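(* Let $(W,S)$ be a Coxeter system with an involutive automorphism $\theta$. Let $\mathcal{L}$ be the set of all $\theta$-stable $J\subseteq S$ such that one of the following holds: \begin{itemize} \item $W_J$ is of type $A_3$ and $\theta_J\neq\mathrm{id}$; \item $W_J$ is of type $B_3$; \item $W_J$ is of type $D_4$ and $\theta_J=\mathrm{id}$; \item $W_J$ is of type $H_3$; \item $W_J$ is of type $I_2(m)$ with $3\le m<\infty$ and $\theta_J=\mathrm{id}$; \item $W_J$ is of type $I_2(m)$ with $2\le m<\infty$ and $\theta_J\neq\mathrm{id}$. \end{itemize} Then the sets $J\in\mathcal{L}$ are sufficient and necessary in the following sense. (Sufficiency) For every $w\in\mathfrak{I}(\theta)$, any two reduced $\underline{S}$-expressions for $w$ can be connected by a finite sequence of braid moves and initial moves that replace $x$ with $y$, where $x,y\in\hat{\mathcal{R}}_\theta(w_0(J))$ for some $J\in\mathcal{L}$. (Necessity) If $\mathcal{K}$ is a set of $\theta$-stable subsets $J\subseteq S$ with $W_J$ finite, such that for every $w\in\mathfrak{I}(\theta)$ any two reduced $\underline{S}$-expressions for $w$ can be connected by a finite sequence of braid moves and initial moves that replace $x$ with $y$, where $x,y\in\hat{\mathcal{R}}_\theta(w_0(J))$ for some $J\in\mathcal{K}$, then $\mathcal{L}\subseteq\mathcal{K}$.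
   Context: Let $(W,S)$ be a Coxeter system; $m(s,s')$ denotes the order of $ss'$ and $e\in W$ the identity. An involutive automorphism $\theta$ of $(W,S)$ is a group automorphism of $W$ with $\theta(S)=S$ and $\theta^2=\mathrm{id}$ (the identity is allowed). The set of twisted involutions is $\mathfrak{I}(\theta)=\{w\in W\mid\theta(w)=w^{-1}\}$. Let $\underline{S}=\{\underline{s}\mid s\in S\}$ be an alphabet in bijection with $S$. The free monoid $\underline{S}^*$ acts from the right on the set $W$ by $w\underline{s}=ws$ if $\theta(s)ws=w$, and $w\underline{s}=\theta(s)ws$ otherwise; $w\underline{s}_1\cdots\underline{s}_k=(\cdots((w\underline{s}_1)\underline{s}_2)\cdots)\underline{s}_k$. The orbit of $e$ is $\mathfrak{I}(\theta)$. A word $[\underline{s}_1\cdots\underline{s}_k]\in\underline{S}^*$ with $e\underline{s}_1\cdots\underline{s}_k=w$ is called an $\underline{S}$-expression for $w$; it is reduced if no $\underline{S}$-expression for $w$ has fewer letters. $\hat{\mathcal{R}}_\theta(w)$ denotes the set of reduced $\underline{S}$-expressions for $w$. A braid move is the replacement, anywhere in a word in $\underline{S}^*$, of a consecutive subword $\underline{s}\,\underline{s}'\underline{s}\cdots$ ($m(s,s')$ letters) by $\underline{s}'\underline{s}\,\underline{s}'\cdots$ ($m(s,s')$ letters), where $s\neq s'$ in $S$ and $m(s,s')<\infty$. An initial move replacing $x$ with $y$, where $x,y\in\hat{\mathcal{R}}_\theta(v)$ for some $v\in\mathfrak{I}(\theta)$, is the replacement of $x$ by $y$ when $x$ is a prefix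 (the beginning) of a reduced $\underline{S}$-expression. For $J\subseteq S$, $W_J$ is the parabolic subgroup generated by $J$, and its type is that of the Coxeter system $(W_J,J)$; $I_2(m)$ is the dihedral type with two generators whose product has order $m$ (so $I_2(2)=A_1\times A_1$). If $W_J$ is finite, $w_0(J)$ denotes its longest element. $J$ is $\theta$-stable if $\theta(J)=J$, and then $\theta_J$ is the restriction of $\theta$ to $W_J$ (so $w_0(J)\in\mathfrak{I}(\theta)$ when $W_J$ is finite). *)

theory Defs
  imports "HOL-Algebra.Multiplicative_Group"
begin

section \<open>Coxeter systems\<close>

(* The order m(s,t) of st.  As for group.ord in general, the value 0 encodes infinite order. *)
definition cox_m :: "('a, 'b) monoid_scheme \<Rightarrow> 'a \<Rightarrow> 'a \<Rightarrow> nat" where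
  "cox_m W s t = group.ord W (s \<otimes>\<^bsub>W\<^esub> t)"

definition word_prod :: "('a, 'b) monoid_scheme \<Rightarrow> 'a list \<Rightarrow> 'a" where
  "word_prod W u = foldr (\<otimes>\<^bsub>W\<^esub>) u \<one>\<^bsub>W\<^esub>"

(* v arises from u by inserting one relator (s t)^m(s,t).  The case s = t inserts s s;
   if m(s,t) is infinite, the inserted word is empty. *)
definition relator_insertion ::
    "('a, 'b) monoid_scheme \<Rightarrow> 'a set \<Rightarrow> 'a list \<Rightarrow> 'a list \<Rightarrow> bool" where
  "relator_insertion W S u v \<longleftrightarrow>
     (\<exists>x\<in>lists S. \<exists>y\<in>lists S. \<exists>s\<in>S. \<exists>t\<in>S.
        u = x @ y \<and> v = x @ concat (replicate (cox_m W s t) [s, t]) @ y)"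

(* W is generated by the set S of elements of order 2, with presentation
   < S | (s t)^m(s,t) = 1 for s, t in S with m(s,t) finite >.  Since the relators include s s,
   no formal inverses are needed: the presented group is the free monoid of words over S
   modulo insertion and deletion of relators.  S may be infinite. *)
locale coxeter_system = group W for W :: "('a, 'b) monoid_scheme" (structure) +
  fixes S :: "'a set"
  assumes S_subset: "S \<subseteq> carrier W"
    and S_order_two: "s \<in> S \<Longrightarrow> ord s = 2"
    and S_generates: "generate W S = carrier W"
    and S_presentation:
      "\<lbrakk>u \<in> lists S; v \<in> lists S\<rbrakk> \<Longrightarrow>
         word_prod W u = word_prod W v \<longleftrightarrow> equivclp (relator_insertion W S) u v"

definition involutive_automorphism ::
    "('a, 'b) monoid_scheme \<Rightarrow> 'a set \<Rightarrow> ('a \<Rightarrow> 'a) \<Rightarrow> bool" where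
  "involutive_automorphism W S \<theta> \<longleftrightarrow>
     \<theta> \<in> iso W W \<and> \<theta> ` S = S \<and> (\<forall>w\<in>carrier W. \<theta> (\<theta> w) = w)"

definition cox_length :: "('a, 'b) monoid_scheme \<Rightarrow> 'a set \<Rightarrow> 'a \<Rightarrow> nat" where
  "cox_length W J w = (LEAST n. \<exists>u\<in>lists J. length u = n \<and> word_prod W u = w)"

(* Meaningful only if the parabolic subgroup generate W J is finite. *)
definition longest_element :: "('a, 'b) monoid_scheme \<Rightarrow> 'a set \<Rightarrow> 'a" where
  "longest_element W J =
     (THE w. w \<in> generate W J \<and> (\<forall>v\<in>generate W J. cox_length W J v \<le> cox_length W J w))"

section \<open>Finite types of parabolic subgroups\<close>

(* The Coxeter graph of J is a path a - b - c whose edges are labelled p and q. *)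
definition path_type3 :: "('a, 'b) monoid_scheme \<Rightarrow> nat \<Rightarrow> nat \<Rightarrow> 'a set \<Rightarrow> bool" where
  "path_type3 W p q J \<longleftrightarrow>
     (\<exists>a b c. distinct [a, b, c] \<and> J = {a, b, c} \<and>
        cox_m W a b = p \<and> cox_m W b c = q \<and> cox_m W a c = 2)"

definition type_A3 :: "('a, 'b) monoid_scheme \<Rightarrow> 'a set \<Rightarrow> bool" where
  "type_A3 W J \<longleftrightarrow> path_type3 W 3 3 J"

definition type_B3 :: "('a, 'b) monoid_scheme \<Rightarrow> 'a set \<Rightarrow> bool" where
  "type_B3 W J \<longleftrightarrow> path_type3 W 3 4 J"

definition type_H3 :: "('a, 'b) monoid_scheme \<Rightarrow> 'a set \<Rightarrow> bool" where
  "type_H3 W J \<longleftrightarrow> path_type3 W 3 5 J"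

definition type_D4 :: "('a, 'b) monoid_scheme \<Rightarrow> 'a set \<Rightarrow> bool" where
  "type_D4 W J \<longleftrightarrow>
     (\<exists>a b c d. distinct [a, b, c, d] \<and> J = {a, b, c, d} \<and>
        cox_m W d a = 3 \<and> cox_m W d b = 3 \<and> cox_m W d c = 3 \<and>
        cox_m W a b = 2 \<and> cox_m W a c = 2 \<and> cox_m W b c = 2)"

definition type_I2 :: "('a, 'b) monoid_scheme \<Rightarrow> nat \<Rightarrow> 'a set \<Rightarrow> bool" where
  "type_I2 W m J \<longleftrightarrow> (\<exists>a b. a \<noteq> b \<and> J = {a, b} \<and> cox_m W a b = m)"

definition trivial_on :: "('a, 'b) monoid_scheme \<Rightarrow> ('a \<Rightarrow> 'a) \<Rightarrow> 'a set \<Rightarrow> bool" where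
  "trivial_on W \<theta> J \<longleftrightarrow> (\<forall>w\<in>generate W J. \<theta> w = w)"

(* Finiteness of m in the two I2 cases is implicit in m >= 2,
   because infinite order is encoded by 0. *)
definition special_subsets ::
    "('a, 'b) monoid_scheme \<Rightarrow> 'a set \<Rightarrow> ('a \<Rightarrow> 'a) \<Rightarrow> 'a set set" where
  "special_subsets W S \<theta> =
     {J. J \<subseteq> S \<and> \<theta> ` J = J \<and>
        (type_A3 W J \<and> \<not> trivial_on W \<theta> J \<or>
         type_B3 W J \<or>
         type_D4 W J \<and> trivial_on W \<theta> J \<or>
         type_H3 W J \<or>
         (\<exists>m\<ge>3. type_I2 W m J \<and> trivial_on W \<theta> J) \<or>
         (\<exists>m\<ge>2. type_I2 W m J \<and> \<not> trivial_on W \<theta> J))}"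

section \<open>Twisted involutions and their reduced expressions\<close>

definition twisted_involutions :: "('a, 'b) monoid_scheme \<Rightarrow> ('a \<Rightarrow> 'a) \<Rightarrow> 'a set" where
  "twisted_involutions W \<theta> = {w \<in> carrier W. \<theta> w = inv\<^bsub>W\<^esub> w}"

(* The underlined letters are identified with the elements of S, so words in the underlined
   alphabet are elements of lists S. *)
definition twisted_act ::
    "('a, 'b) monoid_scheme \<Rightarrow> ('a \<Rightarrow> 'a) \<Rightarrow> 'a \<Rightarrow> 'a \<Rightarrow> 'a" where
  "twisted_act W \<theta> w s =
     (if \<theta> s \<otimes>\<^bsub>W\<^esub> w \<otimes>\<^bsub>W\<^esub> s = w then w \<otimes>\<^bsub>W\<^esub> s else \<theta> s \<otimes>\<^bsub>W\<^esub> w \<otimes>\<^bsub>W\<^esub> s)"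

definition expressions ::
    "('a, 'b) monoid_scheme \<Rightarrow> 'a set \<Rightarrow> ('a \<Rightarrow> 'a) \<Rightarrow> 'a \<Rightarrow> 'a list set" where
  "expressions W S \<theta> w = {u \<in> lists S. foldl (twisted_act W \<theta>) \<one>\<^bsub>W\<^esub> u = w}"

definition reduced_expressions ::
    "('a, 'b) monoid_scheme \<Rightarrow> 'a set \<Rightarrow> ('a \<Rightarrow> 'a) \<Rightarrow> 'a \<Rightarrow> 'a list set" where
  "reduced_expressions W S \<theta> w =
     {u \<in> expressions W S \<theta> w. \<forall>v\<in>expressions W S \<theta> w. length u \<le> length v}"

fun alternating :: "'a \<Rightarrow> 'a \<Rightarrow> nat \<Rightarrow> 'a list" where
  "alternating s t 0 = []"
| "alternating s t (Suc n) = s # alternating t s n"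

definition braid_move ::
    "('a, 'b) monoid_scheme \<Rightarrow> 'a set \<Rightarrow> 'a list \<Rightarrow> 'a list \<Rightarrow> bool" where
  "braid_move W S u u' \<longleftrightarrow>
     (\<exists>p\<in>lists S. \<exists>q\<in>lists S. \<exists>s\<in>S. \<exists>t\<in>S.
        s \<noteq> t \<and> cox_m W s t > 0 \<and>
        u = p @ alternating s t (cox_m W s t) @ q \<and>
        u' = p @ alternating t s (cox_m W s t) @ q)"

(* Replacement of x by y, both reduced expressions for v, at the beginning of the reduced
   expression x @ z (of some twisted involution w). *)
definition initial_move ::
    "('a, 'b) monoid_scheme \<Rightarrow> 'a set \<Rightarrow> ('a \<Rightarrow> 'a) \<Rightarrow> 'a \<Rightarrow> 'a list \<Rightarrow> 'a list \<Rightarrow> bool" where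
  "initial_move W S \<theta> v u u' \<longleftrightarrow>
     (\<exists>x\<in>reduced_expressions W S \<theta> v. \<exists>y\<in>reduced_expressions W S \<theta> v. \<exists>z.
        u = x @ z \<and> u' = y @ z \<and>
        (\<exists>w\<in>twisted_involutions W \<theta>. u \<in> reduced_expressions W S \<theta> w))"

definition move ::
    "('a, 'b) monoid_scheme \<Rightarrow> 'a set \<Rightarrow> ('a \<Rightarrow> 'a) \<Rightarrow> 'a set set \<Rightarrow> 'a list \<Rightarrow> 'a list \<Rightarrow> bool" where
  "move W S \<theta> K u u' \<longleftrightarrow>
     braid_move W S u u' \<or> (\<exists>J\<in>K. initial_move W S \<theta> (longest_element W J) u u')"

definition connects_reduced_expressions ::
    "('a, 'b) monoid_scheme \<Rightarrow> 'a set \<Rightarrow> ('a \<Rightarrow> 'a) \<Rightarrow> 'a set set \<Rightarrow> bool" where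
  "connects_reduced_expressions W S \<theta> K \<longleftrightarrow>
     (\<forall>w\<in>twisted_involutions W \<theta>.
        \<forall>x\<in>reduced_expressions W S \<theta> w. \<forall>y\<in>reduced_expressions W S \<theta> w.
          (move W S \<theta> K)\<^sup>*\<^sup>* x y)"

end

theory Submission
  imports Defs Complex_Main
begin

text \<open>
  Both directions rest on the dihedral chains below a twisted involution \<open>w\<close>. If \<open>s\<close> and \<open>t\<close> are
  descents of \<open>w\<close>, then \<open>w\<close> is reached from a common element \<open>u\<close> along both alternating words in
  \<open>s\<close> and \<open>t\<close> of some length \<open>k \<le> m(s,t)\<close>. If \<open>k = m(s,t)\<close>, a braid move links the expressions of
  \<open>w\<close> ending in \<open>s\<close> with those ending in \<open>t\<close>; the pair is bad if \<open>k < m(s,t)\<close>, which happens exactly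
  when \<open>w{s,t}w\<^sup>-\<^sup>1 = {\<theta>(s),\<theta>(t)}\<close> and the induced action is not that of a commuting pair with
  \<open>ws = \<theta>(s)w\<close>.

  Sufficiency: by induction on the length, the reduced expressions of \<open>w\<close> are connected unless the
  descent set \<open>D\<close> of \<open>w\<close> is a union of nonempty disjoint sets \<open>A\<close>, \<open>B\<close> such that all pairs in
  \<open>A \<times> B\<close> are bad. Then \<open>w\<close> maps the simple roots of \<open>D\<close> to the negatives of those of \<open>\<theta>(D)\<close>, which
  forces \<open>w = w\<^sub>0(D)\<close>: otherwise a descent of the minimal representative of \<open>wW\<^sub>D\<close> would be a further
  descent of \<open>w\<close>. For three or more descents, \<open>wr = \<theta>(r)w\<close> for all \<open>r \<in> D\<close>, and the Coxeter graph
  contains the complete bipartite graph on \<open>A\<close> and \<open>B\<close>. Since \<open>W\<^sub>D\<close> has a longest element, the graph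
  is a star of type \<open>A\<^sub>3\<close>, \<open>B\<^sub>3\<close>, \<open>H\<^sub>3\<close> or \<open>D\<^sub>4\<close>, so a single initial move suffices.

  Necessity: for \<open>J\<close> in the list, \<open>J\<close> splits in the same way into \<open>A\<close> and \<open>B\<close> for \<open>w\<^sub>0(J)\<close>. No braid
  move and no initial move for another \<open>J'\<close> can take an expression of \<open>w\<^sub>0(J)\<close> ending in \<open>A\<close> to one
  ending in \<open>B\<close>.
\<close>


section \<open>Alternating words and Chebyshev values\<close>

text \<open>A presentation says little directly about length, so reducedness is read off from signs
  of roots. The exchange condition enters as \<open>reflection_commute\<close>: if \<open>s\<close>
  lengthens \<open>x\<close> on the right but shortens \<open>i x\<close>, then
  \<open>i x = x s\<close>. With \<open>i\<close> = \<theta>(\<open>s\<close>) this is the dichotomy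
  of the action: a letter multiplies and changes the length by one, or conjugates and changes it by
  two. Applied along a coset it gives the lengths of twisted conjugates. This explains the chain
  lengths. If \<open>u\<close> carries \<open>s\<close>, \<open>t\<close> to
  \<theta>(\<open>s\<close>), \<theta>(\<open>t\<close>) in some order, a conjugating letter puts
  both new factors into one dihedral group behind \<open>u\<close>; its elements have at most
  \<open>m\<close> letters, so about \<open>m/2\<close> steps exhaust it. Otherwise the left and
  right factors stay independent enough for \<open>m\<close> steps. Hence badness can be expressed
  by the conjugation action of \<open>w\<close> on two letters. Both directions use that reducedness
  is local: reduced expressions are the words all of whose letters are ascents, so a braid move can
  be judged inside a single chain.\<close>

lemma alternating_snoc:
  "alternating s t (Suc n) = alternating s t n @ [if even n then s else t]"
  by (induction n arbitrary: s t) auto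

lemma alternating_add:
  "alternating s t (i + j) = alternating s t i @ (if even i then alternating s t j else alternating t s j)"
  by (induction i arbitrary: s t) auto

lemma length_alternating [simp]: "length (alternating s t n) = n"
  by (induction n arbitrary: s t) auto

lemma alternating_in_lists: "s \<in> A \<Longrightarrow> t \<in> A \<Longrightarrow> alternating s t n \<in> lists A"
  by (induction n arbitrary: s t) auto

lemma rev_alternating:
  "rev (alternating s t n) = (if even n then alternating t s n else alternating s t n)"
proof (induction n arbitrary: s t)
  case (Suc n)
  then show ?case
    using alternating_snoc[of t s n] alternating_snoc[of s t n] by (auto split: if_splits)
qed simp

lemma alternating_relator: "alternating s t (2 * n) = concat (replicate n [s, t])"
  by (induction n) auto

text \<open>Shortest words and ascending words in two letters never repeat a letter, so this leaves
  only the two alternating words of each length.\<close>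

lemma alternating_or_repeat:
  assumes "q \<in> lists {s, t}"
  shows "(\<exists>k. q = alternating s t k \<or> q = alternating t s k) \<or>
         (\<exists>a b r. q = a @ [r, r] @ b)"
  using assms
proof (induction q)
  case Nil
  have "[] = alternating s t 0" by simp
  then show ?case by blast
next
  case (Cons x q)
  have alt: ?case if q: "q = alternating a b k" and ab: "{a, b} = {s, t}" for a b k
  proof (cases "x = b \<or> k = 0")
    case True
    then have "x # q = alternating x (if x = s then t else s) (Suc k)" "x \<in> {s, t}"
      using q ab Cons.hyps by (auto simp: doubleton_eq_iff)
    then show ?thesis by (metis insertE singletonD)
  next
    case False
    then obtain n where "x # q = [] @ [a, a] @ alternating b a n"
      using q ab Cons.hyps by (cases k) auto
    then show ?thesis by blast
  qed
  show ?case using Cons.IH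
  proof (elim disjE exE)
    fix a b r assume "q = a @ [r, r] @ b"
    then have "x # q = (x # a) @ [r, r] @ b" by simp
    then show ?thesis by blast
  qed (erule alt, blast)+
qed

text \<open>The Chebyshev polynomial of the second kind \<open>U_(n-1)\<close> at \<open>c\<close>,
  indexed so that \<open>cheb (cos x) n\<close> is \<open>sin (n x) / sin x\<close>. Unlike the
  quotient, the recursion also covers \<open>c = 1\<close>, the value for infinite order.\<close>

fun cheb :: "real \<Rightarrow> nat \<Rightarrow> real" where
  "cheb c 0 = 0"
| "cheb c (Suc 0) = 1"
| "cheb c (Suc (Suc n)) = 2 * c * cheb c (Suc n) - cheb c n"

lemma cheb_sin: "cheb (cos x) n * sin x = sin (real n * x)"
proof (induction "cos x" n rule: cheb.induct)
  case (3 n)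
  have "sin (real (Suc (Suc n)) * x) = sin (real (Suc n) * x + x)"
    by (simp add: algebra_simps)
  moreover have "sin (real n * x) = sin (real (Suc n) * x - x)"
    by (simp add: algebra_simps)
  ultimately have "sin (real (Suc (Suc n)) * x) = 2 * cos x * sin (real (Suc n) * x) - sin (real n * x)"
    by (simp only: sin_add sin_diff) (simp add: algebra_simps)
  then show ?case using 3 by (simp add: algebra_simps)
qed auto

lemma cheb_one: "cheb 1 n = real n"
  by (induction "1::real" n rule: cheb.induct) auto

lemma sin_pi_div_pos: "2 \<le> m \<Longrightarrow> 0 < sin (pi / real m)"
  by (intro sin_gt_zero) (auto simp: field_simps)

text \<open>For \<open>m > 0\<close> the angle \<open>n * pi / m\<close> stays in
  \<open>[0, pi]\<close>. The value \<open>m = 0\<close> stands for infinite order: division by zero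
  turns the angle into 0, and \<open>cheb 1 n = n\<close>.\<close>

lemma cheb_nonneg:
  assumes "m = 0 \<or> n \<le> m" and "m \<noteq> 1"
  shows "0 \<le> cheb (cos (pi / real m)) n"
proof (cases "m = 0")
  case False
  have s: "0 < sin (pi / real m)" using False assms(2) by (intro sin_pi_div_pos) simp
  have "0 \<le> sin (real n * (pi / real m))"
    using False assms(1) by (intro sin_ge_zero) (auto simp: field_simps)
  then have "0 \<le> cheb (cos (pi / real m)) n * sin (pi / real m)" by (simp add: cheb_sin)
  then show ?thesis using s by (simp add: zero_le_mult_iff)
qed (simp add: cheb_one)

lemma cheb_pos:
  assumes "m = 0 \<or> n < m" and "m \<noteq> 1" and "0 < n"
  shows "0 < cheb (cos (pi / real m)) n"
proof (cases "m = 0")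
  case False
  have s: "0 < sin (pi / real m)" using False assms(2) by (intro sin_pi_div_pos) simp
  have "0 < sin (real n * (pi / real m))"
    using False assms by (intro sin_gt_zero) (auto simp: field_simps)
  then have "0 < cheb (cos (pi / real m)) n * sin (pi / real m)" by (simp add: cheb_sin)
  then show ?thesis using s by (simp add: zero_less_mult_iff)
qed (use assms in \<open>simp add: cheb_one\<close>)

text \<open>After \<open>2 * m\<close> steps the angle is \<open>2 * pi\<close>; these two values
  say that a relator restores both coordinates of its plane.\<close>

lemma cheb_period:
  assumes "2 \<le> m"
  shows "cheb (cos (pi / real m)) (2 * m) = 0" "cheb (cos (pi / real m)) (Suc (2 * m)) = 1"
proof -
  have s: "0 < sin (pi / real m)" using assms by (rule sin_pi_div_pos)
  have "real (2 * m) * (pi / real m) = 2 * pi" using assms by simp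
  then have "cheb (cos (pi / real m)) (2 * m) * sin (pi / real m) = 0"
    by (simp only: cheb_sin sin_two_pi)
  then show "cheb (cos (pi / real m)) (2 * m) = 0" using s by simp
  have "real (Suc (2 * m)) * (pi / real m) = 2 * pi + pi / real m"
    using assms by (simp add: field_simps)
  then have "cheb (cos (pi / real m)) (Suc (2 * m)) * sin (pi / real m) = sin (pi / real m)"
    by (simp only: cheb_sin) (simp add: sin_add)
  then show "cheb (cos (pi / real m)) (Suc (2 * m)) = 1" using s by simp
qed

section \<open>The contragredient geometric representation\<close>

lemma word_prod_Nil [simp]: "word_prod W [] = \<one>\<^bsub>W\<^esub>"
  and word_prod_Cons [simp]: "word_prod W (s # u) = s \<otimes>\<^bsub>W\<^esub> word_prod W u"
  by (simp_all add: word_prod_def)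

context coxeter_system
begin

section \<open>Words, length and parity\<close>

abbreviation len :: "'a \<Rightarrow> nat" where "len \<equiv> cox_length W S"
abbreviation wp :: "'a list \<Rightarrow> 'a" where "wp \<equiv> word_prod W"

lemma S_carrier [simp]: "s \<in> S \<Longrightarrow> s \<in> carrier W"
  using S_subset by blast

lemma S_sq [simp]: "s \<in> S \<Longrightarrow> s \<otimes> s = \<one>"
  using pow_ord_eq_1[of s] S_order_two[of s] by (simp add: numeral_2_eq_2)

lemma S_ne_one: "s \<in> S \<Longrightarrow> s \<noteq> \<one>"
  using S_order_two[of s] ord_id by auto

lemma S_inv [simp]: "s \<in> S \<Longrightarrow> inv s = s"
  by (intro inv_equality) auto

lemma S_cancel_right [simp]: "w \<in> carrier W \<Longrightarrow> s \<in> S \<Longrightarrow> w \<otimes> s \<otimes> s = w"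
  by (simp add: m_assoc)

lemma S_cancel_left [simp]: "w \<in> carrier W \<Longrightarrow> s \<in> S \<Longrightarrow> s \<otimes> (s \<otimes> w) = w"
  by (simp flip: m_assoc)

lemma wp_closed [simp]: "u \<in> lists S \<Longrightarrow> wp u \<in> carrier W"
  by (induction u) auto

lemma wp_append: "u \<in> lists S \<Longrightarrow> v \<in> lists S \<Longrightarrow> wp (u @ v) = wp u \<otimes> wp v"
  by (induction u) (auto simp: m_assoc)

lemma wp_rev: "u \<in> lists S \<Longrightarrow> wp (rev u) = inv (wp u)"
  by (induction u) (auto simp: wp_append inv_mult_group in_lists_conv_set)

lemma generate_words:
  assumes "J \<subseteq> S" shows "generate W J = wp ` lists J"
proof
  have J: "lists J \<subseteq> lists S" using assms by (rule lists_mono)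
  show "generate W J \<subseteq> wp ` lists J"
  proof
    fix w assume "w \<in> generate W J"
    then show "w \<in> wp ` lists J"
    proof induction
      case one
      have "\<one> = wp []" by simp
      then show ?case by blast
    next
      case (incl h)
      then show ?case using assms by (intro image_eqI[of _ _ "[h]"]) (auto simp: subset_iff)
    next
      case (inv h)
      then show ?case using assms by (intro image_eqI[of _ _ "[h]"]) (auto simp: subset_iff)
    next
      case (eng h1 h2)
      then obtain u v where "u \<in> lists J" "v \<in> lists J" "h1 = wp u" "h2 = wp v" by blast
      then have "h1 \<otimes> h2 = wp (u @ v)" "u @ v \<in> lists J" using J by (auto simp: wp_append subset_iff)
      then show ?case by blast
    qed
  qed
  show "wp ` lists J \<subseteq> generate W J"
  proof
    fix w assume "w \<in> wp ` lists J"
    then obtain u where u: "u \<in> lists J" "w = wp u" by blast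
    have "wp u \<in> generate W J" using u(1)
      by (induction u) (auto intro: generate.intros)
    then show "w \<in> generate W J" using u by simp
  qed
qed

lemma ex_word: "w \<in> carrier W \<Longrightarrow> \<exists>u\<in>lists S. wp u = w"
  using generate_words[of S] S_generates by force

lemma ex_reduced_word:
  assumes "w \<in> carrier W"
  shows "\<exists>u\<in>lists S. length u = len w \<and> wp u = w"
proof -
  have "\<exists>n. \<exists>u\<in>lists S. length u = n \<and> wp u = w" using ex_word[OF assms] by blast
  then show ?thesis unfolding cox_length_def by (rule LeastI_ex)
qed

lemma len_le: "u \<in> lists S \<Longrightarrow> len (wp u) \<le> length u"
  unfolding cox_length_def by (rule Least_le) blast

lemma len_one [simp]: "len \<one> = 0"
  using len_le[of "[]"] by simp

lemma len_eq_0: "w \<in> carrier W \<Longrightarrow> len w = 0 \<longleftrightarrow> w = \<one>"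
  using ex_reduced_word[of w] by auto

lemma len_mult: "v \<in> carrier W \<Longrightarrow> w \<in> carrier W \<Longrightarrow> len (v \<otimes> w) \<le> len v + len w"
proof -
  assume "v \<in> carrier W" "w \<in> carrier W"
  then obtain a b where "a \<in> lists S" "length a = len v" "wp a = v"
    "b \<in> lists S" "length b = len w" "wp b = w" using ex_reduced_word by meson
  then show ?thesis using len_le[of "a @ b"] by (auto simp: wp_append)
qed

text \<open>All relators have even length, also \<open>s s\<close>. This is what excludes
  \<open>len (w \<otimes> s) = len w\<close>.\<close>

lemma word_parity:
  assumes "u \<in> lists S" "v \<in> lists S" "wp u = wp v"
  shows "even (length u) = even (length v)"
proof -
  have "equivclp (relator_insertion W S) u v" using assms S_presentation by blast
  then show ?thesis
  proof (induction rule: equivclp_induct)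
    case (step y z)
    have *: "length (concat (replicate n [s, t])) = 2 * n" for n and s t :: 'a
      by (induction n) auto
    show ?case using step unfolding relator_insertion_def by (auto simp: *)
  qed simp
qed

lemma len_inv_le: "w \<in> carrier W \<Longrightarrow> len (inv w) \<le> len w"
proof -
  assume "w \<in> carrier W"
  then obtain u where "u \<in> lists S" "length u = len w" "wp u = w" using ex_reduced_word by meson
  then show ?thesis using len_le[of "rev u"] by (auto simp: wp_rev in_lists_conv_set)
qed

lemma len_inv [simp]: "w \<in> carrier W \<Longrightarrow> len (inv w) = len w"
  using len_inv_le[of w] len_inv_le[of "inv w"] by simp

lemma len_S [simp]: assumes "s \<in> S" shows "len s = 1"
proof -
  have "len s \<le> 1" using len_le[of "[s]"] assms by simp
  moreover have "len s \<noteq> 0" using assms S_ne_one len_eq_0 by simp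
  ultimately show ?thesis by simp
qed

lemma len_mult_S:
  assumes "w \<in> carrier W" "s \<in> S"
  shows "len (w \<otimes> s) = Suc (len w) \<or> len w = Suc (len (w \<otimes> s))"
proof -
  have a: "len (w \<otimes> s) \<le> len w + 1" using len_mult[of w s] assms by simp
  have b: "len w \<le> len (w \<otimes> s) + 1" using len_mult[of "w \<otimes> s" s] assms by simp
  obtain u where u: "u \<in> lists S" "length u = len w" "wp u = w" using ex_reduced_word assms by meson
  obtain v where v: "v \<in> lists S" "length v = len (w \<otimes> s)" "wp v = w \<otimes> s"
    using ex_reduced_word[of "w \<otimes> s"] assms by auto
  have "wp (u @ [s]) = wp v" using u v assms by (simp add: wp_append)
  then have "even (length (u @ [s])) = even (length v)" using u v assms by (intro word_parity) auto
  then have "len w \<noteq> len (w \<otimes> s)" using u v by auto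
  then show ?thesis using a b by linarith
qed

lemma len_S_mult:
  assumes "w \<in> carrier W" "s \<in> S"
  shows "len (s \<otimes> w) = Suc (len w) \<or> len w = Suc (len (s \<otimes> w))"
  using len_mult_S[of "inv w" s] len_inv[of "s \<otimes> w"] assms by (simp add: inv_mult_group)

lemma cox_m_sym: "s \<in> S \<Longrightarrow> t \<in> S \<Longrightarrow> cox_m W s t = cox_m W t s"
  unfolding cox_m_def using ord_inv[of "s \<otimes> t"] by (simp add: inv_mult_group)

lemma cox_m_self: "s \<in> S \<Longrightarrow> cox_m W s s = 1"
  unfolding cox_m_def by simp

lemma cox_m_neq_1: "s \<in> S \<Longrightarrow> t \<in> S \<Longrightarrow> s \<noteq> t \<Longrightarrow> cox_m W s t \<noteq> 1"
proof
  assume a: "s \<in> S" "t \<in> S" "s \<noteq> t" "cox_m W s t = 1"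
  then have "s \<otimes> t = \<one>" using pow_ord_eq_1[of "s \<otimes> t"] by (simp add: cox_m_def)
  then have "s \<otimes> t = t \<otimes> t" using a by simp
  then show False using a by (simp only: right_cancel S_carrier)
qed

text \<open>If \<open>s t\<close> has infinite order, then \<open>cox_m W s t = 0\<close> and division by zero gives the correct value \<open>-1\<close>.\<close>

definition bil :: "'a \<Rightarrow> 'a \<Rightarrow> real" where
  "bil s t = - cos (pi / real (cox_m W s t))"

text \<open>The transpose of the reflection sending \<alpha>_t to \<alpha>_t
  \<open>- 2 * bil s t *\<close> \<alpha>_s. Values off \<open>S\<close> are frozen, so that
  relators act as the identity on functions on the whole type.\<close>

definition reflect :: "'a \<Rightarrow> ('a \<Rightarrow> real) \<Rightarrow> 'a \<Rightarrow> real" where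
  "reflect s f = (\<lambda>t. if t \<in> S then f t - 2 * bil s t * f s else f t)"

definition wact :: "('a \<Rightarrow> real) \<Rightarrow> 'a list \<Rightarrow> 'a \<Rightarrow> real" where
  "wact f u = foldl (\<lambda>g s. reflect s g) f u"

lemma wact_Nil [simp]: "wact f [] = f"
  and wact_Cons [simp]: "wact f (s # u) = wact (reflect s f) u"
  and wact_append: "wact f (u @ v) = wact (wact f u) v"
  by (simp_all add: wact_def)

lemma bil_self [simp]: "s \<in> S \<Longrightarrow> bil s s = 1"
  by (simp add: bil_def cox_m_self)

lemma bil_sym: "s \<in> S \<Longrightarrow> t \<in> S \<Longrightarrow> bil s t = bil t s"
  by (simp add: bil_def cox_m_sym)

lemma reflect_self [simp]: "s \<in> S \<Longrightarrow> reflect s f s = - f s"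
  by (simp add: reflect_def)

lemma reflect_reflect [simp]: "s \<in> S \<Longrightarrow> reflect s (reflect s f) = f"
  by (auto simp: reflect_def fun_eq_iff)

lemma reflect_fix: "f s = 0 \<Longrightarrow> reflect s f = f"
  by (auto simp: reflect_def fun_eq_iff)

text \<open>The two coordinates are taken at the letter that comes next and at the other one, so one
  recursion serves both parities.\<close>

lemma wact_alternating:
  assumes "s \<in> S" "t \<in> S" and c: "c = cos (pi / real (cox_m W s t))"
  shows "wact f (alternating s t k) (if even k then s else t) = cheb c (Suc k) * f s + cheb c k * f t"
    and "wact f (alternating s t k) (if even k then t else s) =
         - cheb c k * f s + (cheb c (Suc k) - 2 * c * cheb c k) * f t"
proof (induction k)
  case (Suc k)
  let ?a = "if even k then s else t" and ?b = "if even k then t else s"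
  let ?g = "wact f (alternating s t k)"
  have ab: "?a \<in> S" "?b \<in> S" "bil ?a ?b = - c"
    using assms by (auto simp: bil_def cox_m_sym)
  have g: "wact f (alternating s t (Suc k)) = reflect ?a ?g"
    unfolding alternating_snoc wact_append by simp
  have e: "(if even (Suc k) then s else t) = ?b" "(if even (Suc k) then t else s) = ?a" by auto
  have "reflect ?a ?g ?b = ?g ?b - 2 * bil ?a ?b * ?g ?a" using ab(2) by (simp add: reflect_def)
  then have "reflect ?a ?g ?b = ?g ?b + 2 * c * ?g ?a" unfolding ab(3) by simp
  then show "wact f (alternating s t (Suc k)) (if even (Suc k) then s else t) =
      cheb c (Suc (Suc k)) * f s + cheb c (Suc k) * f t"
    unfolding g e Suc.IH by (simp add: algebra_simps)
  show "wact f (alternating s t (Suc k)) (if even (Suc k) then t else s) =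
      - cheb c (Suc k) * f s + (cheb c (Suc (Suc k)) - 2 * c * cheb c (Suc k)) * f t"
    unfolding g e reflect_self[OF ab(1)] Suc.IH by (simp add: algebra_simps)
qed simp_all

lemma wact_relator:
  assumes st: "s \<in> S" "t \<in> S"
  shows "wact f (concat (replicate (cox_m W s t) [s, t])) = f"
proof (cases "s = t")
  case True
  then show ?thesis using st by (simp add: cox_m_self)
next
  case False
  define m where "m = cox_m W s t"
  define c where "c = cos (pi / real m)"
  show ?thesis
  proof (cases "m = 0")
    case True
    then show ?thesis by (simp add: m_def)
  next
    case m0: False
    have m2: "2 \<le> m" using m0 cox_m_neq_1[OF st False] by (simp add: m_def)
    have bst: "bil s t = - c" "bil t s = - c" using st by (simp_all add: bil_def cox_m_sym c_def m_def)
    define g where "g = wact f (alternating s t (2 * m))"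
    have gs: "g s = f s"
      using wact_alternating(1)[OF st, of c f "2 * m"] cheb_period[OF m2]
      by (simp add: c_def m_def g_def)
    have gt: "g t = f t"
      using wact_alternating(2)[OF st, of c f "2 * m"] cheb_period[OF m2]
      by (simp add: c_def m_def g_def)
    have gr: "g r = f r" if r: "r \<in> S" "r \<noteq> s" "r \<noteq> t" for r
    proof -
      \<comment> \<open>\<open>p\<close> and \<open>q\<close> are the coefficients of the orthogonal
        projection of \<alpha>_r to the plane of \<open>s\<close> and \<open>t\<close>; the Gram
        determinant is \<open>1 - c ^ 2\<close>. The remainder of \<alpha>_r is orthogonal to the
        plane, so \<open>?h\<close> is invariant under both reflections.\<close>
      define p where "p = (bil s r + c * bil t r) / (1 - c ^ 2)"
      define q where "q = (bil t r + c * bil s r) / (1 - c ^ 2)"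
      have "1 - c ^ 2 = (sin (pi / real m)) ^ 2" by (simp add: c_def sin_squared_eq)
      then have nz: "1 - c ^ 2 \<noteq> 0" using sin_pi_div_pos[OF m2] by simp
      have pq: "p - c * q = bil s r" "q - c * p = bil t r"
        using nz by (simp_all add: p_def q_def divide_simps) (simp_all add: algebra_simps power2_eq_square)
      let ?h = "\<lambda>f. f r - p * f s - q * f t"
      have "?h (reflect s f) = ?h f" for f
      proof -
        have "?h (reflect s f) - ?h f = 2 * f s * ((p - c * q) - bil s r)"
          using st r False by (simp add: reflect_def bst algebra_simps)
        then show ?thesis by (simp add: pq)
      qed
      moreover have "?h (reflect t f) = ?h f" for f
      proof -
        have "?h (reflect t f) - ?h f = 2 * f t * ((q - c * p) - bil t r)"
          using st r False by (simp add: reflect_def bst algebra_simps)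
        then show ?thesis by (simp add: pq)
      qed
      ultimately have "?h (wact f u) = ?h f" if "u \<in> lists {s, t}" for u f
        using that by (induction u arbitrary: f) auto
      then have "?h g = ?h f" unfolding g_def by (simp add: alternating_in_lists)
      then show ?thesis using gs gt by simp
    qed
    have out: "wact f u r = f r" if "r \<notin> S" for u r f
      using that by (induction u arbitrary: f) (auto simp: reflect_def)
    have "g = f"
    proof
      fix r show "g r = f r" using gs gt gr[of r] out[of r] by (cases "r \<in> S") (auto simp: g_def)
    qed
    then show ?thesis unfolding g_def alternating_relator m_def .
  qed
qed

lemma wact_well_defined:
  assumes "u \<in> lists S" "v \<in> lists S" "wp u = wp v"
  shows "wact f u = wact f v"
proof -
  have "equivclp (relator_insertion W S) u v" using assms S_presentation by blast
  then show ?thesis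
  proof (induction rule: equivclp_induct)
    case (step y z)
    then show ?case unfolding relator_insertion_def by (auto simp: wact_append wact_relator)
  qed simp
qed

text \<open>A function \<open>f\<close> is read as the linear form with \<open>f(\<alpha>\<^sub>s) = f s\<close>. The right action on linear forms
  gives \<open>act f w s = f(w \<alpha>\<^sub>s)\<close>, so the signs of \<open>act f w s\<close> for nonnegative \<open>f\<close> tell whether the root
  \<open>w \<alpha>\<^sub>s\<close> is positive. In this way no finitely supported vectors are needed when \<open>S\<close> is infinite.\<close>

definition act :: "('a \<Rightarrow> real) \<Rightarrow> 'a \<Rightarrow> 'a \<Rightarrow> real" where
  "act f w = wact f (SOME u. u \<in> lists S \<and> wp u = w)"

lemma act_wp: assumes "u \<in> lists S" shows "act f (wp u) = wact f u"
proof -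
  have "(SOME v. v \<in> lists S \<and> wp v = wp u) \<in> lists S \<and> wp (SOME v. v \<in> lists S \<and> wp v = wp u) = wp u"
    by (rule someI[of _ u]) (use assms in simp)
  then show ?thesis unfolding act_def using assms wact_well_defined by blast
qed

lemma act_one [simp]: "act f \<one> = f"
  using act_wp[of "[]"] by simp

lemma act_S [simp]: "s \<in> S \<Longrightarrow> act f s = reflect s f"
  using act_wp[of "[s]"] by simp

lemma act_mult:
  assumes "v \<in> carrier W" "w \<in> carrier W"
  shows "act f (v \<otimes> w) = act (act f v) w"
proof -
  obtain a b where "a \<in> lists S" "wp a = v" "b \<in> lists S" "wp b = w"
    using ex_word assms by meson
  then show ?thesis using act_wp[of a f] act_wp[of b] act_wp[of "a @ b" f]
    by (auto simp: wp_append wact_append)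
qed

lemma act_lin:
  assumes "w \<in> carrier W"
  shows "act (\<lambda>t. a * f t + b * g t) w s = a * act f w s + b * act g w s"
proof -
  have *: "wact (\<lambda>t. a * f t + b * g t) u = (\<lambda>t. a * wact f u t + b * wact g u t)" for u f g
  proof (induction u arbitrary: f g)
    case (Cons x u)
    have "reflect x (\<lambda>t. a * f t + b * g t) = (\<lambda>t. a * reflect x f t + b * reflect x g t)"
      by (auto simp: reflect_def fun_eq_iff algebra_simps)
    then show ?case using Cons by simp
  qed simp
  show ?thesis unfolding act_def * by simp
qed

lemma wp_alternating_braid:
  assumes "s \<in> S" "t \<in> S"
  shows "wp (alternating s t (cox_m W s t)) = wp (alternating t s (cox_m W s t))"
proof -
  let ?m = "cox_m W s t"
  have l: "alternating s t ?m \<in> lists S" "alternating t s ?m \<in> lists S"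
    using assms by (simp_all only: alternating_in_lists)
  have "alternating s t (?m + ?m) = alternating s t ?m @ rev (alternating t s ?m)"
    unfolding alternating_add rev_alternating by simp
  moreover have "wp (alternating s t (?m + ?m)) = \<one>"
  proof -
    have "wp (concat (replicate n [s, t])) = (s \<otimes> t) [^] n" for n
    proof (induction n)
      case (Suc n)
      have "(s \<otimes> t) [^] Suc n = (s \<otimes> t) \<otimes> (s \<otimes> t) [^] n" using assms by (simp only: nat_pow_Suc2 S_carrier m_closed)
      then show ?case using assms Suc by (simp add: m_assoc)
    qed simp
    then show ?thesis using pow_ord_eq_1[of "s \<otimes> t"] assms alternating_relator[of s t ?m]
      by (simp add: cox_m_def mult_2)
  qed
  ultimately have "wp (alternating s t ?m) \<otimes> inv (wp (alternating t s ?m)) = \<one>"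
    using wp_append[of "alternating s t ?m" "rev (alternating t s ?m)"] l wp_rev[OF l(2)]
    by (simp add: subset_iff lists_eq_set)
  then show ?thesis using l by (metis inv_equality inv_inv wp_closed inv_closed)
qed


section \<open>Descents as signs of roots\<close>

definition desc :: "'a \<Rightarrow> 'a \<Rightarrow> bool" where
  "desc w s \<longleftrightarrow> len (w \<otimes> s) < len w"

lemma desc_len: "w \<in> carrier W \<Longrightarrow> s \<in> S \<Longrightarrow> desc w s \<Longrightarrow> len w = Suc (len (w \<otimes> s))"
  using len_mult_S[of w s] by (auto simp: desc_def)

lemma not_desc_len: "w \<in> carrier W \<Longrightarrow> s \<in> S \<Longrightarrow> \<not> desc w s \<Longrightarrow> len (w \<otimes> s) = Suc (len w)"
  using len_mult_S[of w s] by (auto simp: desc_def)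

lemma desc_mult: "w \<in> carrier W \<Longrightarrow> s \<in> S \<Longrightarrow> desc (w \<otimes> s) s \<longleftrightarrow> \<not> desc w s"
  using len_mult_S[of w s] by (auto simp: desc_def)

lemma not_desc_one: "s \<in> S \<Longrightarrow> \<not> desc \<one> s"
  by (simp add: desc_def)

lemma ex_desc:
  assumes "w \<in> carrier W" "w \<noteq> \<one>"
  shows "\<exists>s\<in>S. desc w s"
proof -
  obtain u where u: "u \<in> lists S" "length u = len w" "wp u = w"
    using ex_reduced_word assms by meson
  with assms(2) have "u \<noteq> []" by auto
  then obtain u1 t where u1: "u = u1 @ [t]" by (meson rev_exhaust)
  with u have t: "t \<in> S" "u1 \<in> lists S" by auto
  then have "w = wp u1 \<otimes> t" using u(3) u1 by (simp add: wp_append)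
  then have "w \<otimes> t = wp u1" using t by simp
  then have "len (w \<otimes> t) < len w" using len_le[OF t(2)] u u1 by simp
  then show ?thesis using t by (auto simp: desc_def)
qed

text \<open>Pick a descent \<open>t\<close> of \<open>w\<close> and write \<open>w = v q\<close> with \<open>q\<close> a word in \<open>s\<close> and \<open>t\<close>, lengths adding up and \<open>v\<close>
  as short as possible. Then \<open>v\<close> has neither descent, \<open>q\<close> is alternating and ends in \<open>t\<close>, and \<open>q \<alpha>\<^sub>s\<close> is
  a nonnegative combination of \<open>\<alpha>\<^sub>s\<close> and \<open>\<alpha>\<^sub>t\<close> with Chebyshev coefficients.\<close>

lemma act_asc_nonneg:
  assumes "w \<in> carrier W" "s \<in> S" "\<not> desc w s" "\<forall>t\<in>S. 0 \<le> f t"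
  shows "0 \<le> act f w s"
  using assms
proof (induction "len w" arbitrary: w s f rule: less_induct)
  case less
  show ?case
  proof (cases "w = \<one>")
    case True
    then show ?thesis using less.prems by simp
  next
    case False
    obtain t where t: "t \<in> S" "desc w t" using ex_desc less.prems(1) False by blast
    define Q where "Q = (\<lambda>(v, q). v \<in> carrier W \<and> q \<in> lists {s, t} \<and> w = v \<otimes> wp q \<and>
       len w = len v + length q)"
    have "Q (w \<otimes> t, [t])" using t less.prems desc_len[of w t] by (simp add: Q_def)
    then obtain x where x: "Q x" "\<forall>y. Q y \<longrightarrow> len (fst x) \<le> len (fst y)"
      using ex_has_least_nat[of Q _ "\<lambda>y. len (fst y)"] by blast
    obtain v q where xvq: "x = (v, q)" by force
    have v: "v \<in> carrier W" and q: "q \<in> lists {s, t}" and wv: "w = v \<otimes> wp q"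
      and lw: "len w = len v + length q" using x(1) by (auto simp: Q_def xvq)
    have vmin: "len v \<le> len v'" if "Q (v', q')" for v' q' using x(2) that by (auto simp: xvq)
    have vw: "len v < len w"
      using vmin[OF \<open>Q (w \<otimes> t, [t])\<close>] desc_len[of w t] t less.prems by simp
    have "s \<noteq> t" using t less.prems by auto
    have qS: "q' \<in> lists S" if "q' \<in> lists {s, t}" for q'
      using that t less.prems by (auto simp: in_lists_conv_set)
    have nd: "\<not> desc v r" if r: "r \<in> {s, t}" for r
    proof
      assume d: "desc v r"
      have rS: "r \<in> S" using r t less.prems by auto
      have "(v \<otimes> r) \<otimes> (r \<otimes> wp q) = v \<otimes> wp q"
        using rS v qS[OF q] by (simp flip: m_assoc)
      then have "Q (v \<otimes> r, r # q)"
        using d r rS v q wv lw desc_len[OF v rS d] by (simp add: Q_def)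
      then show False using vmin desc_len[OF v rS d] by fastforce
    qed
    define g where "g = act f v"
    have gs: "0 \<le> g s" "0 \<le> g t"
      using less.hyps[OF vw v, of _ f] nd less.prems t by (auto simp: g_def)
    have short: "length q \<le> length q'" if "q' \<in> lists S" "w = v \<otimes> wp q'" for q'
      using len_mult[of v "wp q'"] len_le[of q'] that v lw by auto
    have short_s: "length q < length q'" if "q' \<in> lists S" "w \<otimes> s = v \<otimes> wp q'" for q'
      using len_mult[of v "wp q'"] len_le[of q'] that v lw not_desc_len[of w s] less.prems by auto
    \<comment> \<open>If \<open>q\<close> ended in \<open>s\<close>, dropping that letter would
      write \<open>w \<otimes> s\<close> with fewer letters than its length allows.\<close>
    have *: "(if even k then a else b) = s"
      if e: "q = alternating a b k" and ab: "{a, b} = {s, t}" and k: "k = Suc n" for a b k n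
    proof (rule ccontr)
      assume c: "(if even k then a else b) \<noteq> s"
      then have "(if even n then a else b) = s" using ab k by (auto simp: doubleton_eq_iff split: if_splits)
      then have q2: "q = alternating a b n @ [s]" using e k alternating_snoc[of a b n] by simp
      then have al: "alternating a b n \<in> lists S" using qS[OF q] by simp
      have "w \<otimes> s = v \<otimes> wp (alternating a b n)"
        using wv v al less.prems unfolding q2 by (simp add: wp_append flip: m_assoc)
      then show False using short_s[OF al] q2 by simp
    qed
    have "\<exists>a b k. q = alternating a b k \<and> {a, b} = {s, t} \<and> (if even k then a else b) = s"
      using alternating_or_repeat[OF q]
    proof (elim disjE exE)
      fix a b r assume e: "q = a @ [r, r] @ b"
      then have l: "a \<in> lists S" "b \<in> lists S" "r \<in> S" using qS[OF q] by auto
      have "wp q = wp (a @ b)" unfolding e using l by (simp add: wp_append)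
      then have "length q \<le> length (a @ b)" using l wv by (intro short) auto
      then show ?thesis using e by simp
    next
      fix k assume e: "q = alternating s t k"
      have "(if even k then s else t) = s"
      proof (cases k)
        case (Suc n)
        show ?thesis by (rule *[OF e _ Suc]) simp
      qed simp
      then show ?thesis using e by blast
    next
      fix k assume e: "q = alternating t s k"
      show ?thesis
      proof (cases k)
        case 0
        have "q = alternating s t 0" using e 0 by simp
        moreover have "(if even 0 then s else t) = s" by simp
        ultimately show ?thesis by blast
      next
        case (Suc n)
        have "(if even k then t else s) = s" by (rule *[OF e _ Suc]) auto
        moreover have "{t, s} = {s, t}" by auto
        ultimately show ?thesis using e by blast
      qed
    qed
    then obtain a b k where qa: "q = alternating a b k" and ab: "{a, b} = {s, t}"
      and next_s: "(if even k then a else b) = s" by blast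
    have abS: "a \<in> S" "b \<in> S" "a \<noteq> b" using ab \<open>s \<noteq> t\<close> t less.prems by (auto simp: doubleton_eq_iff)
    define m where "m = cox_m W a b"
    \<comment> \<open>With \<open>k \<ge> m > 0\<close> the last \<open>m\<close> letters of
      \<open>q\<close> could be braided so as to end in \<open>s\<close>, and the same contradiction
      arises. With \<open>k < m\<close> both \<open>k\<close> and \<open>Suc k\<close> lie in the
      range where the Chebyshev values are nonnegative.\<close>
    have km: "m = 0 \<or> k < m"
    proof (rule ccontr)
      assume "\<not> ?thesis"
      then obtain n i where n: "m = Suc n" and i: "k = i + m"
        by (metis add.commute le_Suc_ex not_less not0_implies_Suc)
      define a' b' where "a' = (if even i then a else b)" and "b' = (if even i then b else a)"
      have ab': "a' \<in> S" "b' \<in> S" "cox_m W a' b' = m" "cox_m W b' a' = m"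
        using abS by (auto simp: a'_def b'_def m_def cox_m_sym)
      have l: "alternating a b i \<in> lists S" "alternating a' b' m \<in> lists S"
        "alternating b' a' m \<in> lists S" "alternating b' a' n \<in> lists S"
        using abS ab' by (simp_all only: alternating_in_lists)
      have q3: "q = alternating a b i @ alternating a' b' m"
        by (simp add: qa i alternating_add a'_def b'_def)
      have ls: "(if even n then b' else a') = s"
        using next_s n i by (auto simp: a'_def b'_def split: if_splits)
      have "wp q = wp (alternating a b i) \<otimes> wp (alternating a' b' m)"
        unfolding q3 using l by (intro wp_append)
      also have "wp (alternating a' b' m) = wp (alternating b' a' m)"
        using wp_alternating_braid[OF ab'(1,2)] ab' by simp
      also have "\<dots> = wp (alternating b' a' n) \<otimes> s"
        unfolding n alternating_snoc ls using l less.prems by (simp add: wp_append)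
      finally have "w \<otimes> s = v \<otimes> wp (alternating a b i @ alternating b' a' n)"
        using wv v l less.prems by (simp add: wp_append m_assoc)
      then show False using short_s[of "alternating a b i @ alternating b' a' n"] l qa i n by simp
    qed
    have m1: "m \<noteq> 1" using cox_m_neq_1 abS by (simp add: m_def)
    have "act f w s = wact g q s" using v qS[OF q] wv by (simp add: act_mult act_wp g_def)
    also have "\<dots> = cheb (cos (pi / real m)) (Suc k) * g a + cheb (cos (pi / real m)) k * g b"
      using wact_alternating(1)[OF abS(1,2) refl, of g k] next_s by (simp add: qa m_def)
    also have "\<dots> \<ge> 0"
      using km m1 gs ab by (intro add_nonneg_nonneg mult_nonneg_nonneg cheb_nonneg) (auto simp: doubleton_eq_iff)
    finally show ?thesis .
  qed
qed

lemma act_desc_nonpos: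
  assumes "w \<in> carrier W" "s \<in> S" "desc w s" "\<forall>t\<in>S. 0 \<le> f t"
  shows "act f w s \<le> 0"
proof -
  have "0 \<le> act f (w \<otimes> s) s" using assms by (intro act_asc_nonneg) (auto simp: desc_mult)
  then show ?thesis using assms by (simp add: act_mult)
qed

lemma not_descI: "w \<in> carrier W \<Longrightarrow> s \<in> S \<Longrightarrow> \<forall>t\<in>S. 0 \<le> f t \<Longrightarrow> 0 < act f w s \<Longrightarrow> \<not> desc w s"
  using act_desc_nonpos[of w s f] by auto

lemma descI: "w \<in> carrier W \<Longrightarrow> s \<in> S \<Longrightarrow> \<forall>t\<in>S. 0 \<le> f t \<Longrightarrow> act f w s < 0 \<Longrightarrow> desc w s"
  using act_asc_nonneg[of w s f] by auto

text \<open>Every function vanishing on \<open>E\<close> is the difference of its positive and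
  negative parts, which vanish there too. Signs of roots are known only on nonnegative functions;
  this turns them into linear identities.\<close>

lemma act_zero_extend:
  assumes w: "w \<in> carrier W" and s: "s \<in> S"
    and z: "\<And>f. \<forall>t. 0 \<le> f t \<Longrightarrow> \<forall>t\<in>E. f t = 0 \<Longrightarrow> act f w s = 0"
    and f: "\<forall>t\<in>E. f t = 0"
  shows "act f w s = 0"
proof -
  have e: "f = (\<lambda>t. 1 * max (f t) 0 + (- 1) * max (- f t) 0)" by (auto simp: fun_eq_iff max_def)
  then have "act f w s = act (\<lambda>t. 1 * max (f t) 0 + (- 1) * max (- f t) 0) w s" by metis
  also have "\<dots> = 1 * act (\<lambda>t. max (f t) 0) w s + (- 1) * act (\<lambda>t. max (- f t) 0) w s"
    by (rule act_lin[OF w])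
  finally have "act f w s = act (\<lambda>t. max (f t) 0) w s - act (\<lambda>t. max (- f t) 0) w s" by simp
  moreover have "act (\<lambda>t. max (f t) 0) w s = 0" "act (\<lambda>t. max (- f t) 0) w s = 0"
    using f by (auto intro!: z)
  ultimately show ?thesis by simp
qed

lemma act_inv [simp]: "w \<in> carrier W \<Longrightarrow> act (act f w) (inv w) = f"
  "w \<in> carrier W \<Longrightarrow> act (act f (inv w)) w = f"
  by (simp_all flip: act_mult)

lemma act_nonzero:
  assumes "w \<in> carrier W" "s \<in> S"
  shows "\<exists>f. (\<forall>t. 0 \<le> f t) \<and> act f w s \<noteq> 0"
proof (rule ccontr)
  assume "\<not> ?thesis"
  then have z: "act f w s = 0" if "\<forall>t. 0 \<le> f t" for f using that by blast
 have "act (act (\<lambda>_. 1) (inv w)) w s = 0"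
    by (rule act_zero_extend[OF assms, where E = "{}"]) (use z in auto)
  then show False using assms by simp
qed

text \<open>No root is zero, so the two sign conditions exclude each other and become
  equivalences.\<close>

lemma not_desc_iff_act:
  assumes "w \<in> carrier W" "s \<in> S"
  shows "\<not> desc w s \<longleftrightarrow> (\<forall>f. (\<forall>t\<in>S. 0 \<le> f t) \<longrightarrow> 0 \<le> act f w s)"
  using act_asc_nonneg act_desc_nonpos act_nonzero assms by (metis order_antisym)

lemma desc_iff_act:
  assumes "w \<in> carrier W" "s \<in> S"
  shows "desc w s \<longleftrightarrow> (\<forall>f. (\<forall>t\<in>S. 0 \<le> f t) \<longrightarrow> act f w s \<le> 0)"
  using act_asc_nonneg act_desc_nonpos act_nonzero assms by (metis order_antisym)

text \<open>The lifting property. A function vanishing at \<open>i\<close> is fixed by the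
  reflection at \<open>i\<close>, so on it the root \<open>x\<close> \<alpha>_s is both nonnegative
  and nonpositive; hence this root is a multiple of \<alpha>_i. Then \<open>x s x^-1\<close> and
  \<open>i\<close> are reflections in the same root, and their product is the identity because it
  has no descent.\<close>

lemma reflection_commute:
  assumes x: "x \<in> carrier W" and s: "s \<in> S" and i: "i \<in> S"
    and asc: "\<not> desc x s" and ds: "desc (i \<otimes> x) s"
  shows "i \<otimes> x = x \<otimes> s"
proof -
  have z: "act f x s = 0" if "f i = 0" for f
  proof (rule act_zero_extend[OF x s, where E = "{i}"])
    fix h :: "'a \<Rightarrow> real" assume h: "\<forall>t. 0 \<le> h t" "\<forall>t\<in>{i}. h t = 0"
    have "0 \<le> act h x s" using h x s asc by (intro act_asc_nonneg) auto
    moreover have "act h (i \<otimes> x) s \<le> 0" using h x s i ds by (intro act_desc_nonpos) auto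
    moreover have "act h (i \<otimes> x) = act h x" using x i h by (simp add: act_mult reflect_fix)
    ultimately show "act h x s = 0" by simp
  qed (use that in simp)
  define e :: "'a \<Rightarrow> real" where "e = (\<lambda>t. if t = i then 1 else 0)"
  \<comment> \<open>The scalar is only known to be nonzero; this is enough because it cancels in the
    value of \<open>y\<close> at \<open>i\<close>.\<close>
  define l where "l = act e x s"
  have lin: "act f x s = l * f i" for f
  proof -
    have "f = (\<lambda>t. f i * e t + 1 * (if t = i then 0 else f t))" by (auto simp: e_def)
    then have "act f x s = f i * act e x s + 1 * act (\<lambda>t. if t = i then 0 else f t) x s"
      using act_lin[OF x, of "f i" e 1 "\<lambda>t. if t = i then 0 else f t" s] by simp
    then show ?thesis using z[of "\<lambda>t. if t = i then 0 else f t"] by (simp add: l_def)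
  qed
  have l0: "l \<noteq> 0" using act_nonzero[OF x s] lin by auto
  define y where "y = x \<otimes> s \<otimes> inv x \<otimes> i"
  have y: "y \<in> carrier W" using x s i by (simp add: y_def)
  have yact: "act f y = reflect i (act f (x \<otimes> s \<otimes> inv x))" for f
    using x s i by (simp add: y_def act_mult)
  have "\<not> desc y j" if j: "j \<in> S" for j
  proof (rule not_descI[OF y j])
    let ?f = "\<lambda>t. if t = j then 1 else (0::real)"
    show "\<forall>t\<in>S. 0 \<le> ?f t" by simp
    show "0 < act ?f y j"
    proof (cases "j = i")
      case True
      define h where "h = act e (x \<otimes> s \<otimes> inv x)"
      have "act h x = act e (x \<otimes> s)" using x s by (simp add: h_def m_assoc flip: act_mult)
      then have "l * h i = - l" using lin[of h] x s by (simp add: act_mult l_def)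
      then have "l * (h i + 1) = 0" by (simp add: algebra_simps)
      then have "h i = - 1" using l0 by simp
      then show ?thesis using True i by (simp add: yact h_def e_def)
    next
      case False
      then have "act ?f x s = 0" by (intro z) auto
      then have "reflect s (act ?f x) = act ?f x" by (rule reflect_fix)
      then have "act ?f (x \<otimes> s \<otimes> inv x) = ?f" using x s by (simp add: act_mult)
      then show ?thesis using False unfolding yact by (simp add: reflect_fix)
    qed
  qed
  then have "y = \<one>" using ex_desc y by blast
  then have "x \<otimes> s \<otimes> inv x = i" using x s i y_def
    by (metis S_inv inv_equality inv_inv m_closed inv_closed S_carrier)
  then show ?thesis using x s i by (metis inv_solve_right' m_closed S_carrier)
qed

section \<open>Parabolic subgroups and minimal coset representatives\<close>

lemma generate_carrier: "J \<subseteq> S \<Longrightarrow> d \<in> generate W J \<Longrightarrow> d \<in> carrier W"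
  using generate_in_carrier[of J d] S_subset by blast

lemma generate_J: "j \<in> J \<Longrightarrow> j \<in> generate W J"
  by (rule generate.incl)

lemma generate_inv: "J \<subseteq> S \<Longrightarrow> d \<in> generate W J \<Longrightarrow> inv d \<in> generate W J"
  using generate_m_inv_closed[of J d] S_subset by blast

lemmas generate_mult = generate.eng

lemma act_generate_local:
  assumes "J \<subseteq> S" "d \<in> generate W J" "\<And>j. j \<in> J \<Longrightarrow> f j = g j" "s \<in> J"
  shows "act f d s = act g d s"
proof -
  obtain u where u: "u \<in> lists J" "d = wp u" using generate_words assms by blast
  have "wact f u s = wact g u s" using u(1) assms(3,4)
  proof (induction u arbitrary: f g)
    case (Cons x u)
    have "x \<in> J" "f x = g x" using Cons by auto
    then have "wact (reflect x f) u s = wact (reflect x g) u s"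
      using Cons.prems by (intro Cons.IH) (auto simp: reflect_def)
    then show ?case by simp
  qed simp
  moreover have "u \<in> lists S" using u assms(1) lists_mono by blast
  ultimately show ?thesis using u by (simp add: act_wp)
qed

lemma act_generate_fix:
  assumes "J \<subseteq> S" "d \<in> generate W J" "\<And>j. j \<in> J \<Longrightarrow> f j = 0"
  shows "act f d = f"
proof -
  obtain u where u: "u \<in> lists J" "d = wp u" using generate_words assms by blast
  have "wact f u = f" using u(1) assms(3) by (induction u) (auto simp: reflect_fix)
  moreover have "u \<in> lists S" using u assms(1) lists_mono by blast
  ultimately show ?thesis using u by (simp add: act_wp)
qed

text \<open>Inside \<open>W_J\<close> only the values on \<open>J\<close> matter, so
  \<open>f\<close> may be replaced by 0 elsewhere, which makes it nonnegative on all of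
  \<open>S\<close>.\<close>

lemma act_generate_sign:
  assumes J: "J \<subseteq> S" "d \<in> generate W J" "s \<in> J" and f: "\<And>j. j \<in> J \<Longrightarrow> 0 \<le> f j"
  shows "\<not> desc d s \<Longrightarrow> 0 \<le> act f d s" "desc d s \<Longrightarrow> act f d s \<le> 0"
proof -
  let ?g = "\<lambda>t. if t \<in> J then f t else 0"
  have e: "act f d s = act ?g d s" using J by (intro act_generate_local) auto
  have d: "d \<in> carrier W" "s \<in> S" "\<forall>t\<in>S. 0 \<le> ?g t" using J f generate_carrier by auto
  show "\<not> desc d s \<Longrightarrow> 0 \<le> act f d s" using act_asc_nonneg[of d s ?g] d e by simp
  show "desc d s \<Longrightarrow> act f d s \<le> 0" using act_desc_nonpos[of d s ?g] d e by simp
qed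

text \<open>A \<open>v\<close> without descents in \<open>J\<close> takes nonnegative functions to
  functions that are nonnegative on \<open>J\<close>; from there on the sign is decided inside
  \<open>W_J\<close>.\<close>

lemma coset_desc:
  assumes J: "J \<subseteq> S" and v: "v \<in> carrier W" "\<And>j. j \<in> J \<Longrightarrow> \<not> desc v j"
    and d: "d \<in> generate W J" and s: "s \<in> J"
  shows "desc (v \<otimes> d) s \<longleftrightarrow> desc d s"
proof -
  have dc: "d \<in> carrier W" "s \<in> S" using J d s generate_carrier by auto
  have pos: "0 \<le> act f v j" if "\<forall>t\<in>S. 0 \<le> f t" "j \<in> J" for f j
    using act_asc_nonneg[of v j f] v that J by auto
  have "desc (v \<otimes> d) s" if "desc d s"
    using that act_generate_sign(2)[OF J d s] pos v dc by (subst desc_iff_act) (auto simp: act_mult)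
  moreover have "\<not> desc (v \<otimes> d) s" if "\<not> desc d s"
    using that act_generate_sign(1)[OF J d s] pos v dc by (subst not_desc_iff_act) (auto simp: act_mult)
  ultimately show ?thesis by blast
qed

lemma coset_len:
  assumes J: "J \<subseteq> S" and v: "v \<in> carrier W" "\<And>j. j \<in> J \<Longrightarrow> \<not> desc v j"
    and d: "d \<in> generate W J"
  shows "len (v \<otimes> d) = len v + len d"
proof -
  obtain u where u: "u \<in> lists J" "d = wp u" using generate_words J d by blast
  have "len (v \<otimes> wp u) = len v + len (wp u)" using u(1)
  proof (induction u rule: rev_induct)
    case (snoc s u)
    then have s: "s \<in> J" "u \<in> lists J" "s \<in> S" "u \<in> lists S" using J by auto
    have ug: "wp u \<in> generate W J" using generate_words J s by blast
    have "desc (v \<otimes> wp u) s \<longleftrightarrow> desc (wp u) s" using coset_desc J v ug s(1) by blast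
    then have "len (v \<otimes> wp u \<otimes> s) = len v + len (wp u \<otimes> s)"
      using snoc.IH s v not_desc_len[of "wp u" s] not_desc_len[of "v \<otimes> wp u" s]
        desc_len[of "wp u" s] desc_len[of "v \<otimes> wp u" s]
      by (cases "desc (wp u) s") auto
    then show ?case using s v by (simp add: wp_append m_assoc)
  qed (use v in simp)
  then show ?thesis using u by simp
qed

lemma ex_coset_min:
  assumes J: "J \<subseteq> S" and "w \<in> carrier W"
  shows "\<exists>v\<in>carrier W. \<exists>d\<in>generate W J. w = v \<otimes> d \<and> (\<forall>j\<in>J. \<not> desc v j)"
  using assms(2)
proof (induction "len w" arbitrary: w rule: less_induct)
  case less
  show ?case
  proof (cases "\<exists>j\<in>J. desc w j")
    case True
    then obtain j where j: "j \<in> J" "desc w j" "j \<in> S" using J by auto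
    then obtain v d where vd: "v \<in> carrier W" "d \<in> generate W J" "w \<otimes> j = v \<otimes> d" "\<forall>j\<in>J. \<not> desc v j"
      using less.hyps[of "w \<otimes> j"] less.prems by (auto simp: desc_def)
    have dc: "d \<in> carrier W" using J vd generate_carrier by blast
    have "w = v \<otimes> (d \<otimes> j)" using vd j less.prems dc by (metis S_cancel_right S_carrier m_assoc)
    moreover have "d \<otimes> j \<in> generate W J" using vd j by (simp add: generate_mult generate_J)
    ultimately show ?thesis using vd by blast
  next
    case False
    then show ?thesis using less.prems by (intro bexI[of _ w] bexI[of _ \<one>]) (auto intro: generate.one)
  qed
qed

text \<open>Otherwise \<open>d\<close> would be minimal in its coset and \<open>coset_len\<close>
  would give \<open>d \<otimes> inv d\<close> the length \<open>2 * len d\<close>. It follows that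
  the length with respect to \<open>J\<close> is the length with respect to
  \<open>S\<close>.\<close>

lemma generate_ex_desc:
  assumes J: "J \<subseteq> S" and d: "d \<in> generate W J" "d \<noteq> \<one>"
  shows "\<exists>j\<in>J. desc d j"
proof (rule ccontr)
  assume c: "\<not> ?thesis"
  have dc: "d \<in> carrier W" "inv d \<in> generate W J" using J d generate_carrier generate_inv by auto
  have "len (d \<otimes> inv d) = len d + len (inv d)" using c dc J by (intro coset_len) auto
  then show False using dc d len_eq_0 by simp
qed

lemma ex_generate_word:
  assumes J: "J \<subseteq> S" and d: "d \<in> generate W J"
  shows "\<exists>u\<in>lists J. wp u = d \<and> length u = len d"
  using d
proof (induction "len d" arbitrary: d rule: less_induct)
  case less
  have dc: "d \<in> carrier W" using J less.prems generate_carrier by blast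
  show ?case
  proof (cases "d = \<one>")
    case True
    then show ?thesis by (intro bexI[of _ "[]"]) auto
  next
    case False
    then obtain j where j: "j \<in> J" "desc d j" "j \<in> S" using generate_ex_desc J less.prems by blast
    have "d \<otimes> j \<in> generate W J" using j less.prems by (simp add: generate_mult generate_J)
    moreover have "len (d \<otimes> j) < len d" using j by (simp add: desc_def)
    ultimately obtain u where u: "u \<in> lists J" "wp u = d \<otimes> j" "length u = len (d \<otimes> j)"
      using less.hyps by blast
    have "u \<in> lists S" using u(1) J by auto
    then have "wp (u @ [j]) = d" using u j dc by (simp add: wp_append)
    then show ?thesis using u j desc_len[of d j] dc by (intro bexI[of _ "u @ [j]"]) auto
  qed
qed

lemma cox_length_generate:
  assumes J: "J \<subseteq> S" and d: "d \<in> generate W J"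
  shows "cox_length W J d = len d"
  unfolding cox_length_def[of W J]
proof (rule Least_equality)
  show "\<exists>u\<in>lists J. length u = len d \<and> wp u = d" using ex_generate_word[OF J d] by auto
  fix n assume "\<exists>u\<in>lists J. length u = n \<and> wp u = d"
  then obtain u where "u \<in> lists J" "length u = n" "wp u = d" by blast
  moreover from this have "u \<in> lists S" using J by auto
  ultimately show "len d \<le> n" using len_le by blast
qed

lemma generate_len_1:
  assumes J: "J \<subseteq> S" and d: "d \<in> generate W J" "len d = 1"
  shows "d \<in> J"
proof -
  obtain u where u: "u \<in> lists J" "wp u = d" "length u = 1" using ex_generate_word[OF J d(1)] d by auto
  then obtain j where "u = [j]" by (metis One_nat_def length_0_conv length_Suc_conv)
  then show ?thesis using u J by (auto simp: subset_iff)
qed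

section \<open>Longest elements of parabolic subgroups\<close>

definition longest :: "'a set \<Rightarrow> 'a \<Rightarrow> bool" where
  "longest J d \<longleftrightarrow> d \<in> generate W J \<and> (\<forall>j\<in>J. desc d j)"

text \<open>\<open>d\<close> turns nonnegative functions into functions that are nonpositive on
  \<open>J\<close>, so each letter that lengthens \<open>y\<close> shortens
  \<open>d y\<close>.\<close>

lemma longest_len:
  assumes J: "J \<subseteq> S" and d: "longest J d" and y: "y \<in> generate W J"
  shows "len (d \<otimes> y) + len y = len d"
proof -
  have dg: "d \<in> generate W J" "d \<in> carrier W" "\<And>j. j \<in> J \<Longrightarrow> desc d j"
    using d J generate_carrier by (auto simp: longest_def)
  obtain u where u: "u \<in> lists J" "wp u = y" "length u = len y" using ex_generate_word[OF J y] by blast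
  have "len (d \<otimes> wp u) + length u = len d" if "length u = len (wp u)" using u(1) that
  proof (induction u rule: rev_induct)
    case (snoc s u)
    then have s: "s \<in> J" "u \<in> lists J" "s \<in> S" "u \<in> lists S" using J by auto
    have ug: "wp u \<in> generate W J" using generate_words J s by blast
    have e: "wp (u @ [s]) = wp u \<otimes> s" using s by (simp add: wp_append)
    have "len (wp u) \<le> length u" using len_le s by blast
    moreover have "len (wp u \<otimes> s) \<le> len (wp u) + 1" using len_mult[of "wp u" s] s by simp
    ultimately have l: "length u = len (wp u)" "\<not> desc (wp u) s"
      using snoc.prems unfolding e by (auto simp: desc_def)
    have "desc (d \<otimes> wp u) s"
    proof (subst desc_iff_act)
      show "\<forall>f. (\<forall>t\<in>S. 0 \<le> f t) \<longrightarrow> act f (d \<otimes> wp u) s \<le> 0"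
      proof (intro allI impI)
        fix f :: "'a \<Rightarrow> real" assume f: "\<forall>t\<in>S. 0 \<le> f t"
        have neg: "act f d j \<le> 0" if "j \<in> J" for j using act_desc_nonpos[of d j f] f dg that J by auto
        have "0 \<le> act (\<lambda>t. - 1 * act f d t + 0 * act f d t) (wp u) s"
          using neg l by (intro act_generate_sign(1)[OF J ug s(1)]) auto
        then have "act (act f d) (wp u) s \<le> 0" using act_lin[of "wp u" "- 1" "act f d" 0 "act f d" s] s by simp
        then show "act f (d \<otimes> wp u) s \<le> 0" using dg s by (simp add: act_mult)
      qed
    qed (use dg s in auto)
    then show ?case using snoc.IH l s dg desc_len[of "d \<otimes> wp u" s] by (simp add: e m_assoc)
  qed (use dg in simp)
  then show ?thesis using u by simp
qed

lemma longestI_maximal: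
  assumes J: "J \<subseteq> S" and "d \<in> generate W J" "\<And>y. y \<in> generate W J \<Longrightarrow> len y \<le> len d"
  shows "longest J d"
proof -
  have "desc d j" if j: "j \<in> J" for j
  proof -
    have "len (d \<otimes> j) \<le> len d" using assms j by (simp add: generate_mult generate_J)
    then show ?thesis using len_mult_S[of d j] j J assms generate_carrier by (auto simp: desc_def)
  qed
  then show ?thesis using assms by (simp add: longest_def)
qed

lemma longest_maximal:
  assumes J: "J \<subseteq> S" and d: "longest J d" and y: "y \<in> generate W J"
  shows "len y \<le> len d"
  using longest_len[OF J d y] by linarith

lemma longest_unique:
  assumes J: "J \<subseteq> S" and d: "longest J d" "longest J d'"
  shows "d = d'"
proof -
  have g: "d \<in> generate W J" "d' \<in> generate W J" "d \<in> carrier W" "d' \<in> carrier W"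
    using J d generate_carrier by (auto simp: longest_def)
  let ?y = "inv d \<otimes> d'"
  have "?y \<in> generate W J" using g J by (simp add: generate_mult generate_inv)
  then have "len (d \<otimes> ?y) + len ?y = len d" by (rule longest_len[OF J d(1)])
  moreover have "d \<otimes> ?y = d'" using g by (simp flip: m_assoc)
  ultimately have "len d' + len ?y = len d" by simp
  moreover have "len d \<le> len d'" using longest_maximal J d g by blast
  ultimately have "?y = \<one>" using g len_eq_0[of ?y] by simp
  then show ?thesis using g by (metis inv_equality inv_inv inv_closed)
qed

lemma longest_inv:
  assumes J: "J \<subseteq> S" and d: "longest J d"
  shows "inv d = d"
proof (rule longest_unique[OF J _ d])
  have "d \<in> generate W J" "d \<in> carrier W" using J d generate_carrier by (auto simp: longest_def)
  then show "longest J (inv d)"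
    using longest_maximal[OF J d] J by (intro longestI_maximal) (auto intro: generate_inv)
qed

text \<open>Translates the characterisation by descents, which is what the chains supply, into
  maximal length with respect to \<open>J\<close>.\<close>

lemma longest_element_eq:
  assumes J: "J \<subseteq> S" and d: "longest J d"
  shows "longest_element W J = d"
  unfolding longest_element_def
proof (rule the_equality)
  show "d \<in> generate W J \<and> (\<forall>v\<in>generate W J. cox_length W J v \<le> cox_length W J d)"
    using d longest_maximal[OF J d] cox_length_generate[OF J] by (auto simp: longest_def)
  fix w assume w: "w \<in> generate W J \<and> (\<forall>v\<in>generate W J. cox_length W J v \<le> cox_length W J w)"
  then have "longest J w" using cox_length_generate[OF J] by (intro longestI_maximal[OF J]) auto
  then show "w = d" using longest_unique J d by blast
qed

lemma finite_longest:
  assumes J: "J \<subseteq> S" and fin: "finite (generate W J)"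
  shows "\<exists>d. longest J d"
proof -
  have ne: "generate W J \<noteq> {}" using generate.one by fast
  have "Max (len ` generate W J) \<in> len ` generate W J" using fin ne by (intro Max_in) auto
  then obtain d where "d \<in> generate W J" "len d = Max (len ` generate W J)" by auto
  then show ?thesis using fin by (intro exI[of _ d] longestI_maximal[OF J]) auto
qed

text \<open>\<open>d r\<close> is one shorter than \<open>d\<close>, so its inverse is not the
  longest element and some \<open>j\<close> lengthens \<open>d r\<close> on the left. Then
  \<open>j d r\<close> is as long as \<open>d\<close> but has the descent \<open>r\<close>, and
  lifting gives \<open>j d r = d\<close>.\<close>

lemma longest_conj:
  assumes J: "J \<subseteq> S" and d: "longest J d" and r: "r \<in> J"
  shows "\<exists>r'\<in>J. d \<otimes> r = r' \<otimes> d"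
proof -
  have g: "d \<in> generate W J" "d \<in> carrier W" "r \<in> S" "desc d r"
    using J d r generate_carrier by (auto simp: longest_def)
  define x where "x = d \<otimes> r"
  have x: "x \<in> generate W J" "x \<in> carrier W" "len d = Suc (len x)" "x \<otimes> r = d"
    using g r desc_len[of d r] by (auto simp: x_def generate_mult generate_J)
  have "\<exists>j\<in>J. \<not> len (j \<otimes> x) < len x"
  proof (rule ccontr)
    assume "\<not> ?thesis"
    then have lt: "len (j \<otimes> x) < len x" if "j \<in> J" for j using that by blast
    have "longest J (inv x)" unfolding longest_def desc_def
    proof (intro conjI ballI)
      show "inv x \<in> generate W J" using x J generate_inv by blast
      fix j assume "j \<in> J"
      moreover from this have "inv x \<otimes> j = inv (j \<otimes> x)" using x J by (auto simp: inv_mult_group)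
      ultimately show "len (inv x \<otimes> j) < len (inv x)" using lt[of j] x J by auto
    qed
    then have "inv x = d" using longest_unique J d by blast
    then show False using x by (metis len_inv n_not_Suc_n)
  qed
  then obtain j where j: "j \<in> J" "\<not> len (j \<otimes> x) < len x" "j \<in> S" using J by blast
  have jx: "len (j \<otimes> x) = len d" using len_S_mult[of x j] j x by auto
  have "len (j \<otimes> d) < len d"
  proof -
    have "desc (inv d) j" using longest_inv[OF J d] d j by (simp add: longest_def)
    moreover have "inv d \<otimes> j = inv (j \<otimes> d)" using g j by (simp add: inv_mult_group)
    ultimately show ?thesis using g j by (simp add: desc_def)
  qed
  then have "desc (j \<otimes> x) r" using jx x j g by (simp add: desc_def m_assoc)
  moreover have "\<not> desc x r" using x by (simp add: desc_def)
  ultimately have "j \<otimes> x = d" using reflection_commute[of x r j] x j g by simp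
  then have "d \<otimes> r = j \<otimes> d" using x j g by (simp flip: x_def) (metis S_cancel_left)
  then show ?thesis using j by blast
qed

lemma longestI_act:
  assumes J: "J \<subseteq> S" and p: "p \<in> generate W J" "\<And>j. j \<in> J \<Longrightarrow> act (\<lambda>_. 1) p j < 0"
  shows "longest J p"
  unfolding longest_def
proof (intro conjI ballI)
  fix j assume "j \<in> J"
  then show "desc p j" using p J generate_carrier by (intro descI[of p j "\<lambda>_. 1"]) auto
qed (use p in simp)

text \<open>The indicator function of a letter outside \<open>J\<close> is fixed by
  \<open>W_J\<close>, so that letter stays an ascent. Consequently the longest element determines
  \<open>J\<close>.\<close>

lemma longest_descents:
  assumes J: "J \<subseteq> S" and p: "longest J p" and r: "r \<in> S"
  shows "desc p r \<longleftrightarrow> r \<in> J"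
proof
  show "r \<in> J \<Longrightarrow> desc p r" using p by (simp add: longest_def)
  have pg: "p \<in> generate W J" "p \<in> carrier W" using J p generate_carrier by (auto simp: longest_def)
  show "r \<in> J" if "desc p r"
  proof (rule ccontr)
    assume rJ: "r \<notin> J"
    let ?f = "\<lambda>t. if t = r then 1 else (0::real)"
    have "act ?f p = ?f" using J pg rJ by (intro act_generate_fix) auto
    then have "\<not> desc p r" using pg r by (intro not_descI[of p r ?f]) auto
    then show False using that by simp
  qed
qed

text \<open>The hypothesis says that \<open>p\<close> sends \<alpha>_j to -\<alpha>_i. Then
  \<open>i p\<close> sends \<alpha>_j to \<alpha>_i, and lifting applies to
  \<open>x = i p\<close>.\<close>

lemma conj_of_act:
  assumes p: "p \<in> carrier W" and ij: "i \<in> S" "j \<in> S"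
    and act: "\<And>f. act f p j = - f i"
  shows "p \<otimes> j = i \<otimes> p"
proof -
  define x where "x = i \<otimes> p"
  have x: "x \<in> carrier W" "i \<otimes> x = p" using p ij by (auto simp: x_def)
  have "\<not> desc x j"
    using x ij p by (intro not_descI[of x j "\<lambda>_. 1"]) (auto simp: x_def act_mult act)
  moreover have "desc (i \<otimes> x) j"
    unfolding x(2) using p ij by (intro descI[of p j "\<lambda>_. 1"]) (auto simp: act)
  ultimately have "i \<otimes> x = x \<otimes> j" using reflection_commute x ij by blast
  then have "p = i \<otimes> p \<otimes> j" using x by (simp add: x_def)
  then have "p \<otimes> j = i \<otimes> p \<otimes> j \<otimes> j" by simp
  then show ?thesis using p ij by simp
qed

section \<open>Restrictions on the diagram and on the shape of elements with many descents\<close>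

lemma bil_nonpos: "s \<in> S \<Longrightarrow> t \<in> S \<Longrightarrow> s \<noteq> t \<Longrightarrow> bil s t \<le> 0"
proof -
  assume "s \<in> S" "t \<in> S" "s \<noteq> t"
  then have "cox_m W s t \<noteq> 1" by (rule cox_m_neq_1)
  then have "pi / real (cox_m W s t) \<le> pi / 2"
    by (cases "cox_m W s t = 0") (auto simp: divide_simps)
  moreover have "0 \<le> pi / real (cox_m W s t)" by simp
  moreover have "- (pi / 2) \<le> 0" by simp
  ultimately have "0 \<le> cos (pi / real (cox_m W s t))" by (intro cos_ge_zero) linarith+
  then show ?thesis by (simp add: bil_def)
qed

text \<open>The vector \<open>\<Sum>\<^sub>j x\<^sub>j \<alpha>\<^sub>j\<close> pairs nonpositively with all simple roots, so it can only grow under \<open>W\<close>,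
  whereas \<open>w\<close> would make it nonpositive. This excludes the affine and the indefinite diagrams.\<close>

lemma no_descents_if_nonpositive:
  assumes F: "finite F" "F \<subseteq> S" "F \<noteq> {}" and x: "\<And>j. j \<in> F \<Longrightarrow> 0 < x j"
    and neg: "\<And>s. s \<in> F \<Longrightarrow> (\<Sum>j\<in>F. x j * bil s j) \<le> 0"
    and w: "w \<in> carrier W" "\<And>j. j \<in> F \<Longrightarrow> desc w j"
  shows False
proof -
  \<comment> \<open>Letters outside \<open>F\<close> satisfy the inequality for free, since distinct
    simple roots have nonpositive product.\<close>
  have neg': "(\<Sum>j\<in>F. x j * bil s j) \<le> 0" if s: "s \<in> S" for s
  proof (cases "s \<in> F")
    case False
    then show ?thesis using s F x by (intro sum_nonpos mult_nonneg_nonpos bil_nonpos) (auto intro: less_imp_le)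
  qed (rule neg)
  have inc: "(\<Sum>j\<in>F. x j * f j) \<le> (\<Sum>j\<in>F. x j * act f u j)"
    if "u \<in> carrier W" "\<forall>t\<in>S. 0 \<le> f t" for u f
    using that
  proof (induction "len u" arbitrary: u rule: less_induct)
    case less
    show ?case
    proof (cases "u = \<one>")
      case False
      then obtain s where s: "s \<in> S" "desc u s" using ex_desc less.prems by blast
      define v where "v = u \<otimes> s"
      have v: "v \<in> carrier W" "len v < len u" "\<not> desc v s" "u = v \<otimes> s"
        using s less.prems by (auto simp: v_def desc_mult) (simp add: desc_def)
      define g where "g = act f v"
      have gs: "0 \<le> g s" unfolding g_def using v s less.prems by (intro act_asc_nonneg) auto
      have "act f u = reflect s g" unfolding v(4) g_def using v s by (simp add: act_mult)
      then have "(\<Sum>j\<in>F. x j * act f u j) = (\<Sum>j\<in>F. x j * g j - 2 * g s * (x j * bil s j))"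
        using F by (intro sum.cong) (auto simp: reflect_def algebra_simps)
      also have "\<dots> = (\<Sum>j\<in>F. x j * g j) - 2 * g s * (\<Sum>j\<in>F. x j * bil s j)"
        by (simp add: sum_subtractf sum_distrib_left)
      also have "\<dots> \<ge> (\<Sum>j\<in>F. x j * g j)"
        using gs neg'[OF s(1)] by (simp add: mult_nonneg_nonpos)
      finally show ?thesis using less.hyps[OF v(2,1) less.prems(2)] by (simp add: g_def)
    qed simp
  qed
  have "(\<Sum>j\<in>F. x j * 1) \<le> (\<Sum>j\<in>F. x j * act (\<lambda>_. 1) w j)" using inc[of w "\<lambda>_. 1"] w by simp
  also have "\<dots> \<le> 0"
    using x w F act_desc_nonpos[of w _ "\<lambda>_. 1"] by (intro sum_nonpos mult_nonneg_nonpos) (auto intro: less_imp_le)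
  finally have "(\<Sum>j\<in>F. x j) \<le> 0" by simp
  moreover have "0 < (\<Sum>j\<in>F. x j)" using F x by (intro sum_pos) auto
  ultimately show False by simp
qed

lemma longest_if_descents_permuted:
  assumes w: "w \<in> carrier W" and D: "D = {s \<in> S. desc w s}"
    and perm: "\<And>r. r \<in> D \<Longrightarrow> \<exists>i\<in>S. w \<otimes> r = i \<otimes> w"
  shows "longest D w"
proof -
  have DS: "D \<subseteq> S" using D by auto
  obtain v d where vd: "v \<in> carrier W" "d \<in> generate W D" "w = v \<otimes> d" and vmin: "\<And>j. j \<in> D \<Longrightarrow> \<not> desc v j"
    using ex_coset_min[OF DS w] by blast
  have dc: "d \<in> carrier W" using DS vd generate_carrier by blast
  have dl: "longest D d" unfolding longest_def
  proof (intro conjI ballI)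
    fix j assume j: "j \<in> D"
    then have "desc (v \<otimes> d) j" unfolding vd(3)[symmetric] using D by blast
    then show "desc d j" using coset_desc[OF DS vd(1) vmin vd(2) j] by blast
  qed (rule vd(2))
  have vperm: "\<exists>i\<in>S. v \<otimes> j = i \<otimes> v" if j: "j \<in> D" for j
  proof -
    obtain r where r: "r \<in> D" "d \<otimes> j = r \<otimes> d" using longest_conj[OF DS dl j] by blast
    have rj: "r \<in> S" "j \<in> S" using r j DS by auto
    have "d \<otimes> r = j \<otimes> d"
    proof -
      have "inv (d \<otimes> j) = inv (r \<otimes> d)" using r by simp
      then show ?thesis using dc rj longest_inv[OF DS dl] by (simp add: inv_mult_group)
    qed
    obtain i where i: "i \<in> S" "w \<otimes> r = i \<otimes> w" using perm r by blast
    have "v \<otimes> j \<otimes> d = v \<otimes> (j \<otimes> d)" using vd(1) dc rj by (simp add: m_assoc)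
    also have "\<dots> = w \<otimes> r" using vd(1,3) dc rj \<open>d \<otimes> r = j \<otimes> d\<close>[symmetric] by (simp add: m_assoc)
    also have "\<dots> = i \<otimes> v \<otimes> d" unfolding i(2) using vd(1,3) dc i(1) by (simp add: m_assoc)
    finally have "v \<otimes> j \<otimes> d = i \<otimes> v \<otimes> d" .
    then have "v \<otimes> j = i \<otimes> v" using i(1) vd(1) dc rj by (metis S_carrier m_closed right_cancel)
    then show ?thesis using i(1) by blast
  qed
  have "v = \<one>"
  proof (rule ccontr)
    assume "v \<noteq> \<one>"
    then obtain r where r: "r \<in> S" "desc v r" using ex_desc vd by blast
    then have rD: "r \<notin> D" using vmin by blast
    \<comment> \<open>\<open>E\<close> collects the conjugates \<open>v j v^-1\<close> with
      \<open>j\<close> in \<open>D\<close>; they are letters because \<open>w\<close> conjugates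
      \<open>D\<close> into \<open>S\<close> and \<open>d\<close> permutes \<open>D\<close>.\<close>
    define E where "E = {i \<in> S. \<exists>j\<in>D. v \<otimes> j = i \<otimes> v}"
    have z: "act f v j = 0" if f: "\<forall>i\<in>E. f i = 0" and j: "j \<in> D" for f j
    proof -
      obtain i where i: "i \<in> S" "v \<otimes> j = i \<otimes> v" using vperm j by blast
      then have "f i = 0" using f j by (auto simp: E_def)
      then have "act f (v \<otimes> j) = act f v" unfolding i(2) using i vd by (simp add: act_mult reflect_fix)
      moreover have "j \<in> S" using j DS by auto
      ultimately have "reflect j (act f v) j = act f v j" using vd by (simp add: act_mult)
      then show ?thesis using \<open>j \<in> S\<close> by simp
    qed
    \<comment> \<open>On functions vanishing on \<open>E\<close>, the elements \<open>w\<close> and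
      \<open>v\<close> act alike, because the factor \<open>d\<close> fixes functions vanishing on
      \<open>D\<close>. There \<open>r\<close> is an ascent of \<open>w\<close> and a descent of
      \<open>v\<close>, which leaves only the value zero.\<close>
    have zr: "act f v r = 0" if f: "\<forall>i\<in>E. f i = 0" for f
    proof (rule act_zero_extend[where E = E])
      fix h :: "'a \<Rightarrow> real" assume h: "\<forall>t. 0 \<le> h t" "\<forall>t\<in>E. h t = 0"
      have "act h w = act h v" using vd dc z[OF h(2)] act_generate_fix[OF DS vd(2)] by (simp add: act_mult)
      moreover have "0 \<le> act h w r" using h r rD D w by (intro act_asc_nonneg) auto
      moreover have "act h v r \<le> 0" using h r vd by (intro act_desc_nonpos) auto
      ultimately show "act h v r = 0" by simp
    qed (use vd r f in auto)
    \<comment> \<open>Pulled back through \<open>v\<close>, the indicator of \<open>r\<close>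
      vanishes on \<open>E\<close>, yet its value at \<open>r\<close> is 1: \<alpha>_r does not lie
      in the span of the simple roots of \<open>D\<close>.\<close>
    define h :: "'a \<Rightarrow> real" where "h = (\<lambda>t. if t = r then 1 else 0)"
    define f where "f = act h (inv v)"
    have fv: "act f v = h" using vd by (simp add: f_def)
    have "f i = 0" if i: "i \<in> E" for i
    proof -
      obtain j where j: "j \<in> D" "v \<otimes> j = i \<otimes> v" "i \<in> S" using i by (auto simp: E_def)
      have jS: "j \<in> S" using j DS by auto
      have hj: "reflect j h = h" using j rD by (intro reflect_fix) (auto simp: h_def)
      have "act (reflect i f) v = act f (i \<otimes> v)" using j(3) vd(1) by (simp add: act_mult)
      also have "\<dots> = act f (v \<otimes> j)" using j(2) by simp
      also have "\<dots> = act f v" using jS vd(1) fv hj by (simp add: act_mult)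
      finally have "act (reflect i f) v = act f v" .
      then have "act (act (reflect i f) v) (inv v) = act (act f v) (inv v)" by simp
      then have "reflect i f = f" using vd by simp
      then have "reflect i f i = f i" by simp
      then show ?thesis using j by simp
    qed
    then have "act f v r = 0" using zr by blast
    then show False unfolding fv by (simp add: h_def)
  qed
  then show ?thesis using vd dl dc by simp
qed

text \<open>Read \<open>d\<close> letter by letter behind \<open>u\<close>. At the letter
  \<open>s\<close> where \<open>i\<close> becomes a left descent, lifting turns \<open>i\<close>
  into right multiplication by \<open>s\<close>, so \<open>u^-1 i u\<close> lies in
  \<open>W_J\<close>; comparing lengths, it is a single letter.\<close>

lemma left_desc_coset:
  assumes J: "J \<subseteq> S" and u: "u \<in> carrier W" "\<And>j. j \<in> J \<Longrightarrow> \<not> desc u j"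
    and i: "i \<in> S" "len u < len (i \<otimes> u)"
    and d: "d \<in> generate W J" and lt: "len (i \<otimes> (u \<otimes> d)) < len (u \<otimes> d)"
  shows "\<exists>r\<in>J. i \<otimes> u = u \<otimes> r \<and> len (r \<otimes> d) < len d"
proof -
  have dc: "d \<in> carrier W" using J d generate_carrier by blast
  obtain q where q: "q \<in> lists J" "wp q = d" "length q = len d" using ex_generate_word[OF J d] by blast
  have "\<exists>p\<in>generate W J. i \<otimes> u = u \<otimes> p"
    if "q \<in> lists J" "length q = len (wp q)" "len (i \<otimes> (u \<otimes> wp q)) < len (u \<otimes> wp q)" for q
    using that
  proof (induction q rule: rev_induct)
    case Nil
    then show ?case using i u by simp
  next
    case (snoc s q)
    then have s: "s \<in> J" "q \<in> lists J" "s \<in> S" "q \<in> lists S" using J by auto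
    have qg: "wp q \<in> generate W J" using generate_words J s by blast
    have e: "wp (q @ [s]) = wp q \<otimes> s" using s by (simp add: wp_append)
    have "len (wp q) \<le> length q" using len_le s by blast
    moreover have "len (wp q \<otimes> s) \<le> len (wp q) + 1" using len_mult[of "wp q" s] s by simp
    ultimately have l: "length q = len (wp q)" "\<not> desc (wp q) s"
      using snoc.prems unfolding e by (auto simp: desc_def)
    define x where "x = u \<otimes> wp q"
    have x: "x \<in> carrier W" using u s by (simp add: x_def)
    show ?case
    proof (cases "len (i \<otimes> x) < len x")
      case True
      then show ?thesis using snoc.IH l s by (simp add: x_def)
    next
      case False
      have xs: "\<not> desc x s" unfolding x_def using coset_desc[OF J u qg s(1)] l by blast
      have ix: "len (i \<otimes> x) = Suc (len x)" using False len_S_mult[OF x i(1)] by auto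
      have "len (i \<otimes> (x \<otimes> s)) < len (x \<otimes> s)" using snoc.prems e u s by (simp add: x_def m_assoc)
      then have "desc (i \<otimes> x) s" using ix not_desc_len[OF x s(3) xs] x s i by (simp add: desc_def m_assoc)
      then have "i \<otimes> x = x \<otimes> s" using reflection_commute x s i xs by blast
      then have "i \<otimes> u \<otimes> wp q = u \<otimes> wp q \<otimes> s" using u s i by (simp add: x_def m_assoc)
      then have "i \<otimes> u = u \<otimes> wp q \<otimes> s \<otimes> inv (wp q)"
        using u s i by (metis S_carrier inv_solve_right m_closed wp_closed)
      then have "i \<otimes> u = u \<otimes> (wp q \<otimes> s \<otimes> inv (wp q))" using u s by (simp add: m_assoc)
      moreover have "wp q \<otimes> s \<otimes> inv (wp q) \<in> generate W J"
        using qg s J by (simp add: generate_mult generate_J generate_inv)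
      ultimately show ?thesis by blast
    qed
  qed
  then obtain p where p: "p \<in> generate W J" "i \<otimes> u = u \<otimes> p" using q lt by blast
  have pc: "p \<in> carrier W" using J p generate_carrier by blast
  have "len (i \<otimes> u) = len u + len p" using coset_len[OF J u p(1)] p by simp
  moreover have "len (i \<otimes> u) = Suc (len u)" using i len_S_mult[OF u(1) i(1)] by auto
  ultimately have "len p = 1" by simp
  then have pJ: "p \<in> J" using generate_len_1 J p by blast
  have "i \<otimes> (u \<otimes> d) = u \<otimes> (p \<otimes> d)" using p u dc pc i by (simp flip: m_assoc)
  moreover have "p \<otimes> d \<in> generate W J" using p d by (simp add: generate_mult)
  ultimately have "len p + 0 \<le> 1 \<and> len u + len (p \<otimes> d) < len u + len d"
    using lt coset_len[OF J u] d \<open>len p = 1\<close> by simp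
  then show ?thesis using pJ p by auto
qed

section \<open>Products of alternating words\<close>

abbreviation altp :: "'a \<Rightarrow> 'a \<Rightarrow> nat \<Rightarrow> 'a" where "altp s t n \<equiv> wp (alternating s t n)"

lemma alternating_S: "s \<in> S \<Longrightarrow> t \<in> S \<Longrightarrow> alternating s t n \<in> lists S"
  by (rule alternating_in_lists)

lemma altp_closed [simp]: "s \<in> S \<Longrightarrow> t \<in> S \<Longrightarrow> altp s t n \<in> carrier W"
  by (simp add: alternating_S)

lemma altp_Suc_right:
  "s \<in> S \<Longrightarrow> t \<in> S \<Longrightarrow> altp s t (Suc n) = altp s t n \<otimes> (if even n then s else t)"
  by (subst alternating_snoc) (auto simp: wp_append alternating_S)

lemma altp_generate: "altp s t n \<in> generate W {s, t}"
proof (induction n arbitrary: s t)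
  case (Suc n)
  have "altp t s n \<in> generate W {s, t}" using Suc[of t s] by (simp add: insert_commute)
  then show ?case by (simp add: generate_mult generate_J)
qed (simp add: generate.one)

text \<open>The next letter is an ascent because its root has the coefficients
  \<open>cheb c (Suc n)\<close> and \<open>cheb c n\<close>, whose sum is positive in this
  range.\<close>

lemma altp_len:
  assumes st: "s \<in> S" "t \<in> S" "s \<noteq> t" and n: "cox_m W s t = 0 \<or> n \<le> cox_m W s t"
  shows "len (altp s t n) = n"
  using n
proof (induction n)
  case (Suc n)
  let ?r = "if even n then s else t" and ?c = "cos (pi / real (cox_m W s t))"
  have r: "?r \<in> S" using st by simp
  have m1: "cox_m W s t \<noteq> 1" using cox_m_neq_1 st by blast
  have "act (\<lambda>_. 1) (altp s t n) ?r = cheb ?c (Suc n) + cheb ?c n"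
    using wact_alternating(1)[OF st(1,2) refl, of "\<lambda>_. 1" n] by (simp add: act_wp alternating_S st)
  also have "\<dots> > 0"
  proof (cases "n = 0")
    case False
    then show ?thesis using Suc.prems m1 cheb_pos[of "cox_m W s t" n] cheb_nonneg[of "cox_m W s t" "Suc n"]
      by (intro add_nonneg_pos) auto
  qed simp
  finally have "\<not> desc (altp s t n) ?r" using st r by (intro not_descI) auto
  then have "len (altp s t n \<otimes> ?r) = Suc (len (altp s t n))" using st r by (intro not_desc_len) auto
  then show ?case using Suc altp_Suc_right[OF st(1,2), of n] by (simp only: ) auto
qed simp

lemma altp_braid: "s \<in> S \<Longrightarrow> t \<in> S \<Longrightarrow> altp s t (cox_m W s t) = altp t s (cox_m W s t)"
  by (rule wp_alternating_braid)

end

section \<open>Twisted involutions\<close>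

locale twisted_coxeter = coxeter_system +
  fixes \<theta> :: "'a \<Rightarrow> 'a"
  assumes invol: "involutive_automorphism W S \<theta>"
begin

abbreviation I :: "'a set" where "I \<equiv> twisted_involutions W \<theta>"
abbreviation tact :: "'a \<Rightarrow> 'a \<Rightarrow> 'a" where "tact \<equiv> twisted_act W \<theta>"

lemma \<theta>_hom: "\<theta> \<in> hom W W" and \<theta>_image: "\<theta> ` S = S"
  and \<theta>_\<theta> [simp]: "w \<in> carrier W \<Longrightarrow> \<theta> (\<theta> w) = w"
  using invol by (auto simp: involutive_automorphism_def iso_def)

lemma \<theta>_closed [simp]: "w \<in> carrier W \<Longrightarrow> \<theta> w \<in> carrier W"
  using \<theta>_hom by (auto simp: hom_def)

lemma \<theta>_mult [simp]: "v \<in> carrier W \<Longrightarrow> w \<in> carrier W \<Longrightarrow> \<theta> (v \<otimes> w) = \<theta> v \<otimes> \<theta> w"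
  using \<theta>_hom by (auto simp: hom_def)

lemma \<theta>_S [simp]: "s \<in> S \<Longrightarrow> \<theta> s \<in> S"
  using \<theta>_image by blast

lemma \<theta>_group_hom: "group_hom W W \<theta>"
  using \<theta>_hom by unfold_locales

lemma \<theta>_one [simp]: "\<theta> \<one> = \<one>"
  using group_hom.hom_one[OF \<theta>_group_hom] .

lemma \<theta>_inv [simp]: "w \<in> carrier W \<Longrightarrow> \<theta> (inv w) = inv (\<theta> w)"
  using group_hom.hom_inv[OF \<theta>_group_hom] .

lemma \<theta>_inj: "v \<in> carrier W \<Longrightarrow> w \<in> carrier W \<Longrightarrow> \<theta> v = \<theta> w \<longleftrightarrow> v = w"
  by (metis \<theta>_\<theta>)

lemma \<theta>_len_le: "w \<in> carrier W \<Longrightarrow> len (\<theta> w) \<le> len w"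
proof -
  assume "w \<in> carrier W"
  then obtain u where u: "u \<in> lists S" "length u = len w" "wp u = w" using ex_reduced_word by meson
  have "map \<theta> u \<in> lists S \<and> wp (map \<theta> u) = \<theta> (wp u)" using u(1) by induction auto
  then show ?thesis using len_le[of "map \<theta> u"] u by simp
qed

lemma \<theta>_len [simp]: "w \<in> carrier W \<Longrightarrow> len (\<theta> w) = len w"
  using \<theta>_len_le[of w] \<theta>_len_le[of "\<theta> w"] by simp

lemma \<theta>_ord_dvd: "x \<in> carrier W \<Longrightarrow> ord (\<theta> x) dvd ord x"
proof -
  assume x: "x \<in> carrier W"
  have "\<theta> x [^] n = \<theta> (x [^] n)" for n :: nat using x by (induction n) auto
  then have "\<theta> x [^] ord x = \<one>" using pow_ord_eq_1[OF x] by simp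
  then show ?thesis using x by (simp add: pow_eq_id)
qed

lemma \<theta>_ord: "x \<in> carrier W \<Longrightarrow> ord (\<theta> x) = ord x"
  using \<theta>_ord_dvd[of x] \<theta>_ord_dvd[of "\<theta> x"] by (simp add: dvd_antisym)

lemma \<theta>_cox_m: "s \<in> S \<Longrightarrow> t \<in> S \<Longrightarrow> cox_m W (\<theta> s) (\<theta> t) = cox_m W s t"
  using \<theta>_ord[of "s \<otimes> t"] by (simp add: cox_m_def)

lemma \<theta>_generate:
  assumes "J \<subseteq> S" "x \<in> generate W J" shows "\<theta> x \<in> generate W (\<theta> ` J)"
proof -
  obtain u where u: "u \<in> lists J" "x = wp u" using generate_words assms by blast
  have "wp u \<in> carrier W \<and> \<theta> (wp u) \<in> generate W (\<theta> ` J)" using u(1)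
  proof induction
    case (Cons a l)
    then have "a \<in> S" using assms by auto
    then show ?case using Cons by (simp add: generate_mult generate_J)
  qed (simp add: generate.one)
  then show ?thesis using u by simp
qed

section \<open>Twisted involutions and the action of a letter\<close>

lemma I_closed [simp]: "w \<in> I \<Longrightarrow> w \<in> carrier W"
  and I_\<theta>: "w \<in> I \<Longrightarrow> \<theta> w = inv w"
  and I_I: "w \<in> carrier W \<Longrightarrow> \<theta> w = inv w \<Longrightarrow> w \<in> I"
  by (simp_all add: twisted_involutions_def)

lemma one_I [simp]: "\<one> \<in> I"
  by (simp add: I_I)

text \<open>Inversion and \<theta> both preserve length, and together they exchange the two
  sides.\<close>

lemma I_len_left: "w \<in> I \<Longrightarrow> s \<in> S \<Longrightarrow> len (\<theta> s \<otimes> w) = len (w \<otimes> s)"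
proof -
  assume w: "w \<in> I" and s: "s \<in> S"
  have "inv (w \<otimes> s) = \<theta> (\<theta> s \<otimes> w)" using w s by (simp add: inv_mult_group I_\<theta>)
  then show ?thesis using len_inv[of "w \<otimes> s"] \<theta>_len[of "\<theta> s \<otimes> w"] w s by (simp del: len_inv \<theta>_len)
qed

lemma commutes_iff:
  "w \<in> carrier W \<Longrightarrow> s \<in> S \<Longrightarrow> \<theta> s \<otimes> w \<otimes> s = w \<longleftrightarrow> \<theta> s \<otimes> w = w \<otimes> s"
  by (metis S_cancel_right S_carrier \<theta>_S m_closed)

lemma tact_commute: "w \<in> carrier W \<Longrightarrow> s \<in> S \<Longrightarrow> \<theta> s \<otimes> w = w \<otimes> s \<Longrightarrow> tact w s = w \<otimes> s"
  by (simp add: twisted_act_def)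

lemma tact_noncommute:
  "w \<in> carrier W \<Longrightarrow> s \<in> S \<Longrightarrow> \<theta> s \<otimes> w \<noteq> w \<otimes> s \<Longrightarrow> tact w s = \<theta> s \<otimes> w \<otimes> s"
  by (simp add: twisted_act_def commutes_iff)

text \<open>If \<open>s\<close> did not lengthen \<open>\<theta> s \<otimes> w\<close> on the right,
  lifting with \<open>i = \<theta> s\<close> would force the excluded equality.\<close>

lemma len_conj_asc:
  assumes w: "w \<in> I" and s: "s \<in> S" and d: "\<not> desc w s" and c: "\<theta> s \<otimes> w \<noteq> w \<otimes> s"
  shows "len (\<theta> s \<otimes> w \<otimes> s) = len w + 2"
proof -
  have ws: "len (\<theta> s \<otimes> w) = len w + 1" using I_len_left not_desc_len w s d by simp
  moreover have "\<not> desc (\<theta> s \<otimes> w) s" using reflection_commute[of w s "\<theta> s"] w s d c by auto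
  ultimately show ?thesis using w s not_desc_len[of "\<theta> s \<otimes> w" s] by simp
qed

lemma len_conj_desc:
  assumes w: "w \<in> I" and s: "s \<in> S" and d: "desc w s" and c: "\<theta> s \<otimes> w \<noteq> w \<otimes> s"
  shows "len (\<theta> s \<otimes> w \<otimes> s) + 2 = len w"
proof -
  let ?x = "\<theta> s \<otimes> w"
  have x: "?x \<in> carrier W" "\<theta> s \<otimes> ?x = w" using w s by simp_all
  have xl: "len ?x + 1 = len w" using I_len_left desc_len w s d by simp
  have "desc ?x s"
  proof (rule ccontr)
    assume "\<not> desc ?x s"
    moreover have "desc (\<theta> s \<otimes> ?x) s" using d x by simp
    ultimately have "\<theta> s \<otimes> ?x = ?x \<otimes> s" using reflection_commute[of ?x s "\<theta> s"] x s by simp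
    then have "\<theta> s \<otimes> w \<otimes> s = w" using x by simp
    then show False using c commutes_iff w s by simp
  qed
  then show ?thesis using desc_len[of ?x s] x xl s by simp
qed

lemma tact_I [simp]:
  assumes w: "w \<in> I" and s: "s \<in> S" shows "tact w s \<in> I"
proof (cases "\<theta> s \<otimes> w = w \<otimes> s")
  case True
  have "\<theta> (w \<otimes> s) = inv w \<otimes> \<theta> s" using w s by (simp add: I_\<theta>)
  also have "\<dots> = inv (\<theta> s \<otimes> w)" using w s by (simp add: inv_mult_group)
  finally show ?thesis using w s True by (simp add: tact_commute I_I)
next
  case False
  have "\<theta> (\<theta> s \<otimes> w \<otimes> s) = inv (\<theta> s \<otimes> w \<otimes> s)" using w s by (simp add: inv_mult_group I_\<theta> m_assoc)
  then show ?thesis using w s False by (simp add: tact_noncommute I_I)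
qed

lemma tact_tact:
  assumes w: "w \<in> I" and s: "s \<in> S" shows "tact (tact w s) s = w"
proof (cases "\<theta> s \<otimes> w = w \<otimes> s")
  case True
  have "\<theta> s \<otimes> (w \<otimes> s) = (w \<otimes> s) \<otimes> s" using w s by (simp flip: m_assoc add: True)
  then show ?thesis using w s True by (simp add: tact_commute)
next
  case False
  let ?y = "\<theta> s \<otimes> w \<otimes> s"
  have "\<theta> s \<otimes> ?y = w \<otimes> s" using w s by (simp add: m_assoc)
  moreover have "?y \<otimes> s = \<theta> s \<otimes> w" using w s by simp
  ultimately show ?thesis using w s False tact_noncommute[of ?y s] by (simp add: tact_noncommute)
qed

lemma len_tact_asc: "w \<in> I \<Longrightarrow> s \<in> S \<Longrightarrow> \<not> desc w s \<Longrightarrow> len w < len (tact w s)"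
  using not_desc_len[of w s] len_conj_asc[of w s]
  by (cases "\<theta> s \<otimes> w = w \<otimes> s") (auto simp: tact_commute tact_noncommute)

lemma len_tact_desc: "w \<in> I \<Longrightarrow> s \<in> S \<Longrightarrow> desc w s \<Longrightarrow> len (tact w s) < len w"
  using desc_len[of w s] len_conj_desc[of w s]
  by (cases "\<theta> s \<otimes> w = w \<otimes> s") (auto simp: tact_commute tact_noncommute)

lemma desc_tact:
  assumes w: "w \<in> I" and s: "s \<in> S" shows "desc (tact w s) s \<longleftrightarrow> \<not> desc w s"
  using len_tact_asc[of w s] len_tact_desc[of w s] len_tact_asc[of "tact w s" s] len_tact_desc[of "tact w s" s]
    tact_tact[of w s] w s by fastforce

text \<open>The local form of reducedness, from an arbitrary start; \<open>reduced_iff\<close>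
  identifies the words ascending from \<open>\<one>\<close> with the reduced expressions.\<close>

fun ascw :: "'a \<Rightarrow> 'a list \<Rightarrow> bool" where
  "ascw w [] \<longleftrightarrow> True"
| "ascw w (s # u) \<longleftrightarrow> \<not> desc w s \<and> ascw (tact w s) u"

lemma ascw_append: "ascw w (u @ v) \<longleftrightarrow> ascw w u \<and> ascw (foldl tact w u) v"
  by (induction u arbitrary: w) auto

lemma foldl_tact_I: "w \<in> I \<Longrightarrow> u \<in> lists S \<Longrightarrow> foldl tact w u \<in> I"
  by (induction u arbitrary: w) auto

text \<open>At a descent the left factor shortens \<open>y\<close> and the right one adds at most
  one letter back; in the multiplying case the conjugate is \<open>y\<close> itself. Neither allows
  a growth by two.\<close>

lemma tact_step:
  assumes y: "y \<in> I" and r: "r \<in> S" and l: "len (\<theta> r \<otimes> y \<otimes> r) = len y + 2"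
  shows "\<not> desc y r" "tact y r = \<theta> r \<otimes> y \<otimes> r"
proof -
  show "\<not> desc y r"
  proof
    assume d: "desc y r"
    have "len (\<theta> r \<otimes> y \<otimes> r) \<le> len (\<theta> r \<otimes> y) + 1" using len_mult[of "\<theta> r \<otimes> y" r] y r by simp
    then show False using l I_len_left[OF y r] desc_len[of y r] d y r by simp
  qed
  have "\<theta> r \<otimes> y \<otimes> r \<noteq> y" using l by auto
  then show "tact y r = \<theta> r \<otimes> y \<otimes> r" by (simp add: twisted_act_def)
qed

text \<open>Reduces a chain to a length count: as long as the twisted conjugates of \<open>b\<close>
  grow by two per letter, each letter is an ascent and acts by conjugation.\<close>

lemma conj_chain:
  assumes b: "b \<in> I" and st: "s \<in> S" "t \<in> S"
    and l: "\<And>n. n \<le> k \<Longrightarrow> len (inv (\<theta> (altp s t n)) \<otimes> b \<otimes> altp s t n) = len b + 2 * n"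
  shows "ascw b (alternating s t k) \<and>
    foldl tact b (alternating s t k) = inv (\<theta> (altp s t k)) \<otimes> b \<otimes> altp s t k"
  using l
proof (induction k)
  case 0
  then show ?case using b by simp
next
  case (Suc k)
  let ?r = "if even k then s else t" and ?x = "altp s t k"
  let ?y = "inv (\<theta> ?x) \<otimes> b \<otimes> ?x"
  have IH: "ascw b (alternating s t k)" "foldl tact b (alternating s t k) = ?y"
    using Suc.IH Suc.prems by (simp_all add: le_SucI)
  have r: "?r \<in> S" "?x \<in> carrier W" "b \<in> carrier W" using st b by auto
  have y: "?y \<in> I" using foldl_tact_I[of b "alternating s t k"] IH b st by (simp add: alternating_S)
  have x: "altp s t (Suc k) = ?x \<otimes> ?r" by (rule altp_Suc_right[OF st])
  have e: "inv (\<theta> (altp s t (Suc k))) \<otimes> b \<otimes> altp s t (Suc k) = \<theta> ?r \<otimes> ?y \<otimes> ?r"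
    unfolding x using r by (simp add: inv_mult_group m_assoc del: if_split_asm split del: if_split)
  have "len (\<theta> ?r \<otimes> ?y \<otimes> ?r) = len ?y + 2" using Suc.prems[of "Suc k"] Suc.prems[of k] unfolding e by simp
  then have "\<not> desc ?y ?r" "tact ?y ?r = \<theta> ?r \<otimes> ?y \<otimes> ?r" using tact_step[OF y r(1)] by blast+
  then show ?case unfolding e unfolding alternating_snoc ascw_append foldl_append IH(2) using IH(1) by simp
qed

text \<open>For descents \<open>s\<close>, \<open>t\<close> of \<open>w\<close>, this says that the alternating chains below \<open>w\<close> have fewer than \<open>m(s,t)\<close>
  letters.\<close>

definition bad :: "'a \<Rightarrow> 'a \<Rightarrow> 'a \<Rightarrow> bool" where
  "bad w s t \<longleftrightarrow> {w \<otimes> s, w \<otimes> t} = {\<theta> s \<otimes> w, \<theta> t \<otimes> w} \<and>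
     (3 \<le> cox_m W s t \<or> w \<otimes> s = \<theta> t \<otimes> w)"

lemma bad_sym: "s \<in> S \<Longrightarrow> t \<in> S \<Longrightarrow> bad w s t \<longleftrightarrow> bad w t s"
  unfolding bad_def using cox_m_sym[of s t] by (auto simp: doubleton_eq_iff)

definition dihedral_chains :: "'a \<Rightarrow> 'a \<Rightarrow> 'a \<Rightarrow> nat \<Rightarrow> 'a \<Rightarrow> bool" where
  "dihedral_chains u s t k w \<longleftrightarrow>
     ascw u (alternating s t k) \<and> foldl tact u (alternating s t k) = w \<and>
     ascw u (alternating t s k) \<and> foldl tact u (alternating t s k) = w"

lemma dihedral_chains_sym: "dihedral_chains u s t k w \<longleftrightarrow> dihedral_chains u t s k w"
  by (auto simp: dihedral_chains_def)

end

section \<open>Dihedral chains\<close>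

text \<open>\<open>u\<close> is the bottom of its orbit under the letters \<open>s\<close> and
  \<open>t\<close>. The predicate \<open>com j r\<close> records that \<open>u\<close> conjugates
  \<open>r\<close> to \<theta>(\<open>j\<close>), which is how left and right factors around
  \<open>u\<close> can interact.\<close>

locale dihedral_minimal = twisted_coxeter +
  fixes u s t :: 'a
  assumes u: "u \<in> I" and s: "s \<in> S" and t: "t \<in> S" and st: "s \<noteq> t"
    and us: "\<not> desc u s" and ut: "\<not> desc u t"
begin

definition "m = cox_m W s t"
abbreviation "G \<equiv> generate W {s, t}"
definition "com j r \<longleftrightarrow> \<theta> j \<otimes> u = u \<otimes> r"

lemma sub: "{s, t} \<subseteq> S" using s t by simp
lemma uc [simp]: "u \<in> carrier W" using u by simp
lemma G_closed [simp]: "d \<in> G \<Longrightarrow> d \<in> carrier W" using generate_carrier[OF sub] by blast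
lemma umin: "j \<in> {s, t} \<Longrightarrow> \<not> desc u j" using us ut by auto

lemma m_sym: "cox_m W t s = m" using s t cox_m_sym by (simp add: m_def)
lemma m1: "m \<noteq> 1" using cox_m_neq_1[OF s t st] by (simp add: m_def)

lemma altp_st: "altp s t n \<in> G" "altp t s n \<in> G"
  using altp_generate[of s t n] altp_generate[of t s n] by (simp_all add: insert_commute)

lemma altp_len_st:
  assumes "m = 0 \<or> n \<le> m"
  shows "len (altp s t n) = n" "len (altp t s n) = n"
  using altp_len[OF s t st] altp_len[OF t s] st assms m_sym by (auto simp: m_def)

lemma com_sym: "j \<in> S \<Longrightarrow> r \<in> S \<Longrightarrow> com j r \<Longrightarrow> com r j"
proof -
  assume jr: "j \<in> S" "r \<in> S" "com j r"
  then have "\<theta> (\<theta> j \<otimes> u) = \<theta> (u \<otimes> r)" by (simp add: com_def)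
  then have "j \<otimes> inv u = inv u \<otimes> \<theta> r" using jr u by (simp add: I_\<theta>)
  then have "u \<otimes> (j \<otimes> inv u) \<otimes> u = u \<otimes> (inv u \<otimes> \<theta> r) \<otimes> u" by simp
  moreover have "u \<otimes> (j \<otimes> inv u) \<otimes> u = u \<otimes> j" using jr by (simp add: m_assoc)
  moreover have "u \<otimes> (inv u \<otimes> \<theta> r) \<otimes> u = \<theta> r \<otimes> u" using jr by (simp flip: m_assoc)
  ultimately show ?thesis by (simp add: com_def)
qed

text \<open>Lengths add up if \<open>(u d)^-1\<close> is minimal modulo the group of
  \<theta>(\<open>s\<close>) and \<theta>(\<open>t\<close>). By \<open>left_desc_coset\<close> a
  descent there comes from some \<open>com j r\<close> whose \<open>r\<close> shortens
  \<open>d\<close> on the left, which \<open>c\<close> rules out.\<close>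

lemma len_conj:
  assumes d: "d \<in> G" and x: "x \<in> G"
    and c: "\<And>j r. j \<in> {s, t} \<Longrightarrow> r \<in> {s, t} \<Longrightarrow> com j r \<Longrightarrow> \<not> len (r \<otimes> d) < len d"
  shows "len (inv (\<theta> x) \<otimes> (u \<otimes> d)) = len x + len u + len d"
proof -
  have dx: "d \<in> carrier W" "x \<in> carrier W" using d x by auto
  define v where "v = inv (u \<otimes> d)"
  have v: "v \<in> carrier W" using dx by (simp add: v_def)
  have sub': "\<theta> ` {s, t} \<subseteq> S" using s t by simp
  have "\<not> desc v i" if i: "i \<in> \<theta> ` {s, t}" for i
  proof
    assume dv: "desc v i"
    obtain j where j: "j \<in> {s, t}" "i = \<theta> j" "j \<in> S" "i \<in> S" using i s t by auto
    have "v \<otimes> i = inv (i \<otimes> (u \<otimes> d))" using j dx by (simp add: v_def inv_mult_group m_assoc)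
    then have lt: "len (i \<otimes> (u \<otimes> d)) < len (u \<otimes> d)" using dv dx j by (simp add: desc_def v_def)
    have "len u < len (i \<otimes> u)" using I_len_left[OF u j(3)] not_desc_len[OF uc j(3)] umin[OF j(1)] j(2) by simp
    then obtain r where "r \<in> {s, t}" "i \<otimes> u = u \<otimes> r" "len (r \<otimes> d) < len d"
      using left_desc_coset[OF sub uc umin j(4) _ d lt] by blast
    then show False using c[OF j(1)] j(2) by (auto simp: com_def)
  qed
  moreover have "\<theta> x \<in> generate W (\<theta> ` {s, t})" using \<theta>_generate[OF sub x] .
  ultimately have "len (v \<otimes> \<theta> x) = len v + len (\<theta> x)" using coset_len[OF sub' v] by blast
  moreover have "inv (\<theta> x) \<otimes> (u \<otimes> d) = inv (v \<otimes> \<theta> x)" using dx by (simp add: v_def inv_mult_group m_assoc)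
  moreover have "len (u \<otimes> d) = len u + len d" using coset_len[OF sub uc umin d] by blast
  ultimately show ?thesis using dx v by (simp add: v_def)
qed

text \<open>The three possible shapes of a chain depend on which of \<open>s\<close>, \<open>t\<close> are conjugated by \<open>u\<close> into
  \<open>{\<theta>(s), \<theta>(t)}\<close>: one or none of them (\<open>k = m\<close>), both with \<open>u s = \<theta>(s) u\<close> (\<open>k = m div 2 + 1\<close>), or
  both with \<open>u s = \<theta>(t) u\<close> (\<open>k = (m + 1) div 2\<close>).\<close>

lemma chain_generic:
  assumes "\<And>j. j \<in> {s, t} \<Longrightarrow> \<not> com j s" and k: "m = 0 \<or> k < m"
  shows "ascw u (alternating s t k) \<and>
    foldl tact u (alternating s t k) = inv (\<theta> (altp s t k)) \<otimes> u \<otimes> altp s t k"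
proof (rule conj_chain[OF u s t])
  fix n assume n: "n \<le> k"
  have "len (inv (\<theta> (altp s t n)) \<otimes> (u \<otimes> altp s t n)) = len (altp s t n) + len u + len (altp s t n)"
  proof (rule len_conj)
    fix j r assume jr: "j \<in> {s, t}" "r \<in> {s, t}" "com j r"
    then have r: "r = t" using assms(1) by auto
    \<comment> \<open>An alternating product starting with \<open>s\<close> and having fewer than
      \<open>m\<close> letters is lengthened by \<open>t\<close> on the left, so
      \<open>com j t\<close> does no harm.\<close>
    have "len (altp t s (Suc n)) = Suc n" "len (altp s t n) = n"
      using n k by (auto intro!: altp_len_st simp del: alternating.simps)
    then show "\<not> len (r \<otimes> altp s t n) < len (altp s t n)" by (simp add: r)
  qed (rule altp_st)+
  moreover have "len (altp s t n) = n" using n k by (intro altp_len_st) auto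
  ultimately show "len (inv (\<theta> (altp s t n)) \<otimes> u \<otimes> altp s t n) = len u + 2 * n"
    using s t by (simp add: m_assoc)
qed

text \<open>At \<open>n = m\<close> both letters shorten the product on the left, so both have to be
  free of \<open>com\<close>.\<close>

lemma chain_generic_top:
  assumes "\<And>j. j \<in> {s, t} \<Longrightarrow> \<not> com j s" "\<And>j. j \<in> {s, t} \<Longrightarrow> \<not> com j t" and k: "k \<le> m"
  shows "ascw u (alternating s t k) \<and>
    foldl tact u (alternating s t k) = inv (\<theta> (altp s t k)) \<otimes> u \<otimes> altp s t k"
proof (rule conj_chain[OF u s t])
  fix n assume n: "n \<le> k"
  have "len (inv (\<theta> (altp s t n)) \<otimes> (u \<otimes> altp s t n)) = len (altp s t n) + len u + len (altp s t n)"
    by (rule len_conj) (use assms altp_st in auto)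
  moreover have "len (altp s t n) = n" using n k by (intro altp_len_st) auto
  ultimately show "len (inv (\<theta> (altp s t n)) \<otimes> u \<otimes> altp s t n) = len u + 2 * n"
    using s t by (simp add: m_assoc)
qed

lemma tact_commute_step:
  assumes "y \<in> I" "r \<in> S" "\<theta> r \<otimes> y = y \<otimes> r" "len (y \<otimes> r) = Suc (len y)"
  shows "\<not> desc y r" "tact y r = y \<otimes> r"
  using assms by (simp_all add: desc_def tact_commute)

text \<open>The first letter multiplies and all others conjugate.\<close>

lemma chain_semi:
  assumes c: "com s s" and ct: "\<And>j. j \<in> {s, t} \<Longrightarrow> \<not> com j t" and k: "m = 0 \<or> k < m"
  shows "ascw u (alternating s t (Suc k)) \<and>
    foldl tact u (alternating s t (Suc k)) = inv (\<theta> (altp t s k)) \<otimes> (u \<otimes> s) \<otimes> altp t s k"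
proof -
  have "len (u \<otimes> s) = Suc (len u)" using us s not_desc_len by simp
  moreover have c': "\<theta> s \<otimes> u = u \<otimes> s" using c by (simp add: com_def)
  ultimately have 1: "\<not> desc u s" "tact u s = u \<otimes> s" using tact_commute_step[OF u s] by blast+
  have b: "u \<otimes> s \<in> I" using tact_I[OF u s] 1 by simp
  have "ascw (u \<otimes> s) (alternating t s k) \<and>
    foldl tact (u \<otimes> s) (alternating t s k) = inv (\<theta> (altp t s k)) \<otimes> (u \<otimes> s) \<otimes> altp t s k"
  proof (rule conj_chain[OF b t s])
    fix n assume n: "n \<le> k"
    have l: "len (altp t s n) = n" "len (altp s t (Suc n)) = Suc n"
      using n k by (auto intro!: altp_len_st simp del: alternating.simps)
    have x: "altp t s n \<in> carrier W" using s t by simp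
    \<comment> \<open>Moving the middle \<open>s\<close> across \<open>u\<close> leaves a right
      factor that starts with \<open>t\<close>, which \<open>s\<close> lengthens on the
      left.\<close>
    have "inv (\<theta> (altp t s n)) \<otimes> (u \<otimes> s) \<otimes> altp t s n = inv (\<theta> (altp t s n)) \<otimes> (\<theta> s \<otimes> u) \<otimes> altp t s n"
      by (simp add: c')
    also have "\<dots> = inv (\<theta> (altp s t (Suc n))) \<otimes> (u \<otimes> altp t s n)"
      using s t x by (simp add: inv_mult_group m_assoc)
    also have "len \<dots> = len (altp s t (Suc n)) + len u + len (altp t s n)"
    proof (rule len_conj)
      fix j r assume jr: "j \<in> {s, t}" "r \<in> {s, t}" "com j r"
      then have r: "r = s" using ct by auto
      show "\<not> len (r \<otimes> altp t s n) < len (altp t s n)" using l by (simp add: r)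
    qed (rule altp_st)+
    finally show "len (inv (\<theta> (altp t s n)) \<otimes> (u \<otimes> s) \<otimes> altp t s n) = len (u \<otimes> s) + 2 * n"
      using l \<open>len (u \<otimes> s) = Suc (len u)\<close> by simp
  qed
  then show ?thesis using 1 by simp
qed

text \<open>This chain multiplies at its last letter instead of its first. The braid relation
  carries that letter to the \<open>s\<close> next to \<open>u\<close>, so both chains end in the
  same element.\<close>

lemma chain_semi_top:
  assumes c: "com s s" and ct: "\<And>j. j \<in> {s, t} \<Longrightarrow> \<not> com j t" and k: "m = Suc k"
  shows "ascw u (alternating t s m) \<and>
    foldl tact u (alternating t s m) = inv (\<theta> (altp t s k)) \<otimes> (u \<otimes> s) \<otimes> altp t s k"
proof -
  interpret swap: dihedral_minimal W S \<theta> u t s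
    using u s t st us ut by unfold_locales auto
  have sm: "swap.m = m" using m_sym by (simp add: swap.m_def)
  have c': "\<theta> s \<otimes> u = u \<otimes> s" using c by (simp add: com_def)
  define x where "x = altp t s k"
  have x: "x \<in> carrier W" using s t by (simp add: x_def)
  define y where "y = inv (\<theta> x) \<otimes> u \<otimes> x"
  have ch: "ascw u (alternating t s k)" "foldl tact u (alternating t s k) = y"
  proof -
    have "\<not> com j t" if "j \<in> {t, s}" for j using ct[of j] that by blast
    moreover have "swap.m = 0 \<or> k < swap.m" using k sm by simp
    ultimately have "ascw u (alternating t s k) \<and>
      foldl tact u (alternating t s k) = inv (\<theta> (altp t s k)) \<otimes> u \<otimes> altp t s k"
      by (rule swap.chain_generic)
    then show "ascw u (alternating t s k)" "foldl tact u (alternating t s k) = y"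
      by (simp_all add: x_def y_def)
  qed
  let ?r = "if even k then t else s"
  have r: "?r \<in> S" using s t by simp
  have y: "y \<in> I" using foldl_tact_I[OF u, of "alternating t s k"] ch(2) s t by (simp add: alternating_S)
  have xr: "x \<otimes> ?r = s \<otimes> x"
  proof -
    have "x \<otimes> ?r = altp t s m" unfolding k x_def using altp_Suc_right[OF t s] by simp
    also have "\<dots> = altp s t m" using altp_braid[OF s t] by (simp add: m_def)
    finally show ?thesis by (simp add: k x_def)
  qed
  have "\<theta> ?r \<otimes> inv (\<theta> x) = inv (\<theta> (x \<otimes> ?r))" using x r by (simp add: inv_mult_group)
  also have "\<dots> = inv (\<theta> x) \<otimes> \<theta> s" unfolding xr using x s by (simp add: inv_mult_group)
  finally have rx: "\<theta> ?r \<otimes> inv (\<theta> x) = inv (\<theta> x) \<otimes> \<theta> s" .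
  have yr: "y \<otimes> ?r = inv (\<theta> x) \<otimes> (u \<otimes> s) \<otimes> x"
    using x r s by (simp add: y_def m_assoc xr)
  have "\<theta> ?r \<otimes> y = \<theta> ?r \<otimes> inv (\<theta> x) \<otimes> (u \<otimes> x)" using x r by (simp add: y_def m_assoc)
  also have "\<dots> = inv (\<theta> x) \<otimes> (\<theta> s \<otimes> u) \<otimes> x" unfolding rx using x s by (simp add: m_assoc)
  also have "\<dots> = y \<otimes> ?r" unfolding yr c' ..
  finally have com: "\<theta> ?r \<otimes> y = y \<otimes> ?r" .
  have lx: "len x = k" "len (s \<otimes> x) = Suc k"
    using altp_len_st(2)[of k] altp_len_st(1)[of "Suc k"] k by (auto simp: x_def)
  have "y \<otimes> ?r = inv (\<theta> (s \<otimes> x)) \<otimes> (u \<otimes> x)"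
    unfolding yr c'[symmetric] using x s by (simp add: inv_mult_group m_assoc)
  also have "len \<dots> = len (s \<otimes> x) + len u + len x"
  proof (rule len_conj)
    show "s \<otimes> x \<in> G" "x \<in> G" using altp_st by (simp_all add: x_def generate_mult generate_J)
    fix j r assume jr: "j \<in> {s, t}" "r \<in> {s, t}" "com j r"
    then have r: "r = s" using ct by auto
    show "\<not> len (r \<otimes> x) < len x" using lx by (simp add: r)
  qed
  finally have l1: "len (y \<otimes> ?r) = len u + 2 * k + 1" using lx by simp
  have "y = inv (\<theta> x) \<otimes> (u \<otimes> x)" using x by (simp add: y_def m_assoc)
  also have "len \<dots> = len x + len u + len x"
  proof (rule len_conj)
    show "x \<in> G" "x \<in> G" using altp_st by (simp_all add: x_def)
    fix j r assume jr: "j \<in> {s, t}" "r \<in> {s, t}" "com j r"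
    then have r: "r = s" using ct by auto
    show "\<not> len (r \<otimes> x) < len x" using lx by (simp add: r)
  qed
  finally have "len (y \<otimes> ?r) = Suc (len y)" using l1 lx by simp
  then have "\<not> desc y ?r" "tact y ?r = y \<otimes> ?r" using tact_commute_step[OF y r com] by blast+
  then show ?thesis using ch unfolding k alternating_snoc ascw_append foldl_append yr[unfolded x_def, symmetric]
    by (simp add: x_def)
qed

lemma swap: "dihedral_minimal W S \<theta> u t s"
  using u s t st us ut by unfold_locales auto

lemma swap_m: "dihedral_minimal.m W t s = m"
  by (simp add: dihedral_minimal.m_def[OF swap] m_sym)

lemma len_u_altp:
  assumes "{p, q} = {s, t}" "m = 0 \<or> n \<le> m"
  shows "len (u \<otimes> altp p q n) = len u + n"
proof -
  have "altp p q n \<in> G" "len (altp p q n) = n"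
    using assms altp_st altp_len_st by (auto simp: doubleton_eq_iff)
  then show ?thesis using coset_len[OF sub uc umin] by simp
qed

lemma altp_braid_st:
  assumes "{p, q} = {s, t}" shows "altp p q m = altp s t m"
  using assms altp_braid[OF s t] by (auto simp: doubleton_eq_iff m_def)

text \<open>As \<open>u\<close> carries each letter to its own \<theta>-image, conjugation by
  \<open>q\<close> adds a \<open>q\<close> at both ends of the word behind \<open>u\<close>. The
  initial multiplication makes its length odd.\<close>

lemma chain_fixed:
  assumes cs: "com s s" and ct: "com t t" and k: "m = 0 \<or> Suc (2 * k) \<le> m"
  shows "ascw u (alternating s t (Suc k)) \<and> foldl tact u (alternating s t (Suc k)) =
    u \<otimes> altp (if even k then s else t) (if even k then t else s) (Suc (2 * k))"
  using k
proof (induction k)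
  case 0
  have "len (u \<otimes> s) = Suc (len u)" using us s not_desc_len by simp
  then have "\<not> desc u s" "tact u s = u \<otimes> s"
    using tact_commute_step[OF u s] cs by (simp_all add: com_def)
  then show ?case using s by simp
next
  case (Suc k)
  define p q where "p = (if even k then s else t)" and "q = (if even k then t else s)"
  have pq: "p \<in> S" "q \<in> S" "{p, q} = {s, t}" "{q, p} = {s, t}" "com q q"
    "(if even (Suc k) then s else t) = q" "(if even (Suc k) then t else s) = p"
    using s t cs ct by (auto simp: p_def q_def)
  define y where "y = u \<otimes> altp p q (Suc (2 * k))"
  have IH: "ascw u (alternating s t (Suc k))" "foldl tact u (alternating s t (Suc k)) = y"
    using Suc by (auto simp del: alternating.simps simp: y_def p_def q_def)
  have y: "y \<in> I" using foldl_tact_I[OF u, of "alternating s t (Suc k)"] IH(2) s t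
    by (simp add: alternating_S del: alternating.simps)
  have a: "altp p q (Suc (2 * k)) \<in> carrier W" using pq by (simp del: alternating.simps)
  have "altp q p (Suc (2 * Suc k)) = q \<otimes> altp p q (Suc (Suc (2 * k)))" by simp
  also have "altp p q (Suc (Suc (2 * k))) = altp p q (Suc (2 * k)) \<otimes> q"
    using altp_Suc_right[OF pq(1,2), of "Suc (2 * k)"] by simp
  finally have top: "altp q p (Suc (2 * Suc k)) = q \<otimes> (altp p q (Suc (2 * k)) \<otimes> q)" .
  have "\<theta> q \<otimes> y \<otimes> q = (\<theta> q \<otimes> u) \<otimes> altp p q (Suc (2 * k)) \<otimes> q"
    using pq a by (simp add: y_def m_assoc del: alternating.simps)
  also have "\<dots> = u \<otimes> altp q p (Suc (2 * Suc k))"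
    unfolding top using pq a by (simp add: com_def m_assoc del: alternating.simps)
  finally have e: "\<theta> q \<otimes> y \<otimes> q = u \<otimes> altp q p (Suc (2 * Suc k))" .
  have "len y = len u + Suc (2 * k)"
    unfolding y_def using Suc.prems by (intro len_u_altp[OF pq(3)]) auto
  moreover have "len (\<theta> q \<otimes> y \<otimes> q) = len u + Suc (2 * Suc k)"
    unfolding e using Suc.prems by (intro len_u_altp[OF pq(4)]) auto
  ultimately have "len (\<theta> q \<otimes> y \<otimes> q) = len y + 2" by simp
  then have "\<not> desc y q" "tact y q = \<theta> q \<otimes> y \<otimes> q" using tact_step[OF y pq(2)] by blast+
  then show ?case
    unfolding alternating_snoc[of s t "Suc k"] pq(6,7) ascw_append foldl_append IH(2)
    using IH(1) e by (simp del: alternating.simps)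
qed

text \<open>Conjugation by \<open>q\<close> now adds \<open>p\<close> in front and \<open>q\<close>
  behind, already at the first letter, so the word behind \<open>u\<close> has even length.\<close>

lemma chain_swapped:
  assumes cs: "com s t" and ct: "com t s" and k: "m = 0 \<or> 2 * k \<le> m"
  shows "ascw u (alternating s t k) \<and> foldl tact u (alternating s t k) =
    u \<otimes> altp (if even k then s else t) (if even k then t else s) (2 * k)"
  using k
proof (induction k)
  case 0
  then show ?case by simp
next
  case (Suc k)
  define q p where "q = (if even k then s else t)" and "p = (if even k then t else s)"
  have pq: "p \<in> S" "q \<in> S" "{p, q} = {s, t}" "{q, p} = {s, t}" "com q p"
    "(if even (Suc k) then s else t) = p" "(if even (Suc k) then t else s) = q"
    using s t cs ct by (auto simp: p_def q_def)
  define y where "y = u \<otimes> altp q p (2 * k)"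
  have IH: "ascw u (alternating s t k)" "foldl tact u (alternating s t k) = y"
    using Suc by (auto simp del: alternating.simps simp: y_def p_def q_def)
  have y: "y \<in> I" using foldl_tact_I[OF u, of "alternating s t k"] IH(2) s t
    by (simp add: alternating_S del: alternating.simps)
  have a: "altp q p (2 * k) \<in> carrier W" using pq by (simp del: alternating.simps)
  have "altp p q (2 * Suc k) = p \<otimes> altp q p (Suc (2 * k))" by simp
  also have "altp q p (Suc (2 * k)) = altp q p (2 * k) \<otimes> q"
    using altp_Suc_right[OF pq(2,1), of "2 * k"] by simp
  finally have top: "altp p q (2 * Suc k) = p \<otimes> (altp q p (2 * k) \<otimes> q)" .
  have "\<theta> q \<otimes> y \<otimes> q = (\<theta> q \<otimes> u) \<otimes> altp q p (2 * k) \<otimes> q"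
    using pq a by (simp add: y_def m_assoc del: alternating.simps)
  also have "\<dots> = u \<otimes> altp p q (2 * Suc k)"
    unfolding top using pq a by (simp add: com_def m_assoc del: alternating.simps)
  finally have e: "\<theta> q \<otimes> y \<otimes> q = u \<otimes> altp p q (2 * Suc k)" .
  have "len y = len u + 2 * k"
    unfolding y_def using Suc.prems by (intro len_u_altp[OF pq(4)]) auto
  moreover have "len (\<theta> q \<otimes> y \<otimes> q) = len u + 2 * Suc k"
    unfolding e using Suc.prems by (intro len_u_altp[OF pq(3)]) auto
  ultimately have "len (\<theta> q \<otimes> y \<otimes> q) = len y + 2" by simp
  then have "\<not> desc y q" "tact y q = \<theta> q \<otimes> y \<otimes> q" using tact_step[OF y pq(2)] by blast+
  then show ?case
    unfolding alternating_snoc[of s t k] pq(6,7) ascw_append foldl_append IH(2) q_def[symmetric]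
    using IH(1) e by (simp del: alternating.simps)
qed

text \<open>When one letter is missing to the longest element, adding it on the left or on the right
  gives the same product by the braid relation, so the last letter multiplies. This happens for even
  \<open>m\<close> in the fixed case and for odd \<open>m\<close> in the swapped one.\<close>

lemma chain_last:
  assumes pq: "{p, q} = {s, t}" and n: "m = Suc n" and c: "com r r'" "r \<in> S" "r' \<in> S"
    and ends: "altp p q n \<otimes> r = altp p q m" "r' \<otimes> altp p q n = altp q p m"
    and y: "u \<otimes> altp p q n \<in> I"
  shows "\<not> desc (u \<otimes> altp p q n) r" "tact (u \<otimes> altp p q n) r = u \<otimes> altp s t m"
proof -
  have pqS: "p \<in> S" "q \<in> S" using pq s t by (auto simp: doubleton_eq_iff)
  let ?a = "altp p q n"
  have a: "?a \<in> carrier W" using pqS by simp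
  have 1: "u \<otimes> ?a \<otimes> r = u \<otimes> altp s t m"
    using a c ends altp_braid_st[OF pq] by (simp add: m_assoc)
  have "\<theta> r \<otimes> (u \<otimes> ?a) = u \<otimes> r' \<otimes> ?a" using c a by (simp add: com_def flip: m_assoc)
  also have "\<dots> = u \<otimes> altp q p m" using c a ends by (simp add: m_assoc)
  also have "\<dots> = u \<otimes> altp s t m" using altp_braid_st[of q p] pq by (simp add: insert_commute)
  finally have 2: "\<theta> r \<otimes> (u \<otimes> ?a) = u \<otimes> ?a \<otimes> r" using 1 by simp
  have "len (u \<otimes> ?a) = len u + n" "len (u \<otimes> altp s t m) = len u + m"
    using len_u_altp[OF pq] len_u_altp[of s t m] n by auto
  then have "len (u \<otimes> ?a \<otimes> r) = Suc (len (u \<otimes> ?a))" unfolding 1 using n by simp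
  then show "\<not> desc (u \<otimes> ?a) r" "tact (u \<otimes> ?a) r = u \<otimes> altp s t m"
    using tact_commute_step[OF y c(2) 2] 1 by auto
qed

lemma chain_fixed_top:
  assumes cs: "com s s" and ct: "com t t" and m: "2 \<le> m"
  shows "ascw u (alternating s t (Suc (m div 2))) \<and>
    foldl tact u (alternating s t (Suc (m div 2))) = u \<otimes> altp s t m"
proof (cases "even m")
  case False
  then obtain k where k: "m = Suc (2 * k)" by (metis oddE Suc_eq_plus1)
  have "{if even k then s else t, if even k then t else s} = {s, t}" by auto
  from altp_braid_st[OF this] show ?thesis using chain_fixed[OF cs ct, of k] k by simp
next
  case True
  then obtain k' where k': "m = 2 * k'" by auto
  then obtain k where k: "m = Suc (Suc (2 * k))" using m by (cases k') auto
  define p q where "p = (if even k then s else t)" and "q = (if even k then t else s)"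
  have pq: "p \<in> S" "q \<in> S" "{p, q} = {s, t}" "com q q" "(if even (Suc k) then s else t) = q"
    using s t cs ct by (auto simp: p_def q_def)
  define y where "y = u \<otimes> altp p q (Suc (2 * k))"
  have IH: "ascw u (alternating s t (Suc k))" "foldl tact u (alternating s t (Suc k)) = y"
    using chain_fixed[OF cs ct, of k] k by (auto simp del: alternating.simps simp: y_def p_def q_def)
  have y: "y \<in> I" using foldl_tact_I[OF u, of "alternating s t (Suc k)"] IH(2) s t
    by (simp add: alternating_S del: alternating.simps)
  have e: "altp p q (Suc (2 * k)) \<otimes> q = altp p q m" "q \<otimes> altp p q (Suc (2 * k)) = altp q p m"
    using altp_Suc_right[OF pq(1,2), of "Suc (2 * k)"] k by simp_all
  have 1: "\<not> desc y q" "tact y q = u \<otimes> altp s t m"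
    using chain_last[OF pq(3) k pq(4,2,2) e] y by (simp_all add: y_def)
  have 2: "m div 2 = Suc k" using k by simp
  show ?thesis
    unfolding 2 alternating_snoc[of s t "Suc k"] pq(5) ascw_append foldl_append IH(2)
    using IH(1) 1 by (simp del: alternating.simps)
qed

lemma chain_swapped_top:
  assumes cs: "com s t" and ct: "com t s" and m: "2 \<le> m"
  shows "ascw u (alternating s t (Suc m div 2)) \<and>
    foldl tact u (alternating s t (Suc m div 2)) = u \<otimes> altp s t m"
proof (cases "even m")
  case True
  then obtain k where k: "m = 2 * k" by auto
  have "{if even k then s else t, if even k then t else s} = {s, t}" by auto
  from altp_braid_st[OF this] show ?thesis using chain_swapped[OF cs ct, of k] k by simp
next
  case False
  then obtain k where k: "m = Suc (2 * k)" by (metis oddE Suc_eq_plus1)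
  define q p where "q = (if even k then s else t)" and "p = (if even k then t else s)"
  have pq: "q \<in> S" "p \<in> S" "{q, p} = {s, t}" "com q p" using s t cs ct by (auto simp: p_def q_def)
  define y where "y = u \<otimes> altp q p (2 * k)"
  have IH: "ascw u (alternating s t k)" "foldl tact u (alternating s t k) = y"
    using chain_swapped[OF cs ct, of k] k by (auto simp del: alternating.simps simp: y_def p_def q_def)
  have y: "y \<in> I" using foldl_tact_I[OF u, of "alternating s t k"] IH(2) s t
    by (simp add: alternating_S del: alternating.simps)
  have e: "altp q p (2 * k) \<otimes> q = altp q p m" "p \<otimes> altp q p (2 * k) = altp p q m"
    using altp_Suc_right[OF pq(1,2), of "2 * k"] k by simp_all
  have 1: "\<not> desc y q" "tact y q = u \<otimes> altp s t m"
    using chain_last[OF pq(3) k pq(4,1,2) e] y by (simp_all add: y_def)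
  have 2: "Suc m div 2 = Suc k" using k by simp
  show ?thesis
    unfolding 2 alternating_snoc[of s t k] q_def[symmetric] ascw_append foldl_append IH(2)
    using IH 1 by simp
qed

lemma longest_conj_st:
  assumes m: "0 < m"
  shows "altp s t m \<otimes> s = (if even m then s else t) \<otimes> altp s t m"
proof -
  obtain k where k: "m = Suc k" using m by (cases m) auto
  have b: "altp t s m = altp s t m" by (rule altp_braid_st) auto
  show ?thesis
  proof (cases "even m")
    case True
    then have "altp t s m = altp t s k \<otimes> s" using altp_Suc_right[OF t s, of k] k by simp
    then have "altp s t m \<otimes> s = altp t s k" using b s t by simp
    moreover have "s \<otimes> altp s t m = altp t s k" using k s t by simp
    ultimately show ?thesis using True by simp
  next
    case False
    then have "altp s t m = altp s t k \<otimes> s" using altp_Suc_right[OF s t, of k] k by simp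
    then have "altp s t m \<otimes> s = altp s t k" using s t by simp
    moreover have "t \<otimes> altp t s m = altp s t k" using k s t by simp
    ultimately show ?thesis using False b by simp
  qed
qed

lemma longest_conj_ts:
  assumes m: "0 < m"
  shows "altp s t m \<otimes> t = (if even m then t else s) \<otimes> altp s t m"
proof -
  have b: "altp t s m = altp s t m" by (rule altp_braid_st) auto
  show ?thesis using dihedral_minimal.longest_conj_st[OF swap] m b by (simp add: swap_m)
qed

lemma top_conj:
  assumes c: "com j r" "j \<in> S" "r \<in> S" "r' \<in> S" and e: "altp s t m \<otimes> r' = r \<otimes> altp s t m"
  shows "(u \<otimes> altp s t m) \<otimes> r' = \<theta> j \<otimes> (u \<otimes> altp s t m)"
proof -
  have a: "altp s t m \<in> carrier W" using s t by simp
  have "(u \<otimes> altp s t m) \<otimes> r' = u \<otimes> (altp s t m \<otimes> r')" using c a by (simp add: m_assoc)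
  also have "\<dots> = (u \<otimes> r) \<otimes> altp s t m" unfolding e using c a by (simp add: m_assoc)
  also have "u \<otimes> r = \<theta> j \<otimes> u" using c(1) by (simp add: com_def)
  finally show ?thesis using c a by (simp add: m_assoc)
qed

text \<open>For \<open>m = 2\<close> the chain length \<open>m div 2 + 1\<close> already equals
  \<open>m\<close>. This is the exception that the second conjunct of \<open>bad\<close> takes care
  of.\<close>

lemma bad_fixed:
  assumes cs: "com s s" and ct: "com t t" and m: "2 \<le> m"
  shows "bad (u \<otimes> altp s t m) s t \<longleftrightarrow> 3 \<le> m"
proof -
  let ?w = "u \<otimes> altp s t m"
  have m0: "0 < m" using m by simp
  have ne: "\<theta> s \<otimes> ?w \<noteq> \<theta> t \<otimes> ?w" using s t st \<theta>_inj[of s t] by simp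
  have 1: "?w \<otimes> s = \<theta> (if even m then s else t) \<otimes> ?w"
    using top_conj[OF _ _ _ s longest_conj_st[OF m0]] cs ct s t by auto
  have 2: "?w \<otimes> t = \<theta> (if even m then t else s) \<otimes> ?w"
    using top_conj[OF _ _ _ t longest_conj_ts[OF m0]] cs ct s t by auto
  have "m = 2 \<or> 3 \<le> m" using m by auto
  then show ?thesis
  proof
    assume "m = 2"
    then show ?thesis using 1 2 ne unfolding bad_def m_def[symmetric] by auto
  next
    assume "3 \<le> m"
    then show ?thesis unfolding bad_def m_def[symmetric] 1 2 by auto
  qed
qed

lemma bad_swapped:
  assumes cs: "com s t" and ct: "com t s" and m: "2 \<le> m"
  shows "bad (u \<otimes> altp s t m) s t"
proof -
  let ?w = "u \<otimes> altp s t m"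
  have m0: "0 < m" using m by simp
  have 1: "?w \<otimes> s = \<theta> (if even m then t else s) \<otimes> ?w"
    using top_conj[OF _ _ _ s longest_conj_st[OF m0]] cs ct s t by auto
  have 2: "?w \<otimes> t = \<theta> (if even m then s else t) \<otimes> ?w"
    using top_conj[OF _ _ _ t longest_conj_ts[OF m0]] cs ct s t by auto
  have "m = 2 \<or> 3 \<le> m" using m by auto
  then show ?thesis
  proof
    assume "m = 2"
    then show ?thesis using 1 2 unfolding bad_def m_def[symmetric] by auto
  next
    assume "3 \<le> m"
    then show ?thesis unfolding bad_def m_def[symmetric] 1 2 by auto
  qed
qed

text \<open>A bad \<open>w\<close> conjugates the group of \<open>s\<close> and \<open>t\<close> to
  its \<theta>-image; stripping the factors \<open>a\<close> and \<open>b\<close> transfers this to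
  \<open>u\<close>. As lengths add up around \<open>u\<close>, the image of a letter has length
  one.\<close>

lemma bad_imp_com:
  assumes ab: "a \<in> G" "b \<in> G" and bad: "bad (inv (\<theta> a) \<otimes> u \<otimes> b) s t" and x: "x \<in> {s, t}"
  shows "\<exists>j\<in>{s, t}. com j x"
proof -
  define w where "w = inv (\<theta> a) \<otimes> u \<otimes> b"
  have abc: "a \<in> carrier W" "b \<in> carrier W" "x \<in> carrier W" "x \<in> S" using ab x s t by auto
  have w: "w \<in> carrier W" using abc by (simp add: w_def)
  have step: "\<exists>j'\<in>{s, t}. w \<otimes> j = \<theta> j' \<otimes> w" if "j \<in> {s, t}" for j
    using bad that unfolding bad_def w_def[symmetric] by (auto simp: doubleton_eq_iff)
  have word: "\<exists>d'\<in>G. w \<otimes> wp q = \<theta> d' \<otimes> w" if "q \<in> lists {s, t}" for q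
    using that
  proof induction
    case Nil
    show ?case using w by (intro bexI[of _ \<one>]) (auto intro: generate.one)
  next
    case (Cons j q)
    then obtain d' where d': "d' \<in> G" "w \<otimes> wp q = \<theta> d' \<otimes> w" by blast
    obtain j' where j': "j' \<in> {s, t}" "w \<otimes> j = \<theta> j' \<otimes> w" using step Cons.hyps by blast
    have c: "j \<in> S" "j' \<in> S" "q \<in> lists S" "d' \<in> carrier W" using Cons.hyps j' d' s t by auto
    have "w \<otimes> wp (j # q) = (w \<otimes> j) \<otimes> wp q" using w c by (simp add: m_assoc)
    also have "\<dots> = \<theta> j' \<otimes> (w \<otimes> wp q)" unfolding j'(2) using w c by (simp add: m_assoc)
    also have "\<dots> = \<theta> (j' \<otimes> d') \<otimes> w" unfolding d'(2) using w c by (simp add: m_assoc)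
    finally show ?case using j' d' by (intro bexI[of _ "j' \<otimes> d'"]) (auto simp: generate_mult generate_J)
  qed
  have "inv b \<otimes> x \<otimes> b \<in> G" using ab x sub by (simp add: generate_mult generate_J generate_inv)
  then obtain q where "q \<in> lists {s, t}" "inv b \<otimes> x \<otimes> b = wp q" using generate_words[OF sub] by blast
  then obtain d' where d': "d' \<in> G" "w \<otimes> (inv b \<otimes> x \<otimes> b) = \<theta> d' \<otimes> w" using word by metis
  have d'c: "d' \<in> carrier W" using d' by simp
  have "w \<otimes> (inv b \<otimes> x \<otimes> b) = inv (\<theta> a) \<otimes> u \<otimes> (b \<otimes> inv b) \<otimes> x \<otimes> b"
    unfolding w_def using abc by (simp only: m_assoc uc S_carrier inv_closed m_closed \<theta>_closed)
  also have "\<dots> = inv (\<theta> a) \<otimes> u \<otimes> x \<otimes> b" using abc by simp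
  finally have "inv (\<theta> a) \<otimes> u \<otimes> x \<otimes> b = \<theta> d' \<otimes> inv (\<theta> a) \<otimes> u \<otimes> b"
    using d'(2) abc d'c by (simp add: w_def m_assoc)
  then have 1: "inv (\<theta> a) \<otimes> u \<otimes> x = \<theta> d' \<otimes> inv (\<theta> a) \<otimes> u"
    using abc d'c by (simp add: right_cancel)
  define e where "e = a \<otimes> d' \<otimes> inv a"
  have eG: "e \<in> G" using ab d' sub by (simp add: e_def generate_mult generate_inv)
  have "u \<otimes> x = \<theta> a \<otimes> (inv (\<theta> a) \<otimes> u \<otimes> x)" using abc by (simp flip: m_assoc)
  also have "\<dots> = \<theta> e \<otimes> u" unfolding 1 using abc d'c by (simp add: e_def m_assoc)
  finally have 2: "u \<otimes> x = \<theta> e \<otimes> u" .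
  have "len (inv (\<theta> (inv e)) \<otimes> (u \<otimes> \<one>)) = len (inv e) + len u + len \<one>"
    using eG sub by (intro len_conj) (auto intro: generate_inv generate.one)
  then have "len (\<theta> e \<otimes> u) = len e + len u" using eG by simp
  moreover have "len (u \<otimes> x) = Suc (len u)" using not_desc_len[OF uc abc(4)] umin[OF x] by simp
  ultimately have "len e = 1" using 2 by simp
  then have "e \<in> {s, t}" using generate_len_1[OF sub eG] by blast
  then show ?thesis using 2 by (auto simp: com_def)
qed

lemma chains_semi:
  assumes c: "com s s" and ct: "\<And>j. j \<in> {s, t} \<Longrightarrow> \<not> com j t" and m: "0 < m"
  shows "\<exists>w. dihedral_chains u s t m w \<and> \<not> bad w s t"
proof -
  obtain k where k: "m = Suc k" using m by (cases m) auto
  let ?w = "inv (\<theta> (altp t s k)) \<otimes> (u \<otimes> s) \<otimes> altp t s k"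
  have "dihedral_chains u s t m ?w"
    unfolding dihedral_chains_def
    using chain_semi[OF c ct, of k] chain_semi_top[OF c ct k] k by (simp del: alternating.simps)
  moreover have "\<not> bad ?w s t"
  proof
    assume "bad ?w s t"
    moreover have "?w = inv (\<theta> (altp t s k)) \<otimes> u \<otimes> (s \<otimes> altp t s k)" using s t by (simp add: m_assoc)
    ultimately show False
      using bad_imp_com[of "altp t s k" "s \<otimes> altp t s k" t] ct altp_st
      by (auto simp: generate_mult generate_J)
  qed
  ultimately show ?thesis by blast
qed

text \<open>Since \<open>com\<close> is symmetric, \<open>u\<close> carries both letters to
  \<theta>-images, straight or crossed, or it carries at most one, and then to its own image. By
  \<open>bad_imp_com\<close> only the first two shapes can be bad.\<close>

lemma chains:
  assumes m: "0 < m"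
  shows "\<exists>k w. 0 < k \<and> k \<le> m \<and> dihedral_chains u s t k w \<and> (k < m \<longleftrightarrow> bad w s t)"
proof -
  have m2: "2 \<le> m" using m m1 by simp
  have b: "altp t s m = altp s t m" by (rule altp_braid_st) auto
  let ?P = "\<lambda>r. \<exists>j\<in>{s, t}. com j r"
  consider "com s s" "com t t" | "com s t" "com t s" | "com s s" "\<not> ?P t" | "com t t" "\<not> ?P s"
    | "\<not> ?P s" "\<not> ?P t"
    using com_sym s t by blast
  then show ?thesis
  proof cases
    case 1
    let ?k = "Suc (m div 2)"
    have "dihedral_chains u s t ?k (u \<otimes> altp s t m)"
      using chain_fixed_top[OF 1 m2] dihedral_minimal.chain_fixed_top[OF swap] 1 m2 b
      by (simp add: dihedral_chains_def swap_m del: alternating.simps)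
    moreover have "?k < m \<longleftrightarrow> bad (u \<otimes> altp s t m) s t" unfolding bad_fixed[OF 1 m2] by auto
    moreover have "?k \<le> m" using m2 by auto
    ultimately show ?thesis by blast
  next
    case 2
    let ?k = "Suc m div 2"
    have "dihedral_chains u s t ?k (u \<otimes> altp s t m)"
      using chain_swapped_top[OF 2 m2] dihedral_minimal.chain_swapped_top[OF swap] 2 m2 b
      by (simp add: dihedral_chains_def swap_m del: alternating.simps)
    moreover have "?k < m" "0 < ?k" using m2 by auto
    ultimately show ?thesis using bad_swapped[OF 2 m2] by (intro exI[of _ ?k] exI[of _ "u \<otimes> altp s t m"]) auto
  next
    case 3
    then show ?thesis using chains_semi m by blast
  next
    case 4
    then have "\<not> com j s" if "j \<in> {t, s}" for j using that by blast
    then obtain w where "dihedral_chains u t s m w" "\<not> bad w t s"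
      using dihedral_minimal.chains_semi[OF swap 4(1)] m by (auto simp: swap_m)
    then show ?thesis using m bad_sym[OF s t] dihedral_chains_sym by blast
  next
    case 5
    let ?w = "inv (\<theta> (altp s t m)) \<otimes> u \<otimes> altp s t m"
    have "\<not> com j s" "\<not> com j t" if "j \<in> {s, t}" for j using 5 that by blast+
    then have "dihedral_chains u s t m ?w"
      using chain_generic_top[of m] dihedral_minimal.chain_generic_top[OF swap, of m] b
      by (simp add: dihedral_chains_def swap_m insert_commute)
    moreover have "\<not> bad ?w s t" using bad_imp_com[of "altp s t m" "altp s t m" s] 5 altp_st by blast
    ultimately show ?thesis using m by blast
  qed
qed

text \<open>For infinite order the chains never meet, which later shows that two descents of a
  twisted involution have finite \<open>m(s,t)\<close>.\<close>

lemma infinite_chain: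
  assumes m: "m = 0"
  shows "ascw u (alternating s t n)"
proof -
  let ?P = "\<lambda>r. \<exists>j\<in>{s, t}. com j r"
  have suc: "ascw u (alternating s t n)" if "ascw u (alternating s t (Suc n))"
    using that unfolding alternating_snoc ascw_append by blast
  consider "com s s" "com t t" | "com s t" "com t s" | "com s s" "\<not> ?P t" | "\<not> ?P s"
    using com_sym s t by blast
  then show ?thesis
  proof cases
    case 1 then show ?thesis using chain_fixed[of n] m suc by blast
  next
    case 2 then show ?thesis using chain_swapped[of n] m by blast
  next
    case 3
    then have "ascw u (alternating s t (Suc n))" using chain_semi[of n] m by blast
    then show ?thesis by (rule suc)
  next
    case 4 then show ?thesis using chain_generic[of n] m by blast
  qed
qed

end

context twisted_coxeter
begin

section \<open>Elements with two given descents\<close>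

lemma not_ascw_repeat:
  assumes "w \<in> I" "a \<in> lists S" "r \<in> S"
  shows "\<not> ascw w (a @ [r, r] @ b)"
  using assms foldl_tact_I[of w a] by (simp add: ascw_append desc_tact)

lemma ascw_alternating:
  assumes "w \<in> I" "s \<in> S" "t \<in> S" "q \<in> lists {s, t}" "ascw w q"
  shows "q = alternating s t (length q) \<or> q = alternating t s (length q)"
proof -
  have q: "q \<in> lists S" using assms by (auto simp: in_lists_conv_set)
  consider k where "q = alternating s t k" | k where "q = alternating t s k"
    | a b r where "q = a @ [r, r] @ b"
    using alternating_or_repeat[OF assms(4)] by blast
  then show ?thesis
  proof cases
    case 3
    then show ?thesis using not_ascw_repeat[of w a r b] assms(1,5) q by simp
  qed auto
qed

lemma ex_dihedral_bottom:
  assumes "w \<in> I" "s \<in> S" "t \<in> S"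
  shows "\<exists>u\<in>I. \<exists>q\<in>lists {s, t}. \<not> desc u s \<and> \<not> desc u t \<and> ascw u q \<and> foldl tact u q = w"
  using assms(1)
proof (induction "len w" arbitrary: w rule: less_induct)
  case less
  show ?case
  proof (cases "\<exists>r\<in>{s, t}. desc w r")
    case True
    then obtain r where r: "r \<in> {s, t}" "desc w r" "r \<in> S" using assms by blast
    then obtain u q where uq: "u \<in> I" "q \<in> lists {s, t}" "\<not> desc u s" "\<not> desc u t" "ascw u q"
      "foldl tact u q = tact w r"
      using less.hyps[of "tact w r"] less.prems len_tact_desc[of w r] by auto
    have "ascw u (q @ [r])" "foldl tact u (q @ [r]) = w"
      using uq r less.prems by (auto simp: ascw_append desc_tact tact_tact)
    moreover have "q @ [r] \<in> lists {s, t}" using uq r by simp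
    ultimately show ?thesis using uq by blast
  next
    case False
    then show ?thesis using less.prems by (intro bexI[of _ w] bexI[of _ "[]"]) auto
  qed
qed

lemma ascw_alternating_prefix:
  "ascw w (alternating s t (i + j)) \<Longrightarrow> ascw w (alternating s t i)"
  by (simp add: alternating_add ascw_append)

lemma ascw_alternating_Suc:
  "ascw w (alternating s t (Suc i)) \<Longrightarrow> \<not> desc (foldl tact w (alternating s t i)) (if even i then s else t)"
  unfolding alternating_snoc ascw_append by simp

lemma dihedral_chains_desc:
  assumes u: "u \<in> I" and st: "s \<in> S" "t \<in> S" and k: "0 < k" and c: "dihedral_chains u s t k w"
  shows "desc w s" "desc w t"
proof -
  obtain n where n: "k = Suc n" using k by (cases k) auto
  have *: "desc w (if even n then a else b)"
    if ab: "a \<in> S" "b \<in> S" and w: "ascw u (alternating a b k)" "foldl tact u (alternating a b k) = w" for a b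
  proof -
    have y: "foldl tact u (alternating a b n) \<in> I" using u ab by (intro foldl_tact_I alternating_S)
    have "w = tact (foldl tact u (alternating a b n)) (if even n then a else b)"
      using w(2) unfolding n alternating_snoc foldl_append by simp
    then show ?thesis using ascw_alternating_Suc[of u a b n] w(1) n desc_tact[OF y] ab by simp
  qed
  have "desc w (if even n then s else t)" "desc w (if even n then t else s)"
    using *[of s t] *[of t s] st c by (auto simp: dihedral_chains_def simp del: alternating.simps)
  then show "desc w s" "desc w t" by (auto split: if_splits)
qed

text \<open>Ascending words from \<open>u\<close> alternate, so they follow one of the two chains;
  both letters being descents of \<open>w\<close> stops them at length \<open>k\<close>, and below
  that the chain itself continues with an ascent.\<close>

lemma dihedral_chains_length:
  assumes u: "u \<in> I" and st: "s \<in> S" "t \<in> S" and k: "0 < k" and c: "dihedral_chains u s t k w"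
    and q: "q \<in> lists {s, t}" "ascw u q"
  shows "length q \<le> k"
    and "length q = k \<Longrightarrow> foldl tact u q = w"
    and "length q < k \<Longrightarrow> \<exists>r\<in>{s, t}. \<not> desc (foldl tact u q) r"
proof -
  have qa: "q = alternating s t (length q) \<or> q = alternating t s (length q)"
    using ascw_alternating u st q by blast
  have w: "foldl tact u (alternating s t k) = w" "foldl tact u (alternating t s k) = w"
    "ascw u (alternating s t k)" "ascw u (alternating t s k)"
    using c by (auto simp: dihedral_chains_def)
  show "length q = k \<Longrightarrow> foldl tact u q = w" using qa w by auto
  show "length q \<le> k"
  proof (rule ccontr)
    assume "\<not> length q \<le> k"
    then obtain j where j: "length q = Suc k + j" by (metis add_Suc less_imp_Suc_add not_le)
    then have "ascw u (alternating s t (Suc k)) \<or> ascw u (alternating t s (Suc k))"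
      using qa q(2) ascw_alternating_prefix by metis
    then show False using ascw_alternating_Suc[of u _ _ k] w dihedral_chains_desc[OF u st k c] by metis
  qed
  show "\<exists>r\<in>{s, t}. \<not> desc (foldl tact u q) r" if lt: "length q < k"
  proof -
    obtain j where j: "k = Suc (length q) + j" using lt by (metis add_Suc less_imp_Suc_add)
    have "ascw u (alternating s t (Suc (length q)))" "ascw u (alternating t s (Suc (length q)))"
      using w(3,4) unfolding j by (blast intro: ascw_alternating_prefix)+
    then have "\<not> desc (foldl tact u (alternating s t (length q))) (if even (length q) then s else t)"
      "\<not> desc (foldl tact u (alternating t s (length q))) (if even (length q) then t else s)"
      by (auto dest!: ascw_alternating_Suc simp del: alternating.simps split del: if_split)
    then show ?thesis using qa by (metis insertI1 insertI2)
  qed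
qed

lemma dihedral_minimalI:
  "u \<in> I \<Longrightarrow> s \<in> S \<Longrightarrow> t \<in> S \<Longrightarrow> s \<noteq> t \<Longrightarrow> \<not> desc u s \<Longrightarrow> \<not> desc u t \<Longrightarrow> dihedral_minimal W S \<theta> u s t"
  by unfold_locales

text \<open>\<open>w\<close> lies on a chain above its bottom \<open>u\<close>, and only the common
  top of the two chains has both descents.\<close>

lemma two_descents:
  assumes w: "w \<in> I" and st: "s \<in> S" "t \<in> S" "s \<noteq> t" and d: "desc w s" "desc w t"
  shows "\<exists>u\<in>I. \<exists>k. 0 < cox_m W s t \<and> 0 < k \<and> k \<le> cox_m W s t \<and> dihedral_chains u s t k w \<and>
    (k < cox_m W s t \<longleftrightarrow> bad w s t)"
proof -
  obtain u q where uq: "u \<in> I" "q \<in> lists {s, t}" "\<not> desc u s" "\<not> desc u t" "ascw u q"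
    "foldl tact u q = w" using ex_dihedral_bottom[OF w st(1,2)] by blast
  interpret dm: dihedral_minimal W S \<theta> u s t using dihedral_minimalI uq st by blast
  interpret dm': dihedral_minimal W S \<theta> u t s by (rule dm.swap)
  have "dm.m \<noteq> 0"
  proof
    assume m: "dm.m = 0"
    then have "ascw u (alternating s t (Suc (length q)))" "ascw u (alternating t s (Suc (length q)))"
      using dm.infinite_chain dm'.infinite_chain dm.swap_m by (auto simp del: alternating.simps)
    then show False
      using ascw_alternating[OF uq(1) st(1,2) uq(2,5)] ascw_alternating_Suc[of u s t "length q"]
        ascw_alternating_Suc[of u t s "length q"] uq(6) d by (metis (full_types))
  qed
  then obtain k w' where k: "0 < k" "k \<le> dm.m" "dihedral_chains u s t k w'" "k < dm.m \<longleftrightarrow> bad w' s t"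
    using dm.chains by auto
  note q = dihedral_chains_length[OF uq(1) st(1,2) k(1,3) uq(2,5), unfolded uq(6)]
  have "\<not> length q < k" using q(3) d by blast
  then have "length q = k" using q(1) by simp
  then have "w = w'" using q(2) by simp
  then show ?thesis using k uq(1) \<open>dm.m \<noteq> 0\<close> by (auto simp: dm.m_def)
qed

text \<open>Chains have at most \<open>m\<close> letters, so an ascending word with \<open>m\<close>
  letters starts at the bottom and ends at the top. Hence braid moves preserve reducedness, and at
  the end of a word they never link a bad pair.\<close>

lemma braid_ascw:
  assumes v: "v \<in> I" and st: "s \<in> S" "t \<in> S" "s \<noteq> t" and m: "0 < cox_m W s t"
    and a: "ascw v (alternating s t (cox_m W s t))"
  defines "w \<equiv> foldl tact v (alternating s t (cox_m W s t))"
  shows "foldl tact v (alternating t s (cox_m W s t)) = w" "desc w s" "desc w t" "\<not> bad w s t"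
proof -
  obtain u q where uq: "u \<in> I" "q \<in> lists {s, t}" "\<not> desc u s" "\<not> desc u t" "ascw u q"
    "foldl tact u q = v" using ex_dihedral_bottom[OF v st(1,2)] by blast
  interpret dm: dihedral_minimal W S \<theta> u s t using dihedral_minimalI uq st by blast
  obtain k w' where k: "0 < k" "k \<le> dm.m" "dihedral_chains u s t k w'" "k < dm.m \<longleftrightarrow> bad w' s t"
    using dm.chains m by (auto simp: dm.m_def)
  have "alternating s t dm.m \<in> lists {s, t}" by (rule alternating_in_lists) auto
  then have "length (q @ alternating s t dm.m) \<le> k"
    using uq a by (intro dihedral_chains_length(1)[OF uq(1) st(1,2) k(1,3)]) (auto simp: ascw_append dm.m_def)
  then have "length q + dm.m \<le> k" by simp
  then have "length q = 0" "k = dm.m" using k(2) by linarith+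
  then have "q = []" by simp
  have km: "cox_m W s t = k" using \<open>k = dm.m\<close> by (simp add: dm.m_def)
  have uv: "u = v" using uq(6) \<open>q = []\<close> by simp
  have "w' = w" using k(3) by (simp add: dihedral_chains_def w_def km uv)
  then show "foldl tact v (alternating t s (cox_m W s t)) = w" "\<not> bad w s t"
    using k(3,4) by (simp_all add: dihedral_chains_def dm.m_def km uv)
  show "desc w s" "desc w t"
    using dihedral_chains_desc[OF uq(1) st(1,2) k(1,3)] \<open>w' = w\<close> by auto
qed

section \<open>Reduced expressions and moves\<close>

definition asc_expr :: "'a \<Rightarrow> 'a list \<Rightarrow> bool" where
  "asc_expr w x \<longleftrightarrow> x \<in> lists S \<and> ascw \<one> x \<and> foldl tact \<one> x = w"

lemma asc_expr_I: "asc_expr w x \<Longrightarrow> w \<in> I"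
  using foldl_tact_I[of \<one> x] by (auto simp: asc_expr_def)

lemma asc_expr_snoc:
  assumes w: "w \<in> I"
  shows "asc_expr w (x @ [s]) \<longleftrightarrow> s \<in> S \<and> desc w s \<and> asc_expr (tact w s) x"
proof -
  have "s \<in> S \<and> desc w s \<and> asc_expr (tact w s) x" if e: "asc_expr w (x @ [s])"
  proof -
    let ?v = "foldl tact \<one> x"
    have x: "x \<in> lists S" "s \<in> S" "ascw \<one> x" "\<not> desc ?v s" "tact ?v s = w"
      using e by (simp_all add: asc_expr_def ascw_append)
    have v: "?v \<in> I" using x by (intro foldl_tact_I) simp_all
    show ?thesis
      using desc_tact[OF v x(2)] tact_tact[OF v x(2)] x unfolding x(5) by (simp add: asc_expr_def)
  qed
  moreover have "asc_expr w (x @ [s])" if "s \<in> S" "desc w s" "asc_expr (tact w s) x"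
    using that w by (simp add: asc_expr_def ascw_append desc_tact tact_tact)
  ultimately show ?thesis by blast
qed

lemma asc_expr_one: "asc_expr \<one> x \<longleftrightarrow> x = []"
proof
  show "x = []" if "asc_expr \<one> x"
  proof (cases x rule: rev_cases)
    case (snoc y s)
    then show ?thesis using that asc_expr_snoc[OF one_I, of y s] not_desc_one[of s] by blast
  qed simp
qed (simp add: asc_expr_def)

lemma asc_expr_Nil: "asc_expr w [] \<longleftrightarrow> w = \<one>"
  by (auto simp: asc_expr_def)

lemma ex_asc_expr: "w \<in> I \<Longrightarrow> \<exists>x. asc_expr w x"
proof (induction "len w" arbitrary: w rule: less_induct)
  case less
  show ?case
  proof (cases "w = \<one>")
    case False
    then obtain s where s: "s \<in> S" "desc w s" using ex_desc[OF I_closed[OF less.prems]] by blast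
    then obtain x where "asc_expr (tact w s) x"
      using less.hyps[of "tact w s"] len_tact_desc less.prems tact_I by blast
    then show ?thesis using asc_expr_snoc less.prems s by blast
  qed (auto simp: asc_expr_one)
qed

lemma ex_asc_expr_last:
  "w \<in> I \<Longrightarrow> s \<in> S \<Longrightarrow> desc w s \<Longrightarrow> \<exists>x. asc_expr w (x @ [s])"
  using ex_asc_expr[of "tact w s"] asc_expr_snoc by auto

lemma asc_expr_append:
  "asc_expr u z \<Longrightarrow> q \<in> lists S \<Longrightarrow> ascw u q \<Longrightarrow> asc_expr (foldl tact u q) (z @ q)"
  by (auto simp: asc_expr_def ascw_append)

lemma last_alternating: "last (alternating s t (Suc n)) = (if even n then s else t)"
  by (simp add: alternating_snoc del: alternating.simps)

text \<open>The parity of \<open>k\<close> decides which alternating word ends in \<open>s\<close>;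
  naming the first letters \<open>a\<close> and \<open>b\<close> absorbs it.\<close>

lemma ex_alternating_exprs:
  assumes w: "w \<in> I" and st: "s \<in> S" "t \<in> S" "s \<noteq> t" and d: "desc w s" "desc w t"
  shows "\<exists>z k a b. 0 < k \<and> k \<le> cox_m W s t \<and> (k < cox_m W s t \<longleftrightarrow> bad w s t) \<and> {a, b} = {s, t} \<and>
    asc_expr w (z @ alternating a b k) \<and> asc_expr w (z @ alternating b a k) \<and>
    last (alternating a b k) = s \<and> last (alternating b a k) = t"
proof -
  obtain u k where u: "u \<in> I" "0 < k" "k \<le> cox_m W s t" "dihedral_chains u s t k w"
    "k < cox_m W s t \<longleftrightarrow> bad w s t" using two_descents[OF assms] by blast
  obtain z where z: "asc_expr u z" using ex_asc_expr u by blast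
  obtain n where n: "k = Suc n" using u by (cases k) auto
  have e: "asc_expr w (z @ alternating s t k)" "asc_expr w (z @ alternating t s k)"
    using asc_expr_append[OF z alternating_S[OF st(1,2)], of k] asc_expr_append[OF z alternating_S[OF st(2,1)], of k]
      u(4) by (auto simp: dihedral_chains_def)
  show ?thesis
  proof (cases "even n")
    case True
    then show ?thesis using u e n last_alternating[of s t n] last_alternating[of t s n]
      by (intro exI[of _ z] exI[of _ k] exI[of _ s] exI[of _ t]) (simp del: alternating.simps)
  next
    case False
    then show ?thesis using u e n last_alternating[of s t n] last_alternating[of t s n]
      by (intro exI[of _ z] exI[of _ k] exI[of _ t] exI[of _ s])
        (simp del: alternating.simps add: insert_commute)
  qed
qed

text \<open>The induction behind Matsumoto's theorem: equal last letters are removed, and different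
  ones are bridged by two alternating ends of equal length over a common beginning
  \<open>z\<close>.\<close>

lemma asc_expr_length:
  assumes "asc_expr w x" "asc_expr w y"
  shows "length x = length y"
  using assms
proof (induction "len w" arbitrary: w x y rule: less_induct)
  case less
  have w: "w \<in> I" using asc_expr_I less.prems by blast
  have same: "length x' = length y'" if "asc_expr w (x' @ [s])" "asc_expr w (y' @ [s])" for x' y' s
    using that asc_expr_snoc[OF w] less.hyps[of "tact w s" x' y'] len_tact_desc w by blast
  show ?case
  proof (cases "x = [] \<or> y = []")
    case True
    then show ?thesis using less.prems by (auto simp: asc_expr_Nil asc_expr_one)
  next
    case False
    then obtain x' s y' t where xy: "x = x' @ [s]" "y = y' @ [t]" by (metis rev_exhaust)
    show ?thesis
    proof (cases "s = t")
      case True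
      then show ?thesis using same[of x' s y'] xy less.prems by simp
    next
      case False
      have st: "s \<in> S" "t \<in> S" "desc w s" "desc w t"
        using less.prems(1)[unfolded xy] less.prems(2)[unfolded xy] asc_expr_snoc[OF w] by blast+
      from ex_alternating_exprs[OF w st(1,2) False st(3,4)] obtain z k a b where e: "0 < k" "asc_expr w (z @ alternating a b k)"
        "asc_expr w (z @ alternating b a k)" "last (alternating a b k) = s" "last (alternating b a k) = t"
        by (elim exE conjE)
      obtain n where n: "k = Suc n" using e by (cases k) auto
      have "alternating a b k = alternating a b n @ [s]" "alternating b a k = alternating b a n @ [t]"
        using e(4,5) unfolding n last_alternating alternating_snoc by simp_all
      then have "asc_expr w ((z @ alternating a b n) @ [s])" "asc_expr w ((z @ alternating b a n) @ [t])"
        using e by simp_all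
      then show ?thesis using same[of x' s "z @ alternating a b n"] same[of y' t "z @ alternating b a n"]
          xy less.prems by simp
    qed
  qed
qed

section \<open>Rank as the common length of reduced expressions\<close>

definition rank :: "'a \<Rightarrow> nat" where
  "rank w = length (SOME x. asc_expr w x)"

lemma rank_eq: "asc_expr w x \<Longrightarrow> length x = rank w"
  unfolding rank_def by (metis asc_expr_length someI)

lemma rank_tact_asc:
  assumes w: "w \<in> I" and s: "s \<in> S" and d: "\<not> desc w s"
  shows "rank (tact w s) = Suc (rank w)"
proof -
  obtain x where x: "asc_expr w x" using ex_asc_expr w by blast
  have "asc_expr (tact w s) (x @ [s])"
    using x w s d by (subst asc_expr_snoc) (simp_all add: desc_tact tact_tact)
  from rank_eq[OF this] rank_eq[OF x] show ?thesis by simp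
qed

lemma rank_tact_desc:
  assumes w: "w \<in> I" and s: "s \<in> S" and d: "desc w s"
  shows "rank w = Suc (rank (tact w s))"
  using rank_tact_asc[of "tact w s" s] w s d by (simp add: desc_tact tact_tact)

lemma rank_le:
  assumes "x \<in> lists S"
  shows "rank (foldl tact \<one> x) \<le> length x \<and> (rank (foldl tact \<one> x) = length x \<longrightarrow> ascw \<one> x)"
  using assms
proof (induction x rule: rev_induct)
  case Nil
  then show ?case using rank_eq[of \<one> "[]"] by (simp add: asc_expr_def)
next
  case (snoc s x)
  let ?w = "foldl tact \<one> x"
  have s: "s \<in> S" "x \<in> lists S" "?w \<in> I" using snoc.prems by (auto intro!: foldl_tact_I)
  show ?case
    using snoc.IH s rank_tact_asc[of ?w s] rank_tact_desc[of ?w s] by (cases "desc ?w s") (auto simp: ascw_append)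
qed

lemma reduced_iff: "x \<in> reduced_expressions W S \<theta> w \<longleftrightarrow> asc_expr w x"
proof
  assume x: "x \<in> reduced_expressions W S \<theta> w"
  then have x': "x \<in> lists S" "foldl tact \<one> x = w" by (auto simp: reduced_expressions_def expressions_def)
  then have "w \<in> I" using foldl_tact_I[of \<one> x] by auto
  then obtain y where y: "asc_expr w y" using ex_asc_expr by blast
  then have "length x \<le> length y"
    using x by (auto simp: reduced_expressions_def expressions_def asc_expr_def)
  then have "rank w = length x" using rank_eq[OF y] rank_le[OF x'(1)] x'(2) by simp
  then show "asc_expr w x" using rank_le[OF x'(1)] x' by (simp add: asc_expr_def)
next
  assume x: "asc_expr w x"
  have "length x \<le> length v" if "v \<in> expressions W S \<theta> w" for v
    using that rank_eq[OF x] rank_le[of v] by (simp add: expressions_def)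
  then show "x \<in> reduced_expressions W S \<theta> w"
    using x by (simp add: reduced_expressions_def expressions_def asc_expr_def)
qed

lemma asc_expr_if_same_length:
  assumes "asc_expr w x" "y \<in> lists S" "foldl tact \<one> y = w" "length y = length x"
  shows "asc_expr w y"
  using assms rank_eq[OF assms(1)] rank_le[OF assms(2)] by (simp add: asc_expr_def)

section \<open>Moves between reduced expressions of one element\<close>

definition move_in :: "'a set set \<Rightarrow> 'a \<Rightarrow> 'a list \<Rightarrow> 'a list \<Rightarrow> bool" where
  "move_in K w x y \<longleftrightarrow> move W S \<theta> K x y \<and> asc_expr w x \<and> asc_expr w y"

text \<open>An initial move on the longer word is legal only if that word is reduced; this is why
  \<open>move_in\<close> keeps track of the element that both ends express.\<close>

lemma move_in_snoc:
  assumes w: "w \<in> I" and s: "s \<in> S" "desc w s" and m: "move_in K (tact w s) x y"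
  shows "move_in K w (x @ [s]) (y @ [s])"
proof -
  have xy: "asc_expr w (x @ [s])" "asc_expr w (y @ [s])"
    using m s asc_expr_snoc[OF w] by (auto simp: move_in_def)
  have "braid_move W S x y \<or> (\<exists>J\<in>K. initial_move W S \<theta> (longest_element W J) x y)"
    using m unfolding move_in_def move_def by blast
  then have "move W S \<theta> K (x @ [s]) (y @ [s])"
  proof
    assume "braid_move W S x y"
    then obtain p q a b where pq: "p \<in> lists S" "q \<in> lists S" "a \<in> S" "b \<in> S" "a \<noteq> b" "0 < cox_m W a b"
      "x = p @ alternating a b (cox_m W a b) @ q" "y = p @ alternating b a (cox_m W a b) @ q"
      unfolding braid_move_def by blast
    have "braid_move W S (x @ [s]) (y @ [s])"
      unfolding braid_move_def
      by (rule bexI[of _ p], rule bexI[of _ "q @ [s]"], rule bexI[of _ a], rule bexI[of _ b])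
        (use pq s in auto)
    then show ?thesis by (simp add: move_def)
  next
    assume "\<exists>J\<in>K. initial_move W S \<theta> (longest_element W J) x y"
    then obtain J x0 y0 z where J: "J \<in> K" "x0 \<in> reduced_expressions W S \<theta> (longest_element W J)"
      "y0 \<in> reduced_expressions W S \<theta> (longest_element W J)" "x = x0 @ z" "y = y0 @ z"
      unfolding initial_move_def by blast
    have "initial_move W S \<theta> (longest_element W J) (x @ [s]) (y @ [s])"
      unfolding initial_move_def
      by (rule bexI[of _ x0], rule bexI[of _ y0], rule exI[of _ "z @ [s]"])
        (use J xy w in \<open>auto simp: reduced_iff\<close>)
    then show ?thesis using J(1) unfolding move_def by blast
  qed
  then show ?thesis using xy by (simp add: move_in_def)
qed

lemma moves_in_snoc:
  assumes w: "w \<in> I" and s: "s \<in> S" "desc w s" and m: "(move_in K (tact w s))\<^sup>*\<^sup>* x y"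
  shows "(move_in K w)\<^sup>*\<^sup>* (x @ [s]) (y @ [s])"
  using m by induction (auto intro: rtranclp.rtrancl_into_rtrancl move_in_snoc[OF w s])

lemma braid_link:
  assumes w: "w \<in> I" and st: "s \<in> S" "t \<in> S" "s \<noteq> t" and d: "desc w s" "desc w t" and nb: "\<not> bad w s t"
  shows "\<exists>x y. move_in K w x y \<and> x \<noteq> [] \<and> y \<noteq> [] \<and> last x = s \<and> last y = t"
proof -
  let ?m = "cox_m W s t"
  obtain z k a b where e: "0 < k" "k \<le> ?m" "k < ?m \<longleftrightarrow> bad w s t" "{a, b} = {s, t}"
    "asc_expr w (z @ alternating a b k)" "asc_expr w (z @ alternating b a k)"
    "last (alternating a b k) = s" "last (alternating b a k) = t"
    using ex_alternating_exprs[OF w st d] by (elim exE conjE)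
  have k: "k = ?m" using e nb by simp
  have ab: "a \<in> S" "b \<in> S" "a \<noteq> b" "cox_m W a b = k"
    using e(4) st k cox_m_sym[of s t] by (auto simp: doubleton_eq_iff)
  have z: "z \<in> lists S" using e by (auto simp: asc_expr_def)
  have "braid_move W S (z @ alternating a b k) (z @ alternating b a k)"
    unfolding braid_move_def
    by (rule bexI[of _ z], rule bexI[of _ "[]"], rule bexI[of _ a], rule bexI[of _ b])
      (use ab e z in auto)
  then have "move_in K w (z @ alternating a b k) (z @ alternating b a k)"
    using e by (simp add: move_in_def move_def)
  moreover have "alternating a b k \<noteq> []" "alternating b a k \<noteq> []" using e(1) by (cases k; simp)+
  ultimately show ?thesis using e by (metis append_is_Nil_conv last_append)
qed

text \<open>Let \<open>A\<close> consist of the last letters of the expressions reachable from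
  \<open>x\<close>. Equal last letters are connected by induction and non-bad pairs by a braid move,
  so \<open>A\<close> can miss the last letter of \<open>y\<close> only if all pairs across are
  bad.\<close>

lemma connected_or_split:
  assumes w: "w \<in> I"
    and IH: "\<And>v x y. v \<in> I \<Longrightarrow> len v < len w \<Longrightarrow> asc_expr v x \<Longrightarrow> asc_expr v y \<Longrightarrow> (move_in K v)\<^sup>*\<^sup>* x y"
    and xy: "asc_expr w x" "asc_expr w y"
  shows "(move_in K w)\<^sup>*\<^sup>* x y \<or>
    (\<exists>A B. {s \<in> S. desc w s} = A \<union> B \<and> A \<inter> B = {} \<and> A \<noteq> {} \<and> B \<noteq> {} \<and> (\<forall>a\<in>A. \<forall>b\<in>B. bad w a b))"
proof (cases "x = [] \<or> y = []")
  case True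
  then show ?thesis using xy by (auto simp: asc_expr_Nil asc_expr_one)
next
  case False
  let ?D = "{s \<in> S. desc w s}"
  have last_desc: "last z \<in> ?D" if "asc_expr w z" "z \<noteq> []" for z
    using that asc_expr_snoc[OF w, of "butlast z" "last z"] by simp
  have same: "(move_in K w)\<^sup>*\<^sup>* z z'"
    if z: "asc_expr w z" "asc_expr w z'" "z \<noteq> []" "z' \<noteq> []" "last z = last z'" for z z'
  proof -
    let ?s = "last z"
    have e: "z = butlast z @ [?s]" "z' = butlast z' @ [?s]"
      using append_butlast_last_id z(3-5) by metis+
    have s: "?s \<in> S" "desc w ?s" using last_desc z by auto
    have "asc_expr (tact w ?s) (butlast z)" "asc_expr (tact w ?s) (butlast z')"
      using z e asc_expr_snoc[OF w] by metis+
    then have "(move_in K (tact w ?s))\<^sup>*\<^sup>* (butlast z) (butlast z')"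
      using IH[OF tact_I[OF w s(1)] len_tact_desc[OF w s]] by blast
    then show ?thesis using moves_in_snoc[OF w s] e by metis
  qed
  define A where "A = {s \<in> ?D. \<exists>z. asc_expr w z \<and> z \<noteq> [] \<and> last z = s \<and> (move_in K w)\<^sup>*\<^sup>* x z}"
  have xA: "last x \<in> A" using xy False last_desc[of x] by (auto simp: A_def)
  show ?thesis
  proof (cases "last y \<in> A")
    case True
    then obtain z where "asc_expr w z" "z \<noteq> []" "last z = last y" "(move_in K w)\<^sup>*\<^sup>* x z"
      by (auto simp: A_def)
    then show ?thesis using same[of z y] xy False by (meson rtranclp_trans)
  next
    case yA: False
    define B where "B = ?D - A"
    have "bad w a b" if a: "a \<in> A" and b: "b \<in> B" for a b
    proof (rule ccontr)
      assume nb: "\<not> bad w a b"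
      have ab: "a \<in> S" "b \<in> S" "a \<noteq> b" "desc w a" "desc w b" using a b by (auto simp: A_def B_def)
      obtain c d where cd: "move_in K w c d" "c \<noteq> []" "d \<noteq> []" "last c = a" "last d = b"
        using braid_link[OF w ab nb] by blast
      obtain z where z: "asc_expr w z" "z \<noteq> []" "last z = a" "(move_in K w)\<^sup>*\<^sup>* x z"
        using a by (auto simp: A_def)
      have "(move_in K w)\<^sup>*\<^sup>* z c" using same[of z c] z cd by (simp add: move_in_def)
      then have "(move_in K w)\<^sup>*\<^sup>* x d" using z(4) cd(1) by (meson rtranclp.rtrancl_into_rtrancl rtranclp_trans)
      then have "b \<in> A" using cd b by (auto simp: A_def B_def move_in_def)
      then show False using b by (simp add: B_def)
    qed
    moreover have "last y \<in> B" using yA last_desc[OF xy(2)] False by (simp add: B_def)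
    moreover have "?D = A \<union> B" "A \<inter> B = {}" by (auto simp: A_def B_def)
    ultimately show ?thesis using xA by blast
  qed
qed

lemma connects_if_split_longest:
  assumes split: "\<And>w A B. w \<in> I \<Longrightarrow> {s \<in> S. desc w s} = A \<union> B \<Longrightarrow> A \<inter> B = {} \<Longrightarrow> A \<noteq> {} \<Longrightarrow> B \<noteq> {} \<Longrightarrow>
    (\<forall>a\<in>A. \<forall>b\<in>B. bad w a b) \<Longrightarrow> \<exists>J\<in>K. longest_element W J = w"
  shows "connects_reduced_expressions W S \<theta> K"
proof -
  have main: "(move_in K w)\<^sup>*\<^sup>* x y" if "w \<in> I" "asc_expr w x" "asc_expr w y" for w x y
    using that
  proof (induction "len w" arbitrary: w x y rule: less_induct)
    case less
    have IH: "(move_in K v)\<^sup>*\<^sup>* x y" if "v \<in> I" "len v < len w" "asc_expr v x" "asc_expr v y" for v x y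
      using less.hyps that by blast
    consider "(move_in K w)\<^sup>*\<^sup>* x y" | A B where "{s \<in> S. desc w s} = A \<union> B" "A \<inter> B = {}" "A \<noteq> {}" "B \<noteq> {}"
      "\<forall>a\<in>A. \<forall>b\<in>B. bad w a b"
      using connected_or_split[OF less.prems(1) IH less.prems(2,3)] by blast
    then show ?case
    proof cases
      case 2
      then obtain J where J: "J \<in> K" "longest_element W J = w" using split less.prems(1) by meson
      have "initial_move W S \<theta> (longest_element W J) x y"
        unfolding initial_move_def J(2)
        by (rule bexI[of _ x], rule bexI[of _ y], rule exI[of _ "[]"]) (use less.prems in \<open>auto simp: reduced_iff\<close>)
      then have "move_in K w x y" using J less.prems by (auto simp: move_in_def move_def)
      then show ?thesis by blast
    qed
  qed
  have "(move W S \<theta> K)\<^sup>*\<^sup>* x y" if "(move_in K w)\<^sup>*\<^sup>* x y" for w x y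
    using that by (rule rtranclp_mono[THEN predicate2D, rotated]) (auto simp: move_in_def)
  then have "(move W S \<theta> K)\<^sup>*\<^sup>* x y" if "w \<in> I" "asc_expr w x" "asc_expr w y" for w x y
    using main that by blast
  then show ?thesis unfolding connects_reduced_expressions_def by (intro ballI) (simp add: reduced_iff)
qed

lemma longest_I:
  assumes J: "J \<subseteq> S" "\<theta> ` J = J" and p: "longest J p"
  shows "p \<in> I"
proof -
  have pg: "p \<in> generate W J" "p \<in> carrier W" using p J generate_carrier by (auto simp: longest_def)
  have "\<theta> p \<in> generate W J" using \<theta>_generate[OF J(1) pg(1)] J(2) by simp
  then have "longest J (\<theta> p)" using longest_maximal[OF J(1) p] pg by (intro longestI_maximal[OF J(1)]) auto
  then have "\<theta> p = p" using longest_unique J p by blast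
  then show ?thesis using longest_inv[OF J(1) p] pg by (intro I_I) auto
qed

text \<open>Membership of the last letter in \<open>A\<close> is invariant. A braid move changes
  that letter only at the very end, where it links a non-bad pair. An initial move changes it only
  by replacing the whole word; then \<open>p\<close> is the longest element for \<open>J'\<close>,
  and its descents give \<open>J' = J\<close>.\<close>

lemma necessary:
  assumes J: "J \<subseteq> S" "\<theta> ` J = J" and p: "longest J p"
    and AB: "J = A \<union> B" "A \<inter> B = {}" "A \<noteq> {}" "B \<noteq> {}" "\<And>a b. a \<in> A \<Longrightarrow> b \<in> B \<Longrightarrow> bad p a b"
    and K: "\<And>J'. J' \<in> K \<Longrightarrow> J' \<subseteq> S \<and> finite (generate W J')"
    and con: "connects_reduced_expressions W S \<theta> K"
  shows "J \<in> K"
proof (rule ccontr)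
  assume JK: "J \<notin> K"
  have pI: "p \<in> I" by (rule longest_I[OF J p])
  have D: "desc p r \<longleftrightarrow> r \<in> J" if "r \<in> S" for r using longest_descents[OF J(1) p that] .
  obtain a b where ab: "a \<in> A" "b \<in> B" "a \<in> S" "b \<in> S" using AB J by blast
  obtain x y where xy: "asc_expr p (x @ [a])" "asc_expr p (y @ [b])"
    using ex_asc_expr_last[OF pI] ab D AB(1) by (metis UnI1 UnI2)
  have "(move W S \<theta> K)\<^sup>*\<^sup>* (x @ [a]) (y @ [b])"
    using con xy pI unfolding connects_reduced_expressions_def by (auto simp: reduced_iff)
  then have "asc_expr p (y @ [b]) \<and> last (y @ [b]) \<in> A"
  proof induction
    case base
    then show ?case using xy ab by simp
  next
    case (step z z')
    then have z: "asc_expr p z" "last z \<in> A" by auto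
    have zS: "z \<in> lists S" "ascw \<one> z" "foldl tact \<one> z = p" using z by (auto simp: asc_expr_def)
    from step.hyps(2) show ?case unfolding move_def
    proof
      assume "braid_move W S z z'"
      then obtain p0 q s t where pq: "p0 \<in> lists S" "q \<in> lists S" "s \<in> S" "t \<in> S" "s \<noteq> t" "0 < cox_m W s t"
        "z = p0 @ alternating s t (cox_m W s t) @ q" "z' = p0 @ alternating t s (cox_m W s t) @ q"
        unfolding braid_move_def by blast
      define v where "v = foldl tact \<one> p0"
      have v: "v \<in> I" unfolding v_def using pq by (intro foldl_tact_I) auto
      have asc: "ascw v (alternating s t (cox_m W s t))" using zS(2) pq(7) by (simp add: ascw_append v_def)
      note br = braid_ascw[OF v pq(3-6) asc]
      have "foldl tact \<one> z' = p" using zS(3) pq(7,8) br(1) by (simp add: v_def)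
      moreover have "z' \<in> lists S" using pq by (simp add: alternating_S)
      moreover have "length z' = length z" unfolding pq(7,8) by simp
      ultimately have z': "asc_expr p z'" by (intro asc_expr_if_same_length[OF z(1)])
      have "last z' \<in> A"
      proof (cases "q = []")
        case False
        then show ?thesis using z(2) pq(7,8) by simp
      next
        case True
        obtain n where n: "cox_m W s t = Suc n" using pq(6) by (cases "cox_m W s t") auto
        have ne: "alternating s t (Suc n) \<noteq> []" "alternating t s (Suc n) \<noteq> []" by simp_all
        have l: "last z = (if even n then s else t)" "last z' = (if even n then t else s)"
          unfolding pq(7,8) True n append_Nil2 last_appendR[OF ne(1)] last_appendR[OF ne(2)] last_alternating
          by (rule refl)+
        have "foldl tact v (alternating s t (cox_m W s t)) = p" using zS(3) pq(7) True by (simp add: v_def)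
        then have d: "desc p s" "desc p t" "\<not> bad p s t" using br(2-4) by simp_all
        then have "\<not> bad p t s" using bad_sym[OF pq(3,4)] by simp
        then have "\<not> bad p (last z) (last z')" using d l by simp
        moreover have "last z' \<in> J" using D d pq(3,4) l by simp
        ultimately show ?thesis using AB(1,5) z(2) by blast
      qed
      then show ?thesis using z' by blast
    next
      assume "\<exists>J\<in>K. initial_move W S \<theta> (longest_element W J) z z'"
      then obtain J' x0 y0 zz where J': "J' \<in> K" "x0 \<in> reduced_expressions W S \<theta> (longest_element W J')"
        "y0 \<in> reduced_expressions W S \<theta> (longest_element W J')" "z = x0 @ zz" "z' = y0 @ zz"
        unfolding initial_move_def by blast
      note J' = J'(1) J'(2,3)[unfolded reduced_iff] J'(4,5)
      have "foldl tact \<one> z' = p" using zS(3) J' by (simp add: asc_expr_def)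
      moreover have "z' \<in> lists S" using J' zS(1) by (simp add: asc_expr_def)
      moreover have "length z' = length z" using asc_expr_length[OF J'(2,3)] J'(4,5) by simp
      ultimately have z': "asc_expr p z'" by (intro asc_expr_if_same_length[OF z(1)])
      have "zz \<noteq> []"
      proof
        assume "zz = []"
        then have e: "longest_element W J' = p" using zS(3) J' by (simp add: asc_expr_def)
        obtain d where d: "longest J' d" using finite_longest K J'(1) by blast
        have J'S: "J' \<subseteq> S" using K J'(1) by blast
        then have "d = p" using longest_element_eq d e by simp
        then have "r \<in> J' \<longleftrightarrow> r \<in> J" if "r \<in> S" for r using longest_descents[OF J'S d that] D[OF that] by simp
        then have "J' = J" using J J'S by blast
        then show False using J' JK by simp
      qed
      then show ?thesis using z' z(2) J' by simp
    qed
  qed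
  then show False using ab AB(2) by auto
qed

end

section \<open>The special parabolic subgroups\<close>

text \<open>As \<open>3 * (pi / 5) = pi - 2 * (pi / 5)\<close>, the triple and double angle formulas
  give a cubic equation, of which the root \<open>c = -1\<close> is split off.\<close>

lemma golden_ratio: "(2 * cos (pi / 5)) * (2 * cos (pi / 5)) = 2 * cos (pi / 5) + (1::real)"
proof -
  define c where "c = cos (pi / 5)"
  have c0: "0 < c" unfolding c_def by (intro cos_gt_zero) (auto simp: field_simps)
  have "cos (3 * (pi / 5)) = cos (pi - 2 * (pi / 5))" by (rule arg_cong[of _ _ cos]) (simp add: field_simps)
  also have "\<dots> = - cos (2 * (pi / 5))" by (rule cos_pi_minus)
  finally have "4 * c ^ 3 - 3 * c = - (2 * c ^ 2 - 1)"
    unfolding cos_treble_cos cos_double_cos c_def .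
  then have "(c + 1) * (4 * c ^ 2 - 2 * c - 1) = 0"
    by (simp add: algebra_simps power2_eq_square power3_eq_cube)
  then have "4 * c ^ 2 - 2 * c - 1 = 0" using c0 by simp
  then show ?thesis unfolding c_def[symmetric] by (simp add: power2_eq_square)
qed

text \<open>The effect of the Coxeter element \<open>abc\<close> of a path on the values of a function at \<open>a\<close>, \<open>b\<close>
  and \<open>c\<close>; the parameters are the off-diagonal entries of the Cartan matrix up to sign.\<close>

definition path_coxeter :: "real \<Rightarrow> real \<Rightarrow> real \<times> real \<times> real \<Rightarrow> real \<times> real \<times> real" where
  "path_coxeter k l = (\<lambda>(x, y, z).
     (k * (y + k * x) - x, l * (z + l * (y + k * x)) - (y + k * x), - (z + l * (y + k * x))))"

text \<open>The exponents, 3 here, 5 for \<open>H_3\<close> and 3 for \<open>D_4\<close>, are half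
  the Coxeter numbers 6, 10 and 6: in these types this power of a Coxeter element is the longest
  element and acts as -1.\<close>

lemma path_coxeter_B3:
  assumes l: "l * l = 2" shows "(path_coxeter 1 l ^^ 3) (x, y, z) = (- x, - y, - z)"
proof -
  have l': "l * (l * t) = 2 * t" for t using l by (simp flip: mult.assoc)
  have "path_coxeter 1 l (x, y, z) = (y, x + y + l * z, - z - l * (x + y))" for x y z
    by (simp add: path_coxeter_def algebra_simps l l')
  then show ?thesis by (simp add: eval_nat_numeral algebra_simps l l')
qed

lemma path_coxeter_H3:
  assumes l: "l * l = l + 1" shows "(path_coxeter 1 l ^^ 5) (x, y, z) = (- x, - y, - z)"
proof -
  have l': "l * (l * t) = l * t + t" for t using l by (simp add: algebra_simps flip: mult.assoc)
  have "path_coxeter 1 l (x, y, z) = (y, l * (x + y + z), - z - l * (x + y))" for x y z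
    by (simp add: path_coxeter_def algebra_simps l l')
  then show ?thesis by (simp add: eval_nat_numeral algebra_simps l l')
qed

text \<open>The analogue of \<open>path_coxeter\<close> for the element \<open>abcd\<close> of the
  star with centre \<open>d\<close> and simple edges.\<close>

definition star_coxeter :: "real \<times> real \<times> real \<times> real \<Rightarrow> real \<times> real \<times> real \<times> real" where
  "star_coxeter = (\<lambda>(x, y, z, w). (y + z + w, x + z + w, x + y + w, - (x + y + z + w)))"

lemma star_coxeter_D4: "(star_coxeter ^^ 3) (x, y, z, w) = (- x, - y, - z, - w)"
  by (simp add: star_coxeter_def eval_nat_numeral)

context coxeter_system
begin

section \<open>Cosine values and the longest elements of the listed types\<close>

lemma bil_2: "cox_m W s t = 2 \<Longrightarrow> bil s t = 0"
  and bil_3: "cox_m W s t = 3 \<Longrightarrow> bil s t = - (1 / 2)"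
  and bil_4: "cox_m W s t = 4 \<Longrightarrow> bil s t = - (sqrt 2 / 2)"
  by (simp_all add: bil_def cos_60 cos_45)

lemma bil_le:
  assumes "0 < n" "cox_m W s t = 0 \<or> n \<le> cox_m W s t"
  shows "bil s t \<le> - cos (pi / real n)"
proof -
  have "cos (pi / real n) \<le> cos (pi / real (cox_m W s t))"
    using assms by (cases "cox_m W s t = 0") (auto intro!: cos_monotone_0_pi_le simp: field_simps)
  then show ?thesis by (simp add: bil_def)
qed

lemma bil_le_3: "cox_m W s t \<noteq> 1 \<Longrightarrow> cox_m W s t \<noteq> 2 \<Longrightarrow> bil s t \<le> - (1 / 2)"
  using bil_le[of 3 s t] by (simp add: cos_60) linarith

lemma bil_le_4: "4 \<le> cox_m W s t \<Longrightarrow> bil s t \<le> - (sqrt 2 / 2)"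
  using bil_le[of 4 s t] by (simp add: cos_45)

lemma bil_le_6: "6 \<le> cox_m W s t \<Longrightarrow> bil s t \<le> - (sqrt 3 / 2)"
  using bil_le[of 6 s t] by (simp add: cos_30)

lemma reflect_other: "t \<in> S \<Longrightarrow> reflect s f t = f t - 2 * bil s t * f s"
  by (simp add: reflect_def)

lemma wact_path:
  assumes abc: "a \<in> S" "b \<in> S" "c \<in> S" and "2 * bil a b = - k" "2 * bil b c = - l" "bil a c = 0"
  defines "v \<equiv> \<lambda>f. (f a, f b, f c)"
  shows "v (wact f (concat (replicate n [a, b, c]))) = (path_coxeter k l ^^ n) (v f)"
proof (induction n)
  case (Suc n)
  have "bil b a = bil a b" "bil c b = bil b c" "bil c a = bil a c" using abc bil_sym by auto
  then have "v (wact f [a, b, c]) = path_coxeter k l (v f)" for f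
    using assms by (simp add: v_def path_coxeter_def reflect_other algebra_simps)
  moreover have "concat (replicate (Suc n) [a, b, c]) = concat (replicate n [a, b, c]) @ [a, b, c]"
    by (induction n) auto
  ultimately show ?case using Suc by (simp add: wact_append del: replicate.simps)
qed simp

lemma wact_star:
  assumes abc: "a \<in> S" "b \<in> S" "c \<in> S" "d \<in> S" and "2 * bil d a = - 1" "2 * bil d b = - 1" "2 * bil d c = - 1"
    and "bil a b = 0" "bil a c = 0" "bil b c = 0"
  defines "v \<equiv> \<lambda>f. (f a, f b, f c, f d)"
  shows "v (wact f (concat (replicate n [a, b, c, d]))) = (star_coxeter ^^ n) (v f)"
proof (induction n)
  case (Suc n)
  have "bil b a = bil a b" "bil c b = bil b c" "bil c a = bil a c"
    "bil a d = bil d a" "bil b d = bil d b" "bil c d = bil d c" using abc bil_sym by auto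
  then have "v (wact f [a, b, c, d]) = star_coxeter (v f)" for f
    using assms by (simp add: v_def star_coxeter_def reflect_other algebra_simps)
  moreover have "concat (replicate (Suc n) [a, b, c, d]) = concat (replicate n [a, b, c, d]) @ [a, b, c, d]"
    by (induction n) auto
  ultimately show ?case using Suc by (simp add: wact_append del: replicate.simps)
qed simp

text \<open>One computation of values serves twice: the signs show that all of \<open>J\<close>
  descends, and \<sigma> gives the action by conjugation.\<close>

lemma longest_of_act:
  assumes J: "J \<subseteq> S" and u: "u \<in> lists J" and \<sigma>: "\<And>j. j \<in> J \<Longrightarrow> \<sigma> j \<in> J"
    and act: "\<And>f j. j \<in> J \<Longrightarrow> wact f u j = - f (\<sigma> j)"
  shows "longest J (wp u)" "\<And>j. j \<in> J \<Longrightarrow> wp u \<otimes> j = \<sigma> j \<otimes> wp u"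
proof -
  have uS: "u \<in> lists S" using u J by auto
  show "longest J (wp u)"
    using J u act generate_words[OF J] by (intro longestI_act) (auto simp: act_wp uS)
  fix j assume "j \<in> J"
  then show "wp u \<otimes> j = \<sigma> j \<otimes> wp u"
    using J \<sigma> act uS by (intro conj_of_act) (auto simp: act_wp)
qed

lemma longest_A3:
  assumes abc: "a \<in> S" "b \<in> S" "c \<in> S" "distinct [a, b, c]"
    and m: "cox_m W a b = 3" "cox_m W b c = 3" "cox_m W a c = 2"
  shows "\<exists>p. longest {a, b, c} p \<and> p \<otimes> a = c \<otimes> p \<and> p \<otimes> b = b \<otimes> p \<and> p \<otimes> c = a \<otimes> p"
proof -
  have b: "bil a b = - (1 / 2)" "bil b c = - (1 / 2)" "bil a c = 0"
    "bil b a = - (1 / 2)" "bil c b = - (1 / 2)" "bil c a = 0"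
    using m abc cox_m_sym by (auto intro!: bil_2 bil_3)
  \<comment> \<open>A reduced word for the longest permutation of four points. It acts as minus the
    flip of the path, recorded by \<open>?\<sigma>\<close>.\<close>
  let ?u = "[a, b, c, a, b, a]" and ?\<sigma> = "\<lambda>j. if j = a then c else if j = b then b else a"
  have act: "wact f ?u j = - f (?\<sigma> j)" if "j \<in> {a, b, c}" for f j
    using that abc b by (auto simp: reflect_other)
  have J: "{a, b, c} \<subseteq> S" "?u \<in> lists {a, b, c}" using abc by auto
  have "longest {a, b, c} (wp ?u)"
    by (rule longest_of_act(1)[OF J _ act]) auto
  moreover have "wp ?u \<otimes> j = ?\<sigma> j \<otimes> wp ?u" if "j \<in> {a, b, c}" for j
    by (rule longest_of_act(2)[OF J _ act that]) auto
  from this[of a] this[of b] this[of c]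
  have "wp ?u \<otimes> a = c \<otimes> wp ?u" "wp ?u \<otimes> b = b \<otimes> wp ?u" "wp ?u \<otimes> c = a \<otimes> wp ?u"
    using abc(4) not_sym[of a b] not_sym[of a c] not_sym[of b c] by (simp_all del: word_prod_Cons)
  ultimately show ?thesis by blast
qed

lemma concat_replicate_in_lists: "u \<in> lists A \<Longrightarrow> concat (replicate n u) \<in> lists A"
  by (induction n) auto

lemma longest_path:
  assumes abc: "a \<in> S" "b \<in> S" "c \<in> S"
    and m: "cox_m W a b = 3" "cox_m W b c = 4 \<or> cox_m W b c = 5" "cox_m W a c = 2"
  shows "\<exists>p. longest {a, b, c} p \<and> (\<forall>j\<in>{a, b, c}. p \<otimes> j = j \<otimes> p)"
proof -
  obtain n where n: "\<And>f. (wact f (concat (replicate n [a, b, c])) a, wact f (concat (replicate n [a, b, c])) b,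
      wact f (concat (replicate n [a, b, c])) c) = (- f a, - f b, - f c)"
    using m(2)
  proof
    assume "cox_m W b c = 4"
    then show thesis
      using wact_path[OF abc, of 1 "sqrt 2" _ 3] path_coxeter_B3[of "sqrt 2"] m bil_2 bil_3 bil_4
      by (intro that[of 3]) simp
  next
    assume "cox_m W b c = 5"
    then have "2 * bil b c = - (2 * cos (pi / 5))" by (simp add: bil_def)
    then show thesis
      using wact_path[OF abc, of 1 "2 * cos (pi / 5)" _ 5] path_coxeter_H3[OF golden_ratio] m bil_2 bil_3
      by (intro that[of 5]) simp
  qed
  let ?u = "concat (replicate n [a, b, c])"
  have J: "{a, b, c} \<subseteq> S" "?u \<in> lists {a, b, c}" using abc by (auto intro!: concat_replicate_in_lists)
  have "wact f ?u j = - f j" if "j \<in> {a, b, c}" for f j using n[of f] that by auto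
  then show ?thesis using longest_of_act[OF J, of "\<lambda>j. j"] by blast
qed

lemma longest_D4:
  assumes abc: "a \<in> S" "b \<in> S" "c \<in> S" "d \<in> S"
    and m: "cox_m W d a = 3" "cox_m W d b = 3" "cox_m W d c = 3"
      "cox_m W a b = 2" "cox_m W a c = 2" "cox_m W b c = 2"
  shows "\<exists>p. longest {a, b, c, d} p \<and> (\<forall>j\<in>{a, b, c, d}. p \<otimes> j = j \<otimes> p)"
proof -
  let ?u = "concat (replicate 3 [a, b, c, d])"
  have n: "(wact f ?u a, wact f ?u b, wact f ?u c, wact f ?u d) = (- f a, - f b, - f c, - f d)" for f
    using wact_star[OF abc, of f 3] star_coxeter_D4 m bil_2 bil_3 by simp
  have J: "{a, b, c, d} \<subseteq> S" "?u \<in> lists {a, b, c, d}" using abc by (auto intro!: concat_replicate_in_lists)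
  have "wact f ?u j = - f j" if "j \<in> {a, b, c, d}" for f j using n[of f] that by auto
  then show ?thesis using longest_of_act[OF J, of "\<lambda>j. j"] by blast
qed

lemma longest_I2:
  assumes st: "s \<in> S" "t \<in> S" "s \<noteq> t" and m: "0 < cox_m W s t"
  shows "longest {s, t} (altp s t (cox_m W s t))"
proof -
  obtain n where n: "cox_m W s t = Suc n" using m by (cases "cox_m W s t") auto
  have *: "desc (altp a b (Suc n)) (if even n then a else b)"
    if "a \<in> S" "b \<in> S" "a \<noteq> b" "cox_m W a b = Suc n" for a b
    using that altp_Suc_right[of a b n] altp_len[of a b n] altp_len[of a b "Suc n"]
    by (auto simp: desc_def simp del: alternating.simps)
  have "altp t s (Suc n) = altp s t (Suc n)" using altp_braid[OF st(1,2)] n by simp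
  then have "desc (altp s t (Suc n)) (if even n then s else t)" "desc (altp s t (Suc n)) (if even n then t else s)"
    using *[of s t] *[of t s] st n cox_m_sym[of s t] by (auto simp del: alternating.simps)
  then show ?thesis unfolding longest_def n
    using altp_generate[of s t "Suc n"] by (auto split: if_splits simp del: alternating.simps)
qed

text \<open>Any other centre with at least two leaves contains an affine diagram, possibly with
  larger labels. The weights below are the null vectors of these affine diagrams for simple roots of
  length one; larger labels only decrease the sums.\<close>

lemma star_classification:
  assumes w: "w \<in> carrier W" and cB: "c \<in> S" "B \<subseteq> S" "c \<notin> B"
    and d: "desc w c" "\<And>b. b \<in> B \<Longrightarrow> desc w b"
    and m: "\<And>b. b \<in> B \<Longrightarrow> 3 \<le> cox_m W c b"
    and two: "b1 \<in> B" "b2 \<in> B" "b1 \<noteq> b2"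
  shows "(\<exists>b1 b2. B = {b1, b2} \<and> b1 \<noteq> b2 \<and> cox_m W b1 b2 = 2 \<and> cox_m W c b1 = 3 \<and> cox_m W c b2 \<in> {3, 4, 5}) \<or>
    (\<exists>b1 b2 b3. B = {b1, b2, b3} \<and> distinct [b1, b2, b3] \<and>
      cox_m W c b1 = 3 \<and> cox_m W c b2 = 3 \<and> cox_m W c b3 = 3 \<and>
      cox_m W b1 b2 = 2 \<and> cox_m W b1 b3 = 2 \<and> cox_m W b2 b3 = 2)"
proof -
  have BS: "b \<in> S" "b \<noteq> c" "c \<noteq> b" if "b \<in> B" for b using that cB by auto
  have c3: "bil c b \<le> - (1 / 2)" "bil b c \<le> - (1 / 2)" if "b \<in> B" for b
    using m[OF that] bil_le_3[of c b] bil_sym[of b c] BS[OF that] cB by auto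
  have neg: "bil b b' \<le> 0" if "b \<in> B" "b' \<in> B" "b \<noteq> b'" for b b' using that BS bil_nonpos by blast
  note no = no_descents_if_nonpositive[OF _ _ _ _ _ w]
  \<comment> \<open>Affine \<open>A_2\<close>, a triangle with all weights 1. An infinite label,
    encoded by 0, is covered by \<open>bil_le_3\<close>.\<close>
  have leaves: "cox_m W b b' = 2" if b: "b \<in> B" "b' \<in> B" "b \<noteq> b'" for b b'
  proof (rule ccontr)
    assume "cox_m W b b' \<noteq> 2"
    then have "bil b b' \<le> - (1 / 2)" "bil b' b \<le> - (1 / 2)"
      using b BS bil_le_3[of b b'] cox_m_neq_1 bil_sym by auto
    then show False
      using b BS[of b] BS[of b'] c3[of b] c3[of b'] cB d
      by (intro no[of "{c, b, b'}" "\<lambda>_. 1"]) auto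
  qed
  \<comment> \<open>Affine \<open>D_4\<close>: weight 2 at the centre, 1 at the four leaves.\<close>
  have four: False if b: "b1 \<in> B" "b2 \<in> B" "b3 \<in> B" "b4 \<in> B" "distinct [b1, b2, b3, b4]" for b1 b2 b3 b4
    using b(5) BS[OF b(1)] BS[OF b(2)] BS[OF b(3)] BS[OF b(4)] c3[OF b(1)] c3[OF b(2)] c3[OF b(3)] c3[OF b(4)]
      cB(1) d b(1-4) leaves[THEN bil_2]
    by (intro no[of "{c, b1, b2, b3, b4}" "\<lambda>j. if j = c then 2 else 1"]) auto
  \<comment> \<open>Affine \<open>B_3\<close>: weight 2 at the centre, \<open>sqrt 2\<close> at the
    leaf with label 4.\<close>
  have three: "cox_m W c b1 = 3" if b: "b1 \<in> B" "b2 \<in> B" "b3 \<in> B" "distinct [b1, b2, b3]" for b1 b2 b3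
  proof (rule ccontr)
    assume "cox_m W c b1 \<noteq> 3"
    then have 4: "bil c b1 \<le> - (sqrt 2 / 2)" "bil b1 c \<le> - (sqrt 2 / 2)"
      using m[OF b(1)] bil_le_4[of c b1] bil_sym[of c b1] BS[OF b(1)] cB by auto
    then have "sqrt 2 * bil c b1 \<le> sqrt 2 * - (sqrt 2 / 2)" by (intro mult_left_mono) auto
    then have 5: "sqrt 2 * bil c b1 \<le> - 1" by simp
    show False
      using b(4) BS[OF b(1)] BS[OF b(2)] BS[OF b(3)] c3[OF b(2)] c3[OF b(3)] 4 5
        cB(1) d b(1-3) leaves[THEN bil_2]
      by (intro no[of "{c, b1, b2, b3}" "\<lambda>j. if j = c then 2 else if j = b1 then sqrt 2 else 1"]) auto
  qed
  \<comment> \<open>Affine \<open>C_2\<close>: weight \<open>sqrt 2\<close> at the centre, between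
    two labels 4.\<close>
  have one_simple: "cox_m W c b1 = 3 \<or> cox_m W c b2 = 3" if b: "b1 \<in> B" "b2 \<in> B" "b1 \<noteq> b2" for b1 b2
  proof (rule ccontr)
    assume "\<not> ?thesis"
    then have 4: "bil c b \<le> - (sqrt 2 / 2)" "bil b c \<le> - (sqrt 2 / 2)" if "b = b1 \<or> b = b2" for b
      using that b m[OF b(1)] m[OF b(2)] bil_le_4[of c b] bil_sym[of c b] BS cB by auto
    have 5: "sqrt 2 * bil b c \<le> - 1" if "b = b1 \<or> b = b2" for b
    proof -
      have "sqrt 2 * bil b c \<le> sqrt 2 * - (sqrt 2 / 2)" using 4[OF that] by (intro mult_left_mono) auto
      then show ?thesis by simp
    qed
    show False
      using b(3) BS[OF b(1)] BS[OF b(2)] 4[of b1] 4[of b2] 5[of b1] 5[of b2]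
        cB(1) d b(1-2) leaves[THEN bil_2]
      by (intro no[of "{c, b1, b2}" "\<lambda>j. if j = c then sqrt 2 else 1"]) auto
  qed
  \<comment> \<open>Affine \<open>G_2\<close>: weights 1, 2, \<open>sqrt 3\<close> along the path
    with labels 3 and 6.\<close>
  have less_six: "cox_m W c b2 < 6" if b: "b1 \<in> B" "b2 \<in> B" "b1 \<noteq> b2" for b1 b2
  proof (rule ccontr)
    assume "\<not> ?thesis"
    then have 4: "bil c b2 \<le> - (sqrt 3 / 2)" "bil b2 c \<le> - (sqrt 3 / 2)"
      using bil_le_6[of c b2] bil_sym[of c b2] BS[OF b(2)] cB by auto
    then have "sqrt 3 * bil c b2 \<le> sqrt 3 * - (sqrt 3 / 2)" by (intro mult_left_mono) auto
    then have 5: "sqrt 3 * bil c b2 \<le> - (3 / 2)" by simp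
    show False
      using b(3) BS[OF b(1)] BS[OF b(2)] c3[OF b(1)] 4 5
        cB(1) d b(1-2) leaves[THEN bil_2]
      by (intro no[of "{c, b1, b2}" "\<lambda>j. if j = c then 2 else if j = b2 then sqrt 3 else 1"]) auto
  qed
  show ?thesis
  proof (cases "B = {b1, b2}")
    case True
    obtain x y where xy: "B = {x, y}" "x \<noteq> y" "cox_m W c x = 3"
      using one_simple[OF two] True two by (metis insert_commute)
    then have "3 \<le> cox_m W c y" "cox_m W c y < 6" "cox_m W x y = 2"
      using m[of y] less_six[of x y] leaves[of x y] by auto
    moreover from this have "cox_m W c y \<in> {3, 4, 5}" by auto
    ultimately show ?thesis using xy by blast
  next
    case False
    then obtain b3 where b3: "b3 \<in> B" "b3 \<noteq> b1" "b3 \<noteq> b2" using two by blast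
    have "B = {b1, b2, b3}"
    proof (rule ccontr)
      assume "B \<noteq> {b1, b2, b3}"
      then obtain b4 where "b4 \<in> B" "b4 \<noteq> b1" "b4 \<noteq> b2" "b4 \<noteq> b3" using two b3 by blast
      then show False using four[of b1 b2 b3 b4] two b3 by auto
    qed
    moreover have "distinct [b1, b2, b3]" using two b3 by auto
    ultimately show ?thesis
      using three[of b1 b2 b3] three[of b2 b1 b3] three[of b3 b1 b2] leaves two b3
      by (intro disjI2 exI[of _ b1] exI[of _ b2] exI[of _ b3]) auto
  qed
qed

text \<open>Affine \<open>A_3\<close>, a cycle with all weights 1; diagonals only decrease the sums.
  This reduces one side of a complete bipartite diagram to a single vertex.\<close>

lemma no_four_cycle:
  assumes w: "w \<in> carrier W" and S: "a \<in> S" "a' \<in> S" "b \<in> S" "b' \<in> S" "distinct [a, a', b, b']"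
    and d: "desc w a" "desc w a'" "desc w b" "desc w b'"
    and m: "3 \<le> cox_m W a b" "3 \<le> cox_m W a b'" "3 \<le> cox_m W a' b" "3 \<le> cox_m W a' b'"
  shows False
proof -
  have 1: "bil a b \<le> - (1 / 2)" "bil a b' \<le> - (1 / 2)" "bil a' b \<le> - (1 / 2)" "bil a' b' \<le> - (1 / 2)"
    using m by (auto intro!: bil_le_3)
  have 2: "bil a a' \<le> 0" "bil b b' \<le> 0" using S by (auto intro!: bil_nonpos)
  have 3: "bil b a = bil a b" "bil b' a = bil a b'" "bil b a' = bil a' b" "bil b' a' = bil a' b'"
    "bil a' a = bil a a'" "bil b' b = bil b b'" using S bil_sym by auto
  show False
    using S d 1 2 by (intro no_descents_if_nonpositive[of "{a, a', b, b'}" "\<lambda>_. 1", OF _ _ _ _ _ w]) (auto simp: 3)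
qed

end

context twisted_coxeter
begin

section \<open>Matching the bad splittings with the list\<close>

lemma trivial_on_iff:
  assumes "J \<subseteq> S" shows "trivial_on W \<theta> J \<longleftrightarrow> (\<forall>r\<in>J. \<theta> r = r)"
proof
  show "trivial_on W \<theta> J \<Longrightarrow> \<forall>r\<in>J. \<theta> r = r" by (auto simp: trivial_on_def generate_J)
  assume fixed: "\<forall>r\<in>J. \<theta> r = r"
  have "wp u \<in> carrier W \<and> \<theta> (wp u) = wp u" if "u \<in> lists J" for u
    using that by induction (use assms fixed in auto)
  then show "trivial_on W \<theta> J" using generate_words[OF assms] by (auto simp: trivial_on_def)
qed

lemma twisted_conj_sym:
  assumes w: "w \<in> I" and r: "r \<in> S" "r' \<in> S" and e: "w \<otimes> r = \<theta> r' \<otimes> w"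
  shows "w \<otimes> r' = \<theta> r \<otimes> w"
proof -
  have "\<theta> (w \<otimes> r) = \<theta> (\<theta> r' \<otimes> w)" using e by simp
  then have "inv w \<otimes> \<theta> r = r' \<otimes> inv w" using w r by (simp add: I_\<theta>)
  then have "w \<otimes> (inv w \<otimes> \<theta> r) \<otimes> w = w \<otimes> (r' \<otimes> inv w) \<otimes> w" by simp
  moreover have "w \<otimes> (inv w \<otimes> \<theta> r) \<otimes> w = \<theta> r \<otimes> w" using w r by (simp flip: m_assoc)
  moreover have "w \<otimes> (r' \<otimes> inv w) \<otimes> w = w \<otimes> r'" using w r by (simp add: m_assoc)
  ultimately show ?thesis by simp
qed

lemma twisted_conj_unique:
  "w \<in> carrier W \<Longrightarrow> a \<in> S \<Longrightarrow> b \<in> S \<Longrightarrow> \<theta> a \<otimes> w = \<theta> b \<otimes> w \<Longrightarrow> a = b"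
  using \<theta>_inj[of a b] by simp

text \<open>\<open>w\<close> conjugates \<open>D\<close> to \<theta>-images by hypothesis and into
  \<open>D\<close> as its longest element. Both describe the same conjugates, so \<theta> maps
  \<open>D\<close> into itself.\<close>

lemma stable_if_permuted:
  assumes w: "w \<in> I" and D: "D \<subseteq> S" "longest D w"
    and perm: "\<And>r. r \<in> D \<Longrightarrow> \<exists>r'\<in>D. w \<otimes> r = \<theta> r' \<otimes> w"
  shows "\<theta> ` D = D"
proof -
  have sub: "\<theta> r \<in> D" if r: "r \<in> D" for r
  proof -
    obtain r' where r': "r' \<in> D" "w \<otimes> r = \<theta> r' \<otimes> w" using perm r by blast
    have S: "r \<in> S" "r' \<in> S" using r r' D by auto
    have e: "w \<otimes> r' = \<theta> r \<otimes> w" using twisted_conj_sym[OF w S r'(2)] .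
    obtain r'' where r'': "r'' \<in> D" "w \<otimes> r' = r'' \<otimes> w" using longest_conj[OF D r'(1)] by blast
    have "r'' \<in> S" using r'' D by auto
    then have "\<theta> r = r''" using e r'' w S by simp
    then show ?thesis using r'' by simp
  qed
  moreover have "r \<in> \<theta> ` D" if r: "r \<in> D" for r
    using sub[OF r] r D by (intro image_eqI[of _ _ "\<theta> r"]) auto
  ultimately show ?thesis by blast
qed

text \<open>The condition on \<theta> comes from comparing \<open>conj\<close> with the known action
  of the longest element: it flips \<open>A_3\<close>, so \<theta> must flip too, and it commutes
  with every letter in \<open>D_4\<close>, so \<theta> is trivial. With a single leaf, one of the
  two dihedral cases applies whatever \<theta> is.\<close>

lemma star_special:
  assumes w: "w \<in> I" and S: "c \<in> S" "B \<subseteq> S" "c \<notin> B" "B \<noteq> {}"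
    and long: "longest (insert c B) w" and stable: "\<theta> ` insert c B = insert c B"
    and conj: "\<And>r. r \<in> insert c B \<Longrightarrow> w \<otimes> r = \<theta> r \<otimes> w"
    and m: "\<And>b. b \<in> B \<Longrightarrow> 3 \<le> cox_m W c b"
  shows "insert c B \<in> special_subsets W S \<theta>"
proof -
  have J: "insert c B \<subseteq> S" using S by simp
  have d: "desc w r" if "r \<in> insert c B" for r using long that unfolding longest_def by blast
  obtain b where b: "b \<in> B" using S by blast
  show ?thesis
  proof (cases "B = {b}")
    case True
    have "type_I2 W (cox_m W c b) (insert c B)" unfolding type_I2_def using True S b by blast
    then show ?thesis using J stable m[OF b] unfolding special_subsets_def by (auto intro: le_trans[of 2 3])
  next
    case False
    then obtain b' where b': "b' \<in> B" "b \<noteq> b'" using b by blast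
    consider (path) b1 b2 where "B = {b1, b2}" "b1 \<noteq> b2" "cox_m W b1 b2 = 2" "cox_m W c b1 = 3"
        "cox_m W c b2 \<in> {3, 4, 5}"
      | (star) b1 b2 b3 where "B = {b1, b2, b3}" "distinct [b1, b2, b3]"
        "cox_m W c b1 = 3" "cox_m W c b2 = 3" "cox_m W c b3 = 3"
        "cox_m W b1 b2 = 2" "cox_m W b1 b3 = 2" "cox_m W b2 b3 = 2"
      using star_classification[OF I_closed[OF w] S(1-3) _ _ m b b'] d by blast
    then show ?thesis
    proof cases
      case path
      have bS: "b1 \<in> S" "b2 \<in> S" "c \<noteq> b1" "c \<noteq> b2" using path(1) S by auto
      have e: "insert c B = {b1, c, b2}" using path(1) by auto
      have p: "path_type3 W 3 (cox_m W c b2) (insert c B)" unfolding path_type3_def e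
        by (rule exI[of _ b1], rule exI[of _ c], rule exI[of _ b2]) (use path bS S cox_m_sym in auto)
      show ?thesis
      proof (cases "cox_m W c b2 = 3")
        case True
        obtain q where q: "longest {b1, c, b2} q" "q \<otimes> b1 = b2 \<otimes> q"
          using longest_A3[of b1 c b2] path bS S True cox_m_sym[of b1 c] by auto
        have "q = w" using longest_unique[OF J] q long by (simp add: e)
        then have "\<theta> b1 \<otimes> w = b2 \<otimes> w" using q conj[of b1] path(1) by simp
        then have "\<theta> b1 = b2" using w bS by simp
        then have "\<not> trivial_on W \<theta> (insert c B)" using trivial_on_iff[OF J] path(1,2) by auto
        then show ?thesis using p True J stable by (simp add: special_subsets_def type_A3_def)
      next
        case False
        then show ?thesis using p path(5) J stable
          by (auto simp: special_subsets_def type_B3_def type_H3_def)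
      qed
    next
      case star
      have bS: "b1 \<in> S" "b2 \<in> S" "b3 \<in> S" "c \<noteq> b1" "c \<noteq> b2" "c \<noteq> b3" using star(1) S by auto
      have e: "insert c B = {b1, b2, b3, c}" using star(1) by auto
      have "type_D4 W (insert c B)" unfolding type_D4_def e
        by (rule exI[of _ b1], rule exI[of _ b2], rule exI[of _ b3], rule exI[of _ c]) (use star bS S in auto)
      moreover obtain q where q: "longest {b1, b2, b3, c} q" "\<forall>j\<in>{b1, b2, b3, c}. q \<otimes> j = j \<otimes> q"
        using longest_D4[OF bS(1-3) S(1) star(3-8)] by blast
      have "q = w" using longest_unique[OF J] q long by (simp add: e)
      then have "\<theta> j = j" if "j \<in> insert c B" for j
      proof -
        have "\<theta> j \<otimes> w = j \<otimes> w" using q(2) conj[OF that] that \<open>q = w\<close> unfolding e by metis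
        then show ?thesis using w J that by (auto simp: subset_iff)
      qed
      then have "trivial_on W \<theta> (insert c B)" using trivial_on_iff[OF J] by blast
      ultimately show ?thesis using J stable by (simp add: special_subsets_def)
    qed
  qed
qed

lemma split_special:
  assumes w: "w \<in> I" and D: "{s \<in> S. desc w s} = A \<union> B" and AB: "A \<inter> B = {}" "A \<noteq> {}" "B \<noteq> {}"
    and bad: "\<And>a b. a \<in> A \<Longrightarrow> b \<in> B \<Longrightarrow> bad w a b"
  shows "A \<union> B \<in> special_subsets W S \<theta>" "longest_element W (A \<union> B) = w"
proof -
  have DS: "A \<union> B \<subseteq> S" and d: "\<And>r. r \<in> A \<union> B \<Longrightarrow> desc w r" using D by blast+
  have pair: "w \<otimes> a = \<theta> a \<otimes> w \<and> w \<otimes> b = \<theta> b \<otimes> w \<or> w \<otimes> a = \<theta> b \<otimes> w \<and> w \<otimes> b = \<theta> a \<otimes> w"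
    if "a \<in> A" "b \<in> B" for a b
    using bad[OF that] by (auto simp: bad_def doubleton_eq_iff)
  have perm: "\<exists>r'\<in>A \<union> B. w \<otimes> r = \<theta> r' \<otimes> w" if r: "r \<in> A \<union> B" for r
    using r pair AB(2,3) by blast
  have long: "longest (A \<union> B) w"
  proof (rule longest_if_descents_permuted[OF I_closed[OF w] D[symmetric]])
    fix r assume "r \<in> A \<union> B"
    then obtain r' where r': "r' \<in> A \<union> B" "w \<otimes> r = \<theta> r' \<otimes> w" using perm by blast
    then have "r' \<in> S" using DS by blast
    then show "\<exists>i\<in>S. w \<otimes> r = i \<otimes> w" using r'(2) by (intro bexI[of _ "\<theta> r'"]) simp_all
  qed
  then show "longest_element W (A \<union> B) = w" by (rule longest_element_eq[OF DS])
  have stable: "\<theta> ` (A \<union> B) = A \<union> B" by (rule stable_if_permuted[OF w DS long perm])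
  have uniq: "a = b" if "a \<in> A \<union> B" "b \<in> A \<union> B" "\<theta> a \<otimes> w = \<theta> b \<otimes> w" for a b
    using twisted_conj_unique[OF I_closed[OF w]] that DS by blast
  show "A \<union> B \<in> special_subsets W S \<theta>"
  proof (cases "\<exists>a\<in>A. \<exists>b\<in>B. w \<otimes> a = \<theta> b \<otimes> w")
    case True
    then obtain a b where ab: "a \<in> A" "b \<in> B" "w \<otimes> a = \<theta> b \<otimes> w" by blast
    have S: "a \<in> S" "b \<in> S" "a \<noteq> b" using ab AB DS by auto
    have ba: "w \<otimes> b = \<theta> a \<otimes> w" using twisted_conj_sym[OF w S(1,2) ab(3)] .
    \<comment> \<open>\<open>w\<close> conjugates \<open>a\<close> to \<theta>(\<open>b\<close>),
      while a bad pair of \<open>a\<close> and \<open>b'\<close> requires \<theta>(\<open>a\<close>)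
      or \<theta>(\<open>b'\<close>); so an exchanged pair leaves no room for a third
      descent.\<close>
    have "b' = b" if "b' \<in> B" for b'
      using pair[OF ab(1) that] ab uniq[of b a] uniq[of b b'] that S by auto
    moreover have "a' = a" if "a' \<in> A" for a'
      using pair[OF that ab(2)] ab ba uniq[of a b] uniq[of a a'] that S by auto
    ultimately have e: "A \<union> B = {a, b}" using ab by blast
    have "desc w a" "desc w b" using d ab by auto
    then have m0: "0 < cox_m W a b" using two_descents[OF w S] by blast
    then have m2: "2 \<le> cox_m W a b" using cox_m_neq_1[OF S] by simp
    have I2: "type_I2 W (cox_m W a b) (A \<union> B)" unfolding type_I2_def using e S by blast
    show ?thesis
    proof (cases "cox_m W a b = 2")
      case False
      then have "3 \<le> cox_m W a b" using m2 by simp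
      then show ?thesis using I2 m2 DS stable by (auto simp: special_subsets_def)
    next
      \<comment> \<open>For commuting letters the longest element commutes with both, so the
        exchange is due to \<theta>.\<close>
      case m: True
      interpret dm: dihedral_minimal W S \<theta> \<one> a b
        using S not_desc_one by (intro dihedral_minimalI) auto
      have "longest {a, b} (altp a b 2)" using longest_I2[OF S m0] m by simp
      then have "altp a b 2 = w" using longest_unique[OF DS] long unfolding e by blast
      then have "w \<otimes> a = a \<otimes> w" using dm.longest_conj_st m by (simp add: dm.m_def)
      then have "\<theta> b = a" using ab w S by simp
      then have "\<not> trivial_on W \<theta> (A \<union> B)" using trivial_on_iff[OF DS] S e by auto
      then show ?thesis using I2 m2 DS stable by (auto simp: special_subsets_def)
    qed
  next
    case False
    then have "w \<otimes> a = \<theta> a \<otimes> w" "w \<otimes> b = \<theta> b \<otimes> w" if "a \<in> A" "b \<in> B" for a b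
      using pair that by blast+
    then have conj: "w \<otimes> r = \<theta> r \<otimes> w" if "r \<in> A \<union> B" for r using that AB by blast
    have m3: "3 \<le> cox_m W a b" if "a \<in> A" "b \<in> B" for a b
      using bad[OF that] False that by (auto simp: bad_def)
    have m3': "3 \<le> cox_m W b a" if "a \<in> A" "b \<in> B" for a b
    proof -
      have "a \<in> S" "b \<in> S" using that DS by auto
      then show ?thesis using m3[OF that] cox_m_sym[of a b] by simp
    qed
    obtain a b where ab: "a \<in> A" "b \<in> B" using AB by blast
    have "A = {a} \<or> B = {b}"
    proof (rule ccontr)
      assume "\<not> ?thesis"
      then obtain a' b' where ab': "a' \<in> A" "b' \<in> B" "a' \<noteq> a" "b' \<noteq> b" using ab by blast
      show False
      proof (rule no_four_cycle[of w a a' b b'])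
        show "distinct [a, a', b, b']" using ab ab' AB by auto
      qed (use ab ab' DS d m3 w in auto)
    qed
    then show ?thesis
    proof
      assume A: "A = {a}"
      then have e: "A \<union> B = insert a B" by simp
      show ?thesis unfolding e
        by (rule star_special[OF w]) (use A AB DS long stable conj m3 in auto)
    next
      assume B: "B = {b}"
      then have e: "A \<union> B = insert b A" by simp
      show ?thesis unfolding e
        by (rule star_special[OF w]) (use B AB DS long stable conj m3' in \<open>auto simp: e\<close>)
    qed
  qed
qed

text \<open>The middle vertex is the only one that commutes with neither of the others, so \<theta>
  fixes it; exchanging the ends requires equal labels.\<close>

lemma path_automorphism:
  assumes S: "a \<in> S" "b \<in> S" "c \<in> S" "distinct [a, b, c]" and stable: "\<theta> ` {a, b, c} = {a, b, c}"
    and m: "cox_m W a b = p" "cox_m W b c = q" "cox_m W a c = 2" and pq: "p \<noteq> 2" "q \<noteq> 2"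
  shows "\<theta> b = b" and "\<theta> a = a \<and> \<theta> c = c \<or> p = q \<and> \<theta> a = c \<and> \<theta> c = a"
proof -
  have mem: "\<theta> a \<in> {a, b, c}" "\<theta> b \<in> {a, b, c}" "\<theta> c \<in> {a, b, c}" using stable by blast+
  have ne: "\<theta> a \<noteq> \<theta> b" "\<theta> b \<noteq> \<theta> c" "\<theta> a \<noteq> \<theta> c" using S \<theta>_inj by auto
  have ms: "cox_m W b a = p" "cox_m W c b = q" "cox_m W c a = 2" using m S cox_m_sym by auto
  have m\<theta>: "cox_m W (\<theta> a) (\<theta> b) = p" "cox_m W (\<theta> b) (\<theta> c) = q" "cox_m W (\<theta> a) (\<theta> c) = 2"
    using m S \<theta>_cox_m by auto
  have only: "x \<noteq> b" if "x \<in> {a, b, c}" "y \<in> {a, b, c}" "x \<noteq> y" "cox_m W x y = 2 \<or> cox_m W y x = 2" for x y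
  proof
    assume x: "x = b"
    then have "y = a \<or> y = c" using that by blast
    then show False using that(4) m(1,2) ms(1,2) pq unfolding x by (elim disjE) simp_all
  qed
  have "\<theta> a \<noteq> b" "\<theta> c \<noteq> b"
    using only[OF mem(1,3) ne(3)] only[OF mem(3,1) not_sym[OF ne(3)]] m\<theta>(3) by blast+
  then have ac: "\<theta> a = a \<and> \<theta> c = c \<or> \<theta> a = c \<and> \<theta> c = a" using mem(1,3) ne(3) by auto
  then show b: "\<theta> b = b" using mem(2) ne(1,2) by auto
  show "\<theta> a = a \<and> \<theta> c = c \<or> p = q \<and> \<theta> a = c \<and> \<theta> c = a"
    using ac b m\<theta>(1) ms(2) by metis
qed

text \<open>From three letters on, the splitting separates the centre of the diagram from its
  leaves. In types \<open>B_3\<close> and \<open>H_3\<close> the unequal labels force \<theta> to be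
  trivial on \<open>J\<close>, matching the longest element, which commutes with every
  letter.\<close>

lemma special_split:
  assumes J: "J \<in> special_subsets W S \<theta>"
  shows "\<exists>p A B. longest J p \<and> J = A \<union> B \<and> A \<inter> B = {} \<and> A \<noteq> {} \<and> B \<noteq> {} \<and> (\<forall>a\<in>A. \<forall>b\<in>B. bad p a b)"
proof -
  have JS: "J \<subseteq> S" and stable: "\<theta> ` J = J" using J by (auto simp: special_subsets_def)
  have bad: "bad p a b" if "{p \<otimes> a, p \<otimes> b} = {\<theta> a \<otimes> p, \<theta> b \<otimes> p}" "3 \<le> cox_m W a b" for p a b
    using that by (simp add: bad_def)
  consider (A3) "type_A3 W J" "\<not> trivial_on W \<theta> J" | (BH) q where "q = 4 \<or> q = 5" "path_type3 W 3 q J"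
    | (D4) "type_D4 W J" "trivial_on W \<theta> J"
    | (I2) m where "type_I2 W m J" "3 \<le> m \<or> 2 \<le> m \<and> \<not> trivial_on W \<theta> J"
    using J unfolding special_subsets_def type_B3_def type_H3_def by blast
  then show ?thesis
  proof cases
    case A3
    then obtain a b c where abc: "distinct [a, b, c]" "J = {a, b, c}"
      "cox_m W a b = 3" "cox_m W b c = 3" "cox_m W a c = 2" unfolding type_A3_def path_type3_def by blast
    have S: "a \<in> S" "b \<in> S" "c \<in> S" using abc JS by auto
    obtain p where p: "longest {a, b, c} p" "p \<otimes> a = c \<otimes> p" "p \<otimes> b = b \<otimes> p" "p \<otimes> c = a \<otimes> p"
      using longest_A3[OF S abc(1,3-5)] by blast
    have "\<theta> b = b" "\<theta> a = a \<and> \<theta> c = c \<or> \<theta> a = c \<and> \<theta> c = a"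
      using path_automorphism[OF S abc(1) stable[unfolded abc(2)] abc(3-5)] by simp_all
    then have "\<theta> b = b" "\<theta> a = c" "\<theta> c = a" using A3(2) trivial_on_iff[OF JS] abc(2) by auto
    then have "bad p b a" "bad p b c" using p(2-4) abc(3,4) cox_m_sym[OF S(1,2)] by (simp_all add: bad insert_commute)
    then have "\<forall>x\<in>{b}. \<forall>y\<in>{a, c}. bad p x y" by blast
    moreover have "longest J p" "J = {b} \<union> {a, c}" using p(1) unfolding abc(2) by blast+
    moreover have "{b} \<inter> {a, c} = {}" "{b} \<noteq> {}" "{a, c} \<noteq> {}" using abc(1) by auto
    ultimately show ?thesis by blast
  next
    case BH
    then obtain a b c where abc: "distinct [a, b, c]" "J = {a, b, c}"
      "cox_m W a b = 3" "cox_m W b c = q" "cox_m W a c = 2" unfolding path_type3_def by blast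
    have S: "a \<in> S" "b \<in> S" "c \<in> S" using abc JS by auto
    obtain p where p: "longest {a, b, c} p" "\<forall>j\<in>{a, b, c}. p \<otimes> j = j \<otimes> p"
      using longest_path[OF S abc(3) _ abc(5)] abc(4) BH(1) by blast
    have q: "q \<noteq> 2" "3 \<noteq> q" using BH(1) by auto
    have "\<theta> b = b" "\<theta> a = a" "\<theta> c = c"
      using path_automorphism[OF S abc(1) stable[unfolded abc(2)] abc(3-5)] q by simp_all
    moreover have "3 \<le> cox_m W b c" using BH(1) abc(4) by auto
    ultimately have "bad p b a" "bad p b c"
      using p(2) abc(3) cox_m_sym[OF S(1,2)] by (simp_all add: bad insert_commute)
    then have "\<forall>x\<in>{b}. \<forall>y\<in>{a, c}. bad p x y" by blast
    moreover have "longest J p" "J = {b} \<union> {a, c}" using p(1) unfolding abc(2) by blast+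
    moreover have "{b} \<inter> {a, c} = {}" "{b} \<noteq> {}" "{a, c} \<noteq> {}" using abc(1) by auto
    ultimately show ?thesis by blast
  next
    case D4
    then obtain a b c d where abc: "distinct [a, b, c, d]" "J = {a, b, c, d}"
      "cox_m W d a = 3" "cox_m W d b = 3" "cox_m W d c = 3"
      "cox_m W a b = 2" "cox_m W a c = 2" "cox_m W b c = 2" unfolding type_D4_def by blast
    have S: "a \<in> S" "b \<in> S" "c \<in> S" "d \<in> S" using abc JS by auto
    obtain p where p: "longest {a, b, c, d} p" "\<forall>j\<in>{a, b, c, d}. p \<otimes> j = j \<otimes> p"
      using longest_D4[OF S abc(3-8)] by blast
    have "\<theta> j = j" if "j \<in> {a, b, c, d}" for j using D4(2) trivial_on_iff[OF JS] abc(2) that by blast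
    then have "bad p d a" "bad p d b" "bad p d c" using p(2) abc(3-5) by (simp_all add: bad)
    then have "\<forall>x\<in>{d}. \<forall>y\<in>{a, b, c}. bad p x y" by blast
    moreover have "longest J p" "J = {d} \<union> {a, b, c}" using p(1) unfolding abc(2) by blast+
    moreover have "{d} \<inter> {a, b, c} = {}" "{d} \<noteq> {}" "{a, b, c} \<noteq> {}" using abc(1) by auto
    ultimately show ?thesis by blast
  next
    case I2
    then obtain a b where ab: "a \<noteq> b" "J = {a, b}" "cox_m W a b = m" unfolding type_I2_def by blast
    have S: "a \<in> S" "b \<in> S" using ab JS by auto
    interpret dm: dihedral_minimal W S \<theta> \<one> a b
      using S ab not_desc_one by (intro dihedral_minimalI) auto
    have m: "0 < m" "dm.m = m" using I2 ab by (auto simp: dm.m_def)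
    define p where "p = altp a b m"
    have p: "longest J p" using longest_I2[OF S ab(1)] ab m by (simp add: p_def)
    have pab: "p \<otimes> a = (if even m then a else b) \<otimes> p" "p \<otimes> b = (if even m then b else a) \<otimes> p"
      using dm.longest_conj_st dm.longest_conj_ts m by (simp_all add: p_def)
    have th: "\<theta> a = a \<and> \<theta> b = b \<or> \<theta> a = b \<and> \<theta> b = a"
      using stable ab S \<theta>_inj[of a b] by (auto simp: doubleton_eq_iff)
    then have e: "{p \<otimes> a, p \<otimes> b} = {\<theta> a \<otimes> p, \<theta> b \<otimes> p}" using pab by auto
    have "bad p a b"
    proof (cases "3 \<le> m")
      case True
      then show ?thesis using bad[OF e] ab by simp
    next
      case False
      then have "m = 2" "\<not> trivial_on W \<theta> J" using I2 by auto
      then have "\<theta> b = a" using th trivial_on_iff[OF JS] ab by auto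
      then show ?thesis using e pab \<open>m = 2\<close> by (simp add: bad_def)
    qed
    moreover have "J = {a} \<union> {b}" "{a} \<inter> {b} = {}" using ab by auto
    ultimately show ?thesis using p by blast
  qed
qed

end

theorem theorem1p2:
  fixes W :: "('a, 'b) monoid_scheme" and S :: "'a set" and \<theta> :: "'a \<Rightarrow> 'a"
  assumes "coxeter_system W S"
    and "involutive_automorphism W S \<theta>"
  shows "connects_reduced_expressions W S \<theta> (special_subsets W S \<theta>) \<and>
    (\<forall>K. (\<forall>J\<in>K. J \<subseteq> S \<and> \<theta> ` J = J \<and> finite (generate W J)) \<and>
         connects_reduced_expressions W S \<theta> K \<longrightarrow>
         special_subsets W S \<theta> \<subseteq> K)"
proof -
  interpret coxeter_system W S by fact
  interpret twisted_coxeter W S \<theta> by unfold_locales fact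
  show ?thesis
  proof (intro conjI allI impI subsetI)
    show "connects_reduced_expressions W S \<theta> (special_subsets W S \<theta>)"
    proof (rule connects_if_split_longest)
      fix w A B assume *: "w \<in> I" "{s \<in> S. desc w s} = A \<union> B" "A \<inter> B = {}" "A \<noteq> {}" "B \<noteq> {}"
        "\<forall>a\<in>A. \<forall>b\<in>B. bad w a b"
      then show "\<exists>J\<in>special_subsets W S \<theta>. longest_element W J = w"
        using split_special[OF *(1-5)] by blast
    qed
  next
    fix K J
    assume K: "(\<forall>J\<in>K. J \<subseteq> S \<and> \<theta> ` J = J \<and> finite (generate W J)) \<and>
        connects_reduced_expressions W S \<theta> K"
      and J: "J \<in> special_subsets W S \<theta>"
    obtain p A B where split: "longest J p" "J = A \<union> B" "A \<inter> B = {}" "A \<noteq> {}" "B \<noteq> {}"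
      "\<forall>a\<in>A. \<forall>b\<in>B. bad p a b" using special_split[OF J] by blast
    have "J \<subseteq> S" "\<theta> ` J = J" using J by (auto simp: special_subsets_def)
    then show "J \<in> K"
    proof (rule necessary[OF _ _ split(1-5)])
      show "bad p a b" if "a \<in> A" "b \<in> B" for a b using split(6) that by blast
      show "J' \<subseteq> S \<and> finite (generate W J')" if "J' \<in> K" for J' using K that by blast
    qed (use K in blast)
  qed
qed

end
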